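(* Let $K$ be a non-archimedean local field of characteristic zero. If $G$ is a discrete subgroup of $\mathrm{PSL}_2(K)$ with no $2$-torsion, then $G$ is a free product whose possible factors are cyclic groups and direct products of a finite cyclic group with an infinite cyclic group.
   Context: Discreteness refers to the topology on $\mathrm{PSL}_2(K)$ induced from the topology of $K$. "No $2$-torsion" means $G$ has no element of order $2$. *)

theory Defs
  imports "HOL-Algebra.Algebra"
begin

definition nonarch_local_field :: "('a::field_char_0 \<Rightarrow> real) \<Rightarrow> bool" where
  "nonarch_local_field v \<longleftrightarrow>
     (\<forall>x. v x \<ge> 0) \<and> (\<forall>x. v x = 0 \<longleftrightarrow> x = 0) \<and>
     (\<forall>x y. v (x * y) = v x * v y) \<and>
     (\<forall>x y. v (x + y) \<le> max (v x) (v y)) \<and>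
     (\<exists>\<pi>. 0 < v \<pi> \<and> v \<pi> < 1 \<and> (\<forall>x. x \<noteq> 0 \<longrightarrow> (\<exists>k::int. v x = v \<pi> powi k))) \<and>
     (\<forall>(s::nat \<Rightarrow> 'a). (\<forall>e>0. \<exists>N. \<forall>m\<ge>N. \<forall>n\<ge>N. v (s m - s n) < e) \<longrightarrow>
         (\<exists>L. \<forall>e>0. \<exists>N. \<forall>n\<ge>N. v (s n - L) < e)) \<and>
     finite ((\<lambda>x. {y. v y \<le> 1 \<and> v (x - y) < 1}) ` {x. v x \<le> 1})"

type_synonym 'a m2 = "'a \<times> 'a \<times> 'a \<times> 'a"  \<comment> \<open>(a,b,c,d) = [[a,b],[c,d]]\<close>

definition m2_mult :: "'a::comm_ring_1 m2 \<Rightarrow> 'a m2 \<Rightarrow> 'a m2" where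
  "m2_mult = (\<lambda>(a,b,c,d) (e,f,g,h). (a*e + b*g, a*f + b*h, c*e + d*g, c*f + d*h))"

definition m2_neg :: "'a::comm_ring_1 m2 \<Rightarrow> 'a m2" where
  "m2_neg = (\<lambda>(a,b,c,d). (-a, -b, -c, -d))"

definition m2_one :: "'a::comm_ring_1 m2" where
  "m2_one = (1, 0, 0, 1)"

definition SL2 :: "'a::comm_ring_1 m2 set" where
  "SL2 = {(p,q,r,t). p*t - q*r = 1}"

definition psl2_class :: "'a::comm_ring_1 m2 \<Rightarrow> 'a m2 set" where
  "psl2_class A = {A, m2_neg A}"

definition PSL2 :: "('a::field m2 set) monoid" where
  "PSL2 = \<lparr>carrier = psl2_class ` SL2,
           monoid.mult = (\<lambda>P Q. {m2_mult A B | A B. A \<in> P \<and> B \<in> Q}),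
           one = psl2_class m2_one\<rparr>"

definition m2_dist :: "('a::field \<Rightarrow> real) \<Rightarrow> 'a m2 \<Rightarrow> 'a m2 \<Rightarrow> real" where
  "m2_dist v = (\<lambda>(a,b,c,d) (e,f,g,h). max (max (v (a - e)) (v (b - f))) (max (v (c - g)) (v (d - h))))"

text \<open>Quotient topology: a set S of points of PSL_2(K) is open iff its preimage
  (the union of the classes in S) is open in SL_2(K) with the subspace topology.\<close>

definition psl2_open :: "('a::field \<Rightarrow> real) \<Rightarrow> 'a m2 set set \<Rightarrow> bool" where
  "psl2_open v S \<longleftrightarrow> S \<subseteq> carrier PSL2 \<and>
     (\<forall>A \<in> \<Union>S. \<exists>e>0. \<forall>B \<in> SL2. m2_dist v A B < e \<longrightarrow> B \<in> \<Union>S)"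

definition psl2_discrete :: "('a::field \<Rightarrow> real) \<Rightarrow> 'a m2 set set \<Rightarrow> bool" where
  "psl2_discrete v G \<longleftrightarrow> G \<subseteq> carrier PSL2 \<and>
     (\<forall>g \<in> G. \<exists>U. psl2_open v U \<and> U \<inter> G = {g})"

definition free_product_of :: "('g, 'b) monoid_scheme \<Rightarrow> 'g set set \<Rightarrow> bool" where
  "free_product_of G \<H> \<longleftrightarrow>
     (\<forall>H \<in> \<H>. subgroup H G) \<and>
     generate G (\<Union>\<H>) = carrier G \<and>
     (\<forall>w :: ('g set \<times> 'g) list.
        w \<noteq> [] \<and>
        (\<forall>(H, h) \<in> set w. H \<in> \<H> \<and> h \<in> H \<and> h \<noteq> \<one>\<^bsub>G\<^esub>) \<and>
        (\<forall>i. Suc i < length w \<longrightarrow> fst (w ! i) \<noteq> fst (w ! Suc i))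
        \<longrightarrow> foldr (\<lambda>(H, h) x. h \<otimes>\<^bsub>G\<^esub> x) w \<one>\<^bsub>G\<^esub> \<noteq> \<one>\<^bsub>G\<^esub>)"

end

theory Submission
  imports Defs "HOL-Algebra.Algebraic_Closure_Type"
begin

text \<open>
  \<open>PSL\<^sub>2(K)\<close> acts on the Bruhat--Tits tree, whose vertices are the homothety classes of norms on
  \<open>K\<^sup>2\<close>. By discreteness the vertex stabilizers in \<open>G\<close> are finite; without 2-torsion they are
  abelian, because centralizers of nontrivial torsion elements are abelian and self-normalizing.
  Collapsing all edges with nontrivial stabilizer gives a tree on which \<open>G\<close> acts with trivial
  edge stabilizers, so \<open>G\<close> is the free product of stabilizers of collapsed vertices and infinite
  cyclic groups. Since commuting is transitive on nontrivial torsion elements, a nontrivial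
  stabilizer of a collapsed vertex lies in the centralizer of one such element, a torus, and
  discrete subgroups of tori are cyclic or the product of a finite and an infinite cyclic group.

  Trees are encoded by their halfspaces: a pocset of subsets of a set of points. Collapsing edges
  then just means to drop halfspaces, and points that are not separated are regarded as equal.
\<close>

text \<open>Bass-Serre theory is replaced by ping-pong on the group itself: the orbit of one base
  point decides where a group element lies, and no quotient graph of groups is formed. The absence
  of 2-torsion enters three times. Trace zero means square minus one, an involution in
  \<open>PSL2\<close>. Hence commuting classes have commuting lifts, since anticommuting lifts have
  trace zero; a torus is its own normalizer, since other normalizing elements have trace zero as
  well; and an edge with trivial stabilizer is not inverted, since the inverting element would be an
  involution. Characteristic zero makes unipotent elements torsion-free, so nontrivial torsion
  elements have two different eigenvalues. The finite residue field makes bounded sets totally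
  bounded, which with discreteness gives finite vertex stabilizers. Completeness puts the
  eigenvalues of an element with trace of absolute value above one into K, where the valuation of an
  eigenvalue splits off the infinite cyclic factor.\<close>

subsection \<open>Free products by ping-pong\<close>

text \<open>By induction, a reduced word whose first letter lies in H evaluates into every set A
  paired with H: the value of its tail lies in the set of another subgroup, hence outside A, and the
  first letter throws it into A. \<open>P\<close> is a relation because one subgroup may come with
  several sets; trivial stabilizers of different points coincide.\<close>

lemma (in group) free_product_of_pingpong:
  fixes P :: "('a set \<times> 'a set) set"
  assumes sub: "\<And>H A. (H, A) \<in> P \<Longrightarrow> subgroup H G"
    and gen: "generate G (\<Union>(fst ` P)) = carrier G"
    and one: "\<And>H A. (H, A) \<in> P \<Longrightarrow> \<one> \<notin> A"
    and disj: "\<And>H A K B. (H, A) \<in> P \<Longrightarrow> (K, B) \<in> P \<Longrightarrow> H \<noteq> K \<Longrightarrow> A \<inter> B = {}"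
    and step: "\<And>H A a g. (H, A) \<in> P \<Longrightarrow> a \<in> H \<Longrightarrow> a \<noteq> \<one> \<Longrightarrow> g \<in> carrier G \<Longrightarrow> g \<notin> A \<Longrightarrow> a \<otimes> g \<in> A"
  shows "free_product_of G (fst ` P)"
proof -
  define red where "red = (\<lambda>w. (\<forall>p \<in> set w. fst p \<in> fst ` P \<and> snd p \<in> fst p \<and> snd p \<noteq> \<one>) \<and>
        (\<forall>i. Suc i < length w \<longrightarrow> fst (w ! i) \<noteq> fst (w ! Suc i)))"
  define ev where "ev = (\<lambda>w::('a set \<times> 'a) list. foldr (\<lambda>(H, h) x. h \<otimes> x) w \<one>)"
  have main: "ev w \<in> carrier G \<and> (\<forall>A. (fst (hd w), A) \<in> P \<longrightarrow> ev w \<in> A)" if "w \<noteq> []" "red w" for w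
    using that
  proof (induction w)
    case Nil
    then show ?case by simp
  next
    case (Cons p w)
    obtain H h where p: "p = (H, h)" by force
    have hH: "H \<in> fst ` P" "h \<in> H" "h \<noteq> \<one>" using Cons.prems p by (auto simp: red_def)
    then have hc: "h \<in> carrier G" using sub subgroup.mem_carrier by fastforce
    have ev: "ev (p # w) = h \<otimes> ev w" by (simp add: ev_def p)
    show ?case
    proof (cases "w = []")
      case True
      have "ev w = \<one>" by (simp add: ev_def True)
      then show ?thesis using ev hH hc one step[of H _ h \<one>] by (auto simp: p)
    next
      case False
      have adj: "fst ((p # w) ! i) \<noteq> fst ((p # w) ! Suc i)" if "Suc i < length (p # w)" for i
        using Cons.prems(2) that unfolding red_def by simp
      have rw: "red w"
        unfolding red_def
      proof (intro conjI allI impI)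
        fix i assume "Suc i < length w"
        then show "fst (w ! i) \<noteq> fst (w ! Suc i)" using adj[of "Suc i"] by simp
      qed (use Cons.prems(2) in \<open>simp add: red_def\<close>)
      note IH = Cons.IH[OF False rw]
      have ne: "H \<noteq> fst (hd w)"
        using adj[of 0] False p by (simp add: hd_conv_nth)
      have "fst (hd w) \<in> fst ` P" using rw hd_in_set[OF False] unfolding red_def by auto
      then obtain B where B: "(fst (hd w), B) \<in> P" by force
      have "ev w \<notin> A" if "(H, A) \<in> P" for A
        using disj[OF that B ne] IH B by blast
      then show ?thesis using ev hH hc IH step by (auto simp: p)
    qed
  qed
  have "ev w \<noteq> \<one>" if "w \<noteq> []" "red w" for w
  proof -
    have "hd w \<in> set w" using that by simp
    then have "fst (hd w) \<in> fst ` P" using that(2) unfolding red_def by auto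
    then obtain A where "(fst (hd w), A) \<in> P" by force
    then show ?thesis using main[OF that] one by metis
  qed
  then show ?thesis
    unfolding free_product_of_def red_def ev_def case_prod_beta using sub gen by fastforce
qed

subsection \<open>Systems of halfspaces\<close>

text \<open>A halfspace stands for the oriented edge leading into it. Nesting says that walls do not
  cross, which makes the structure a tree; \<open>finite_sep\<close> makes distances finite;
  \<open>wall_edge\<close> supplies two end points that are separated by this edge alone.\<close>

locale wall_space =
  fixes V :: "'x set" and W :: "'x set set"
  assumes wall_subset: "h \<in> W \<Longrightarrow> h \<subseteq> V"
    and wall_compl: "h \<in> W \<Longrightarrow> V - h \<in> W"
    and nested: "h \<in> W \<Longrightarrow> k \<in> W \<Longrightarrow> h \<subseteq> k \<or> k \<subseteq> h \<or> h \<inter> k = {} \<or> h \<union> k = V"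
    and finite_sep: "x \<in> V \<Longrightarrow> y \<in> V \<Longrightarrow> finite {h \<in> W. x \<notin> h \<and> y \<in> h}"
    and wall_edge: "h \<in> W \<Longrightarrow> \<exists>x\<in>V - h. \<exists>y\<in>h. {k \<in> W. x \<notin> k \<and> y \<in> k} = {h}"
begin

text \<open>Separation is oriented: these are the halfspaces entered on the way from x to y, and
  their number is the tree distance.\<close>

definition sep :: "'x \<Rightarrow> 'x \<Rightarrow> 'x set set" where
  "sep x y = {h \<in> W. x \<notin> h \<and> y \<in> h}"

lemma mem_sep: "h \<in> sep x y \<longleftrightarrow> h \<in> W \<and> x \<notin> h \<and> y \<in> h"
  by (simp add: sep_def)

definition eqv :: "'x \<Rightarrow> 'x \<Rightarrow> bool" where
  "eqv x y \<longleftrightarrow> sep x y = {}"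

text \<open>The largest halfspace entered on the way from x to y is the first edge of the
  geodesic.\<close>

definition dir :: "'x \<Rightarrow> 'x \<Rightarrow> 'x set" where
  "dir x y = (SOME h. h \<in> sep x y \<and> (\<forall>k \<in> sep x y. k \<subseteq> h))"

text \<open>A tail of the oriented edge h; accordingly \<open>origin (V - h) y\<close> says that y
  is a head of it.\<close>

definition origin :: "'x set \<Rightarrow> 'x \<Rightarrow> bool" where
  "origin h x \<longleftrightarrow> x \<in> V \<and> (\<exists>y\<in>V. sep x y = {h})"

lemma sep_compl: "x \<in> V \<Longrightarrow> y \<in> V \<Longrightarrow> h \<in> W \<Longrightarrow> V - h \<in> sep x y \<longleftrightarrow> h \<in> sep y x"
  by (auto simp: mem_sep wall_compl)

lemma double_compl: "h \<in> W \<Longrightarrow> V - (V - h) = h"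
  using wall_subset by blast

lemma sep_swap: "x \<in> V \<Longrightarrow> y \<in> V \<Longrightarrow> sep y x = (\<lambda>h. V - h) ` sep x y"
proof (intro equalityI subsetI)
  fix h assume "x \<in> V" "y \<in> V" "h \<in> sep y x"
  then have "V - h \<in> sep x y" "h = V - (V - h)"
    using sep_compl double_compl by (auto simp: mem_sep)
  then show "h \<in> (\<lambda>h. V - h) ` sep x y" by blast
qed (auto simp: mem_sep wall_compl)

lemma eqv_refl [simp]: "eqv x x"
  by (simp add: eqv_def sep_def)

lemma eqv_sym: "x \<in> V \<Longrightarrow> y \<in> V \<Longrightarrow> eqv x y \<Longrightarrow> eqv y x"
  by (simp add: eqv_def sep_swap[of x y])

lemma eqv_wall: "x \<in> V \<Longrightarrow> y \<in> V \<Longrightarrow> eqv x y \<Longrightarrow> h \<in> W \<Longrightarrow> x \<in> h \<longleftrightarrow> y \<in> h"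
  using eqv_sym[of x y] by (auto simp: eqv_def sep_def)

lemma eqv_trans: "x \<in> V \<Longrightarrow> y \<in> V \<Longrightarrow> z \<in> V \<Longrightarrow> eqv x y \<Longrightarrow> eqv y z \<Longrightarrow> eqv x z"
  using eqv_wall[of x y] eqv_wall[of y z] by (simp add: eqv_def[of x z] sep_def)

lemma sep_cong:
  assumes "x \<in> V" "x' \<in> V" "y \<in> V" "y' \<in> V" "eqv x x'" "eqv y y'"
  shows "sep x y = sep x' y'"
  using eqv_wall[OF assms(1,2,5)] eqv_wall[OF assms(3,4,6)] unfolding sep_def by blast

text \<open>Two halfspaces that contain y and miss x neither are disjoint nor cover
  \<open>V\<close>, so they are nested. A finite nonempty chain has a largest member.\<close>

lemma dir_max:
  assumes "x \<in> V" "y \<in> V" "\<not> eqv x y"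
  shows "dir x y \<in> sep x y" "k \<in> sep x y \<Longrightarrow> k \<subseteq> dir x y"
proof -
  have "\<exists>h. h \<in> sep x y \<and> (\<forall>k \<in> sep x y. k \<subseteq> h)"
  proof -
    have fin: "finite (sep x y)" "sep x y \<noteq> {}"
      using finite_sep[OF assms(1,2)] assms(3) unfolding sep_def[symmetric] eqv_def by simp_all
    then obtain h where h: "h \<in> sep x y" "\<forall>k\<in>sep x y. h \<subseteq> k \<longrightarrow> h = k"
      using finite_has_maximal[of "sep x y"] by blast
    have "k \<subseteq> h" if "k \<in> sep x y" for k
    proof -
      have "h \<subseteq> k \<or> k \<subseteq> h \<or> h \<inter> k = {} \<or> h \<union> k = V"
        using h(1) that nested by (auto simp: mem_sep)
      then show ?thesis using h that assms by (auto simp: mem_sep)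
    qed
    then show ?thesis using h by blast
  qed
  then have "dir x y \<in> sep x y \<and> (\<forall>k \<in> sep x y. k \<subseteq> dir x y)"
    unfolding dir_def by (rule someI_ex)
  then show "dir x y \<in> sep x y" "k \<in> sep x y \<Longrightarrow> k \<subseteq> dir x y" by auto
qed

lemma dir_eqI:
  assumes "x \<in> V" "y \<in> V" "h \<in> sep x y" "\<And>k. k \<in> sep x y \<Longrightarrow> k \<subseteq> h"
  shows "dir x y = h"
  using dir_max[of x y] assms by (metis empty_iff eqv_def subset_antisym)

lemma dir_W: "x \<in> V \<Longrightarrow> y \<in> V \<Longrightarrow> \<not> eqv x y \<Longrightarrow> dir x y \<in> W"
  using dir_max(1) by (auto simp: mem_sep)

lemma dir_mem: "x \<in> V \<Longrightarrow> y \<in> V \<Longrightarrow> \<not> eqv x y \<Longrightarrow> y \<in> dir x y \<and> x \<notin> dir x y"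
  using dir_max(1) by (auto simp: mem_sep)

lemma dir_cong:
  assumes "x \<in> V" "x' \<in> V" "y \<in> V" "y' \<in> V" "eqv x x'" "eqv y y'"
  shows "dir x y = dir x' y'"
  unfolding dir_def using sep_cong[OF assms] by simp

text \<open>If the paths from s to z and to s' part at s, then the path from s' to z runs through s.
  Indeed z lies outside \<open>dir s s'\<close>, and the complement of that halfspace is contained
  in \<open>dir s' s\<close>.\<close>

lemma dir_branch:
  assumes V: "s \<in> V" "s' \<in> V" "z \<in> V" and ne: "\<not> eqv s s'"
    and d: "eqv s z \<or> dir s z \<noteq> dir s s'"
  shows "\<not> eqv s' z \<and> dir s' z = dir s' s"
proof -
  let ?h = "dir s s'" and ?m = "dir s' s"
  have ne': "\<not> eqv s' s" using ne eqv_sym V by blast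
  have h: "?h \<in> sep s s'" using dir_max ne V by blast
  have zh: "z \<notin> ?h"
  proof
    assume z: "z \<in> ?h"
    then have hz: "?h \<in> sep s z" using h by (auto simp: mem_sep)
    then have nz: "\<not> eqv s z" by (auto simp: eqv_def)
    have "?h \<subseteq> dir s z" using dir_max(2)[of s z] hz V nz by blast
    moreover have "dir s z \<subseteq> ?h"
    proof (rule dir_max(2)[of s s'])
      have "s' \<in> dir s z" using \<open>?h \<subseteq> dir s z\<close> h by (auto simp: mem_sep)
      then show "dir s z \<in> sep s s'" using dir_max(1)[of s z] nz V by (auto simp: mem_sep)
    qed (use V ne in auto)
    ultimately show False using d nz by blast
  qed
  have "V - ?h \<in> sep s' s" using h V sep_compl by (auto simp: mem_sep wall_compl)
  then have "V - ?h \<subseteq> ?m" using dir_max(2)[of s' s] ne' V by blast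
  then have zm: "z \<in> ?m" using zh V by blast
  have m: "?m \<in> sep s' s" using dir_max ne' V by blast
  then have mz: "?m \<in> sep s' z" using zm by (auto simp: mem_sep)
  then have nz: "\<not> eqv s' z" by (auto simp: eqv_def)
  have "?m \<subseteq> dir s' z" using dir_max(2)[of s' z] nz V mz by blast
  moreover have "dir s' z \<subseteq> ?m"
  proof (rule dir_max(2)[of s' s])
    have "s \<in> dir s' z" using \<open>?m \<subseteq> dir s' z\<close> m by (auto simp: mem_sep)
    then show "dir s' z \<in> sep s' s" using dir_max(1)[of s' z] nz V by (auto simp: mem_sep)
  qed (use V ne' in auto)
  ultimately show ?thesis using nz by blast
qed

lemma originE:
  assumes "h \<in> W" "origin h x"
  obtains y where "x \<in> V" "y \<in> V" "x \<notin> h" "y \<in> h" "sep x y = {h}" "origin (V - h) y"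
proof -
  obtain y where y: "x \<in> V" "y \<in> V" "sep x y = {h}" using assms by (auto simp: origin_def)
  then have "h \<in> sep x y" by blast
  then have "x \<notin> h" "y \<in> h" by (auto simp: mem_sep)
  have "sep y x = {V - h}" using sep_swap[of x y] y by simp
  then have "origin (V - h) y" using y by (auto simp: origin_def)
  then show ?thesis using that y \<open>x \<notin> h\<close> \<open>y \<in> h\<close> by blast
qed

lemma origin_exists:
  assumes "h \<in> W"
  shows "\<exists>x. origin h x"
proof -
  obtain x y where "x \<in> V - h" "y \<in> h" "sep x y = {h}"
    using wall_edge[OF assms] unfolding sep_def by metis
  then have "x \<in> V \<and> (\<exists>y\<in>V. sep x y = {h})" using wall_subset[OF assms] by auto
  then show ?thesis unfolding origin_def ..
qed

lemma origin_notin: "h \<in> W \<Longrightarrow> origin h x \<Longrightarrow> x \<in> V \<and> x \<notin> h"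
  by (metis originE)

text \<open>A halfspace k separating two tails of h also separates the corresponding heads, because
  h is the only halfspace between tail and head. Then all four corners of h and k are inhabited,
  against nesting.\<close>

lemma origin_unique:
  assumes h: "h \<in> W" and x: "origin h x" and x': "origin h x'"
  shows "eqv x x'"
proof -
  obtain y where y: "x \<in> V" "y \<in> V" "x \<notin> h" "y \<in> h" "sep x y = {h}" "origin (V - h) y" by (rule originE[OF h x]) (rule that)
  obtain y' where y': "x' \<in> V" "y' \<in> V" "x' \<notin> h" "y' \<in> h" "sep x' y' = {h}" "origin (V - h) y'" by (rule originE[OF h x']) (rule that)
  have False if k: "k \<in> sep x x'" for k
  proof -
    have kW: "k \<in> W" and xk: "x \<notin> k" "x' \<in> k" using k by (auto simp: mem_sep)
    have "k \<noteq> h" using xk y' by blast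
    then have yk: "y \<notin> k" using y(5) kW xk by (auto simp: mem_sep)
    have "y' \<in> k"
    proof (rule ccontr)
      assume "y' \<notin> k"
      then have "V - k \<in> sep x' y'" using y'(1,2) xk kW wall_compl by (simp add: mem_sep)
      then have "V - k = h" using y'(5) by simp
      then show False using xk y by blast
    qed
    then show False using nested[OF h kW] y y' xk yk by blast
  qed
  then show ?thesis by (auto simp: eqv_def)
qed

lemma origin_cong:
  assumes "origin h x" "x' \<in> V" "eqv x x'"
  shows "origin h x'"
  using assms sep_cong unfolding origin_def by (metis eqv_refl)

text \<open>A halfspace k separating x from a tail s of \<open>dir x z\<close> also contains the
  head, hence all of \<open>dir x z\<close>. So k is entered on the way to z and is strictly larger
  than the largest such halfspace.\<close>

lemma origin_dir:
  assumes V: "x \<in> V" "z \<in> V" and ne: "\<not> eqv x z"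
  shows "origin (dir x z) x"
proof -
  let ?h = "dir x z"
  have h: "?h \<in> W" "x \<notin> ?h" "z \<in> ?h" using dir_W dir_mem assms by auto
  obtain s where s: "origin ?h s" using origin_exists h by blast
  then obtain t where t: "s \<in> V" "t \<in> V" "s \<notin> ?h" "t \<in> ?h" "sep s t = {?h}" "origin (V - ?h) t"
    by (rule originE[OF h(1)]) (rule that)
  have False if k: "k \<in> sep x s" for k
  proof -
    have kW: "k \<in> W" and xk: "x \<notin> k" "s \<in> k" using k by (auto simp: mem_sep)
    have tk: "t \<in> k"
    proof (rule ccontr)
      assume "t \<notin> k"
      then have "V - k \<in> sep s t" using t(1,2) xk kW wall_compl by (simp add: mem_sep)
      then have "V - k = ?h" using t(5) by simp
      then show False using xk h V by blast
    qed
    then have "?h \<subseteq> k" using nested[OF h(1) kW] xk V t(1-4) h by blast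
    then have "k \<in> sep x z" using kW xk h by (auto simp: mem_sep)
    then have "k \<subseteq> ?h" using dir_max assms by blast
    then show False using xk t by blast
  qed
  then have "eqv x s" by (auto simp: eqv_def)
  then show ?thesis using origin_cong[OF s V(1)] eqv_sym V t by blast
qed

lemma sep_of_origins:
  assumes h: "h \<in> W" and x: "origin h x" and y: "origin (V - h) y"
  shows "sep x y = {h}"
proof -
  obtain z where z: "x \<in> V" "z \<in> V" "x \<notin> h" "z \<in> h" "sep x z = {h}" "origin (V - h) z" by (rule originE[OF h x]) (rule that)
  have "eqv z y" using origin_unique[OF wall_compl[OF h] z(6) y] .
  moreover have "y \<in> V" using y by (auto simp: origin_def)
  ultimately show ?thesis using sep_cong[of x x z y] z by simp
qed

text \<open>This turns membership in a halfspace into a statement about the first step from its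
  tail, the form in which the ping-pong sets are compared.\<close>

lemma dir_eq_iff_mem:
  assumes h: "h \<in> W" and x: "origin h x" and z: "z \<in> V"
  shows "z \<in> h \<longleftrightarrow> \<not> eqv x z \<and> dir x z = h"
proof
  assume zh: "z \<in> h"
  obtain y where y: "x \<in> V" "y \<in> V" "x \<notin> h" "y \<in> h" "sep x y = {h}" "origin (V - h) y" by (rule originE[OF h x]) (rule that)
  have hs: "h \<in> sep x z" using h y zh by (auto simp: mem_sep)
  then have ne: "\<not> eqv x z" by (auto simp: eqv_def)
  have "h \<subseteq> dir x z" using dir_max(2)[of x z h] hs ne y z by blast
  then have "y \<in> dir x z" using y(4) by blast
  then have "dir x z \<in> sep x y" using dir_max(1)[OF y(1) z ne] by (simp add: mem_sep)
  then show "\<not> eqv x z \<and> dir x z = h" using y(5) ne by simp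
next
  assume "\<not> eqv x z \<and> dir x z = h"
  then show "z \<in> h" using dir_mem[of x z] x z by (auto simp: origin_def)
qed

text \<open>Crossing the first edge removes it from the separating set and adds nothing, so the
  distance to z can serve as an induction measure.\<close>

lemma compl_dir_step:
  assumes V: "x \<in> V" "z \<in> V" and ne: "\<not> eqv x z" and y: "origin (V - dir x z) y"
  shows "sep y z \<subset> sep x z"
proof -
  let ?h = "dir x z"
  have h: "?h \<in> W" "z \<in> ?h" using dir_W dir_mem V ne by auto
  have xy: "sep x y = {?h}" using sep_of_origins[OF h(1) origin_dir[OF V ne] y] .
  have yV: "y \<in> V" using y by (simp add: origin_def)
  have hy: "?h \<notin> sep y z" using xy by (auto simp: mem_sep)
  have "k \<in> sep x z" if k: "k \<in> sep y z" for k
  proof (rule ccontr)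
    assume "k \<notin> sep x z"
    then have "k \<in> sep y x" using k by (auto simp: mem_sep)
    then have "V - k \<in> sep x y" using V yV sep_swap[of y x] by blast
    then have "V - k = ?h" using xy by simp
    then show False using k h by (auto simp: mem_sep)
  qed
  moreover have "?h \<in> sep x z" using dir_max V ne by blast
  ultimately show ?thesis using hy by blast
qed

end

context wall_space
begin

text \<open>Connectedness of the tree as an induction rule: walk from x to z edge by edge. The case
  \<open>cong\<close> passes between points of one vertex.\<close>

lemma reach_induct [consumes 2, case_names base step cong]:
  assumes x: "x \<in> V" and z: "z \<in> V"
    and base: "A x"
    and step: "\<And>x h t. x \<in> V \<Longrightarrow> A x \<Longrightarrow> h \<in> W \<Longrightarrow> origin h x \<Longrightarrow> origin (V - h) t \<Longrightarrow> A t"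
    and cong: "\<And>x y. x \<in> V \<Longrightarrow> y \<in> V \<Longrightarrow> A x \<Longrightarrow> eqv x y \<Longrightarrow> A y"
  shows "A z"
proof -
  have "x \<in> V \<Longrightarrow> A x \<Longrightarrow> A z" for x
  proof (induction "card (sep x z)" arbitrary: x rule: less_induct)
    case less
    show ?case
    proof (cases "eqv x z")
      case True
      then show ?thesis using cong less.prems z by blast
    next
      case False
      have hW: "dir x z \<in> W" using dir_W less.prems(1) z False .
      obtain t where t: "origin (V - dir x z) t" using origin_exists[OF wall_compl[OF hW]] by blast
      have tV: "t \<in> V" using t by (simp add: origin_def)
      have "sep t z \<subset> sep x z" using compl_dir_step[OF less.prems(1) z False t] .
      moreover have "finite (sep x z)" unfolding sep_def using finite_sep[OF less.prems(1) z] .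
      ultimately have "card (sep t z) < card (sep x z)" by (rule psubset_card_mono[rotated])
      moreover have "A t" using step[OF less.prems hW origin_dir[OF less.prems(1) z False] t] .
      ultimately show ?thesis using less.hyps tV by blast
    qed
  qed
  then show ?thesis using x base by blast
qed

end

subsection \<open>Groups acting on systems of halfspaces\<close>

locale wall_action = wall_space V W + group G for V :: "'x set" and W :: "'x set set" and G :: "('g, 'm) monoid_scheme" (structure) +
  fixes act :: "'g \<Rightarrow> 'x \<Rightarrow> 'x"
  assumes act_closed: "g \<in> carrier G \<Longrightarrow> x \<in> V \<Longrightarrow> act g x \<in> V"
    and act_one: "x \<in> V \<Longrightarrow> act \<one> x = x"
    and act_mult: "g \<in> carrier G \<Longrightarrow> h \<in> carrier G \<Longrightarrow> x \<in> V \<Longrightarrow> act (g \<otimes> h) x = act g (act h x)"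
    and act_wall: "g \<in> carrier G \<Longrightarrow> w \<in> W \<Longrightarrow> act g ` w \<in> W"
begin

lemma act_inv: "g \<in> carrier G \<Longrightarrow> x \<in> V \<Longrightarrow> act (inv g) (act g x) = x"
  by (metis act_mult act_one inv_closed l_inv)

lemma act_inv': "g \<in> carrier G \<Longrightarrow> x \<in> V \<Longrightarrow> act g (act (inv g) x) = x"
  by (metis act_mult act_one inv_closed r_inv)

lemma act_inj: "g \<in> carrier G \<Longrightarrow> x \<in> V \<Longrightarrow> y \<in> V \<Longrightarrow> act g x = act g y \<longleftrightarrow> x = y"
  using act_inv by metis

lemma act_mem: "g \<in> carrier G \<Longrightarrow> x \<in> V \<Longrightarrow> w \<in> W \<Longrightarrow> act g x \<in> act g ` w \<longleftrightarrow> x \<in> w"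
  using act_inj wall_subset by (auto simp: image_iff subset_iff)

lemma image_one: "w \<in> W \<Longrightarrow> act \<one> ` w = w"
  using act_one wall_subset by (force simp: image_iff)

lemma image_mult:
  assumes "g \<in> carrier G" "h \<in> carrier G" "w \<in> W"
  shows "act (g \<otimes> h) ` w = act g ` act h ` w"
proof -
  have "act (g \<otimes> h) x = (act g \<circ> act h) x" if "x \<in> w" for x
    using act_mult[OF assms(1,2), of x] wall_subset[OF assms(3)] that by auto
  then show ?thesis by (metis image_comp image_cong)
qed

lemma image_inv: "g \<in> carrier G \<Longrightarrow> w \<in> W \<Longrightarrow> act (inv g) ` act g ` w = w"
  using image_mult[of "inv g" g w] image_one by simp

lemma image_inv': "g \<in> carrier G \<Longrightarrow> w \<in> W \<Longrightarrow> act g ` act (inv g) ` w = w"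
  using image_mult[of g "inv g" w] image_one by simp

lemma image_compl:
  assumes "g \<in> carrier G" "w \<in> W"
  shows "act g ` (V - w) = V - act g ` w"
proof (intro equalityI subsetI)
  fix x assume "x \<in> act g ` (V - w)"
  then obtain y where "x = act g y" "y \<in> V" "y \<notin> w" by blast
  then show "x \<in> V - act g ` w" using act_closed act_mem[OF assms(1) _ assms(2), of y] assms(1) by simp
next
  fix x assume x: "x \<in> V - act g ` w"
  then have "act (inv g) x \<in> V - w"
    using assms act_closed act_inv' by (metis DiffD1 DiffD2 DiffI image_eqI inv_closed)
  then show "x \<in> act g ` (V - w)" using x act_inv' assms by (metis DiffD1 image_eqI)
qed

lemma sep_act:
  assumes g: "g \<in> carrier G" and V: "x \<in> V" "y \<in> V"
  shows "sep (act g x) (act g y) = (`) (act g) ` sep x y"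
proof (intro equalityI subsetI)
  fix w assume w: "w \<in> sep (act g x) (act g y)"
  then have wW: "w \<in> W" by (simp add: mem_sep)
  define u where "u = act (inv g) ` w"
  have uW: "u \<in> W" and wu: "w = act g ` u" using act_wall image_inv' g wW by (auto simp: u_def)
  have "u \<in> sep x y" using w uW V g act_mem[OF g _ uW] by (simp add: mem_sep wu)
  then show "w \<in> (`) (act g) ` sep x y" using wu by blast
next
  fix w assume "w \<in> (`) (act g) ` sep x y"
  then obtain u where "u \<in> sep x y" "w = act g ` u" by blast
  then show "w \<in> sep (act g x) (act g y)" using act_mem act_wall g V by (simp add: mem_sep)
qed

lemma eqv_act: "g \<in> carrier G \<Longrightarrow> x \<in> V \<Longrightarrow> y \<in> V \<Longrightarrow> eqv (act g x) (act g y) \<longleftrightarrow> eqv x y"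
  by (simp add: eqv_def sep_act)

lemma eqv_act_inv: "g \<in> carrier G \<Longrightarrow> x \<in> V \<Longrightarrow> y \<in> V \<Longrightarrow> eqv (act g x) y \<longleftrightarrow> eqv x (act (inv g) y)"
  using eqv_act[of "inv g" "act g x" y] act_inv act_closed by simp

lemma dir_act:
  assumes "g \<in> carrier G" "x \<in> V" "y \<in> V" "\<not> eqv x y"
  shows "dir (act g x) (act g y) = act g ` dir x y"
proof (rule dir_eqI)
  show "act g ` dir x y \<in> sep (act g x) (act g y)"
    using sep_act dir_max(1) assms by blast
  fix k assume "k \<in> sep (act g x) (act g y)"
  then obtain u where "u \<in> sep x y" "k = act g ` u" using sep_act assms by auto
  then show "k \<subseteq> act g ` dir x y" using dir_max(2)[of x y u] assms by blast
qed (use assms act_closed in auto)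

lemma origin_act:
  assumes "g \<in> carrier G" "origin w x"
  shows "origin (act g ` w) (act g x)"
proof -
  obtain y where y: "x \<in> V" "y \<in> V" "sep x y = {w}" using assms(2) by (auto simp: origin_def)
  then have "sep (act g x) (act g y) = {act g ` w}" using sep_act[OF assms(1) y(1,2)] by simp
  then show ?thesis using act_closed assms(1) y unfolding origin_def by blast
qed

definition Stab :: "'x \<Rightarrow> 'g set" where
  "Stab x = {g \<in> carrier G. eqv (act g x) x}"

lemma subgroup_Stab:
  assumes x: "x \<in> V"
  shows "subgroup (Stab x) G"
proof
  show "Stab x \<subseteq> carrier G" by (auto simp: Stab_def)
  show "\<one> \<in> Stab x" using x act_one by (simp add: Stab_def)
next
  fix g h assume "g \<in> Stab x" "h \<in> Stab x"
  then have g: "g \<in> carrier G" "eqv (act g x) x" and h: "h \<in> carrier G" "eqv (act h x) x"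
    by (auto simp: Stab_def)
  have "eqv (act g (act h x)) (act g x)" using eqv_act h g x act_closed by blast
  then have "eqv (act g (act h x)) x" using eqv_trans[OF _ _ x _ g(2)] act_closed g h x by blast
  then show "g \<otimes> h \<in> Stab x" using g h x act_mult by (simp add: Stab_def)
next
  fix g assume "g \<in> Stab x"
  then have g: "g \<in> carrier G" "eqv (act g x) x" by (auto simp: Stab_def)
  then have "eqv x (act (inv g) x)" using eqv_act_inv x by blast
  then show "inv g \<in> Stab x" using eqv_sym x g act_closed by (simp add: Stab_def)
qed

end

section \<open>Free actions on edges and the lift of a maximal subtree of the quotient\<close>

locale free_wall_action = wall_action +
  assumes wall_free: "g \<in> carrier G \<Longrightarrow> w \<in> W \<Longrightarrow> act g ` w = w \<Longrightarrow> g = \<one>"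
    and no_inversion: "g \<in> carrier G \<Longrightarrow> w \<in> W \<Longrightarrow> act g ` w \<noteq> V - w"
begin

text \<open>The third condition allows at most one point of S in each orbit of vertices. The fourth
  is connectedness; it speaks only of the first step towards s', since iterating it yields the whole
  geodesic.\<close>

definition lifted_tree :: "'a \<Rightarrow> 'a set \<Rightarrow> bool" where
  "lifted_tree x0 S \<longleftrightarrow> S \<subseteq> V \<and> x0 \<in> S \<and>
     (\<forall>s\<in>S. \<forall>t\<in>S. \<forall>g\<in>carrier G. eqv (act g s) t \<longrightarrow> s = t) \<and>
     (\<forall>s\<in>S. \<forall>s'\<in>S. s \<noteq> s' \<longrightarrow> (\<exists>t\<in>S. origin (V - dir s s') t))"

lemma lifted_tree_not_eqv:
  assumes "lifted_tree x0 S" "s \<in> S" "t \<in> S" "s \<noteq> t"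
  shows "\<not> eqv s t"
  using assms act_one one_closed unfolding lifted_tree_def by (metis subsetD)

text \<open>The new vertex becomes a leaf attached along k. No point of S lies in k: otherwise
  connectedness would put a head of k into S, and that head is equivalent to t.\<close>

lemma lifted_tree_insert:
  assumes S: "lifted_tree x0 S" and s: "s \<in> S" and k: "k \<in> W"
    and sk: "origin k s" and t: "origin (V - k) t"
    and new: "\<And>g s. g \<in> carrier G \<Longrightarrow> s \<in> S \<Longrightarrow> \<not> eqv (act g s) t"
  shows "lifted_tree x0 (insert t S)"
proof -
  have SV: "S \<subseteq> V" using S by (simp add: lifted_tree_def)
  have tV: "t \<in> V" using t by (simp add: origin_def)
  have sV: "s \<in> V" using s SV by blast
  have conn: "\<exists>t\<in>S. origin (V - dir s s') t" if "s \<in> S" "s' \<in> S" "s \<noteq> s'" for s s'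
    using S that by (simp add: lifted_tree_def)
  have new1: "\<not> eqv s' t" if "s' \<in> S" for s'
    using new[OF one_closed that] act_one SV that by auto
  have nk: "s' \<notin> k" if s': "s' \<in> S" for s'
  proof
    assume "s' \<in> k"
    then have d: "\<not> eqv s s'" "dir s s' = k" using dir_eq_iff_mem[OF k sk] SV s' by auto
    then obtain u where u: "u \<in> S" "origin (V - k) u" using conn[OF s s'] eqv_refl by metis
    show False using new1[OF u(1)] origin_unique[OF wall_compl[OF k] u(2) t] by blast
  qed
  have tk: "t \<in> k" using origin_notin[OF wall_compl[OF k] t] by blast
  have A: "eqv (act g s') t' \<Longrightarrow> s' = t'" if "g \<in> carrier G" "s' \<in> insert t S" "t' \<in> insert t S" for g s' t'
  proof -
    assume e: "eqv (act g s') t'"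
    consider "s' = t" "t' = t" | "s' = t" "t' \<in> S" | "s' \<in> S" "t' = t" | "s' \<in> S" "t' \<in> S"
      using \<open>s' \<in> insert t S\<close> \<open>t' \<in> insert t S\<close> by blast
    then show "s' = t'"
    proof cases
      case 2
      have t'V: "t' \<in> V" using SV 2 by blast
      then have "eqv t (act (inv g) t')"
        using e 2 eqv_act_inv[OF that(1) tV t'V] by simp
      then have "eqv (act (inv g) t') t"
        using eqv_sym tV act_closed[OF inv_closed[OF that(1)] t'V] by blast
      then show ?thesis using new[of "inv g" t'] that(1) 2 by simp
    next
      case 3
      then show ?thesis using new that(1) e by blast
    next
      case 4
      then show ?thesis using S e that(1) unfolding lifted_tree_def by blast
    qed simp
  qed
  have B: "\<exists>u\<in>insert t S. origin (V - dir s1 s2) u" if s12: "s1 \<in> insert t S" "s2 \<in> insert t S" "s1 \<noteq> s2" for s1 s2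
  proof -
    consider "s1 \<in> S" "s2 \<in> S" | "s1 = t" "s2 \<in> S" | "s1 = s" "s2 = t" | "s1 \<in> S" "s1 \<noteq> s" "s2 = t"
      using s12 by blast
    then show ?thesis
    proof cases
      case 1
      then show ?thesis using conn s12(3) by blast
    next
      case 2
      then have "s2 \<in> V - k" using nk SV by blast
      then have "dir t s2 = V - k" using dir_eq_iff_mem[OF wall_compl[OF k] t, of s2] by simp
      then have "origin (V - dir t s2) s" using sk double_compl k by simp
      then show ?thesis using s 2 by blast
    next
      case 3
      then have "dir s t = k" using dir_eq_iff_mem[OF k sk tV] tk by simp
      then show ?thesis using 3 t by blast
    next
      case 4
      have s1V: "s1 \<in> V" using 4 SV by blast
      have ne: "\<not> eqv s s1" using lifted_tree_not_eqv[OF S s 4(1)] 4 by blast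
      have "dir s s1 \<noteq> k" using nk[OF 4(1)] dir_eq_iff_mem[OF k sk s1V] ne by blast
      moreover have "dir s t = k" using dir_eq_iff_mem[OF k sk tV] tk by simp
      ultimately have "dir s1 t = dir s1 s" using dir_branch[OF sV s1V tV ne] by simp
      then show ?thesis using 4 conn[OF 4(1) s] by auto
    qed
  qed
  show ?thesis
    unfolding lifted_tree_def
    using A B SV tV S by (auto simp: lifted_tree_def)
qed

text \<open>Zorn gives a maximal S. An edge starting at a translate of S can be pulled back to start
  in S; if the orbit of its head were missing, the head could be added as a leaf.\<close>

lemma lifted_tree_exists:
  assumes x0: "x0 \<in> V"
  shows "\<exists>S. lifted_tree x0 S \<and> (\<forall>x\<in>V. \<exists>g\<in>carrier G. \<exists>s\<in>S. eqv (act g s) x)"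
proof -
  have "\<exists>S\<in>Collect (lifted_tree x0). \<forall>T\<in>Collect (lifted_tree x0). S \<subseteq> T \<longrightarrow> T = S"
  proof (rule subset_Zorn_nonempty)
    have "lifted_tree x0 {x0}" using x0 by (auto simp: lifted_tree_def)
    then show "Collect (lifted_tree x0) \<noteq> {}" by blast
  next
    fix C assume C: "C \<noteq> {}" "subset.chain (Collect (lifted_tree x0)) C"
    have lt: "lifted_tree x0 S" if "S \<in> C" for S using C(2) that by (auto simp: subset.chain_def)
    have two: "\<exists>S\<in>C. s \<in> S \<and> t \<in> S" if st: "s \<in> \<Union>C" "t \<in> \<Union>C" for s t
    proof -
      obtain S T where ST: "S \<in> C" "s \<in> S" "T \<in> C" "t \<in> T" using st by blast
      then have "S \<subseteq> T \<or> T \<subseteq> S" using C(2) unfolding subset_chain_def by blast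
      then show ?thesis using ST by blast
    qed
    have "lifted_tree x0 (\<Union>C)"
      unfolding lifted_tree_def
    proof (intro conjI ballI impI)
      show "\<Union>C \<subseteq> V" using lt unfolding lifted_tree_def by blast
      show "x0 \<in> \<Union>C" using lt C(1) unfolding lifted_tree_def by blast
    next
      fix s t g assume a: "s \<in> \<Union>C" "t \<in> \<Union>C" "g \<in> carrier G" "eqv (act g s) t"
      obtain S where "S \<in> C" "s \<in> S" "t \<in> S" using two[OF a(1,2)] by blast
      then show "s = t" using lt a(3,4) unfolding lifted_tree_def by blast
    next
      fix s t assume a: "s \<in> \<Union>C" "t \<in> \<Union>C" "s \<noteq> t"
      obtain S where S: "S \<in> C" "s \<in> S" "t \<in> S" using two[OF a(1,2)] by blast
      then have "\<exists>u\<in>S. origin (V - dir s t) u" using lt a(3) unfolding lifted_tree_def by blast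
      then show "\<exists>u\<in>\<Union>C. origin (V - dir s t) u" using S by blast
    qed
    then show "\<Union>C \<in> Collect (lifted_tree x0)" by simp
  qed
  then obtain S where S: "lifted_tree x0 S" and max: "\<And>T. lifted_tree x0 T \<Longrightarrow> S \<subseteq> T \<Longrightarrow> T = S" by blast
  have SV: "S \<subseteq> V" and x0S: "x0 \<in> S" using S by (auto simp: lifted_tree_def)
  have "\<exists>g\<in>carrier G. \<exists>s\<in>S. eqv (act g s) z" if z: "z \<in> V" for z
    using x0 z
  proof (induction rule: reach_induct)
    case base
    then show ?case using act_one x0 x0S by (metis eqv_refl one_closed)
  next
    case (step x h t)
    then obtain g s where g: "g \<in> carrier G" and s: "s \<in> S" "eqv (act g s) x" by blast
    have sV: "s \<in> V" using s SV by blast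
    have tV: "t \<in> V" using step by (simp add: origin_def)
    define k u where "k = act (inv g) ` h" and "u = act (inv g) t"
    have k: "k \<in> W" using act_wall g step by (simp add: k_def)
    have uV: "u \<in> V" using act_closed g tV by (simp add: u_def)
    have "eqv s (act (inv g) x)" using eqv_act_inv s(2) sV step(1) g by blast
    then have "eqv (act (inv g) x) s" using eqv_sym sV act_closed step(1) g by blast
    then have sk: "origin k s"
      using origin_act[of "inv g"] origin_cong[of k _ s] step g sV unfolding k_def by blast
    have uk: "origin (V - k) u"
      using origin_act[of "inv g" "V - h" t] step g image_compl[of "inv g" h] by (simp add: k_def u_def)
    show ?case
    proof (cases "\<exists>g\<in>carrier G. \<exists>s\<in>S. eqv (act g s) u")
      case True
      then obtain g' s' where g': "g' \<in> carrier G" "s' \<in> S" "eqv (act g' s') u" by blast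
      have s'V: "s' \<in> V" using g' SV by blast
      have "eqv (act g (act g' s')) (act g u)" using eqv_act g g' s'V uV act_closed by blast
      moreover have "act g u = t" using act_inv' g tV by (simp add: u_def)
      ultimately have "eqv (act (g \<otimes> g') s') t" using act_mult g g' s'V by simp
      then show ?thesis using g g' by blast
    next
      case False
      then have "lifted_tree x0 (insert u S)" using lifted_tree_insert[OF S s(1) k sk uk] by blast
      then have "u \<in> S" using max by blast
      then show ?thesis using False act_one uV by (metis eqv_refl one_closed)
    qed
  next
    case (cong x y)
    then show ?case using eqv_trans SV act_closed by (metis subsetD)
  qed
  then show ?thesis using S by blast
qed

end

text \<open>\<open>S\<close> lifts a maximal subtree of the quotient tree and \<open>D\<close> is a transversal of the orbits of
  halfspaces containing those that cross an edge of \<open>S\<close>. Stabilizers of points of \<open>S\<close> and the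
  elements pairing the remaining halfspaces of \<open>D\<close> play ping-pong on \<open>G\<close> itself: \<open>dom_at s\<close> is a
  fundamental domain for left translation by the stabilizer of \<open>s\<close>.\<close>

locale wall_domain = free_wall_action +
  fixes x0 :: 'a and S :: "'a set" and D :: "'a set set"
  assumes tree: "lifted_tree x0 S"
    and cover: "x \<in> V \<Longrightarrow> \<exists>g\<in>carrier G. \<exists>s\<in>S. eqv (act g s) x"
    and D_sub: "D \<subseteq> W"
    and D_origin: "w \<in> D \<Longrightarrow> \<exists>s\<in>S. origin w s"
    and D_unique: "w \<in> D \<Longrightarrow> g \<in> carrier G \<Longrightarrow> act g ` w \<in> D \<Longrightarrow> act g ` w = w"
    and D_cover: "w \<in> W \<Longrightarrow> \<exists>g\<in>carrier G. act g ` w \<in> D"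
    and D_internal: "w \<in> W \<Longrightarrow> s \<in> S \<Longrightarrow> t \<in> S \<Longrightarrow> origin w s \<Longrightarrow> origin (V - w) t \<Longrightarrow> w \<in> D"
begin

text \<open>The first edge from s towards \<open>act g x0\<close> is required to be the chosen one
  of its orbit. If \<open>act g x0\<close> lies at s there is no first edge, and the neutral element
  serves as representative.\<close>

definition dom_at :: "'a \<Rightarrow> 'b set" where
  "dom_at s = {g \<in> carrier G. if eqv s (act g x0) then g = \<one> else dir s (act g x0) \<in> D}"

text \<open>Chosen edges that leave the lifted tree. They stem from the edges of the quotient
  outside the maximal subtree and yield the infinite cyclic factors.\<close>

definition external :: "'a set \<Rightarrow> bool" where
  "external w \<longleftrightarrow> w \<in> D \<and> (\<forall>t\<in>S. \<not> origin (V - w) t)"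

definition half :: "'a set \<Rightarrow> 'b set" where
  "half w = {g \<in> carrier G. act g x0 \<in> w}"

text \<open>The element c carries u to the complement of w, so it glues the outgoing edge u to the
  reverse of w, like a stable letter of an HNN extension. Its ping-pong set is what lies beyond
  either edge.\<close>

definition pieces :: "('b set \<times> 'b set) set" where
  "pieces = {(Stab s, carrier G - dom_at s) | s. s \<in> S} \<union>
     {(generate G {c}, half w \<union> half u) | c w u. external w \<and> external u \<and> c \<in> carrier G \<and> act c ` u = V - w}"

lemma S_sub: "S \<subseteq> V" and x0_S: "x0 \<in> S"
  using tree by (auto simp: lifted_tree_def)

lemma S_V: "s \<in> S \<Longrightarrow> s \<in> V"
  using S_sub by blast

lemma x0_V: "x0 \<in> V"
  using S_V x0_S by blast

lemma S_inequiv: "s \<in> S \<Longrightarrow> t \<in> S \<Longrightarrow> g \<in> carrier G \<Longrightarrow> eqv (act g s) t \<Longrightarrow> s = t"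
  using tree unfolding lifted_tree_def by blast

lemma S_ne: "s \<in> S \<Longrightarrow> t \<in> S \<Longrightarrow> s \<noteq> t \<Longrightarrow> \<not> eqv s t"
  using lifted_tree_not_eqv[OF tree] .

lemma S_conn: "s \<in> S \<Longrightarrow> t \<in> S \<Longrightarrow> s \<noteq> t \<Longrightarrow> \<exists>u\<in>S. origin (V - dir s t) u"
  using tree unfolding lifted_tree_def by blast

lemma D_W: "w \<in> D \<Longrightarrow> w \<in> W"
  using D_sub by blast

lemma dir_S_D:
  assumes "s \<in> S" "t \<in> S" "s \<noteq> t"
  shows "dir s t \<in> D"
proof -
  obtain u where "u \<in> S" "origin (V - dir s t) u" using S_conn[OF assms] by blast
  moreover have "\<not> eqv s t" using S_ne assms by blast
  ultimately show ?thesis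
    using D_internal[OF dir_W _ _ origin_dir] assms S_V by blast
qed

lemma dir_S_not_external: "s \<in> S \<Longrightarrow> t \<in> S \<Longrightarrow> s \<noteq> t \<Longrightarrow> \<not> external (dir s t)"
  using S_conn unfolding external_def by blast

lemma one_dom_at:
  assumes "s \<in> S"
  shows "\<one> \<in> dom_at s"
  using dir_S_D[OF assms x0_S] act_one x0_V by (cases "s = x0") (auto simp: dom_at_def)

text \<open>By \<open>dir_branch\<close>, from one of s and t the point \<open>act g x0\<close> is
  seen in the direction of the other. That direction is an edge of the lifted tree and hence in
  \<open>D\<close>.\<close>

lemma dom_at_or:
  assumes "s \<in> S" "t \<in> S" "s \<noteq> t" "g \<in> carrier G"
  shows "g \<in> dom_at s \<or> g \<in> dom_at t"
proof (cases "eqv s (act g x0) \<or> dir s (act g x0) \<noteq> dir s t")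
  case True
  then have "\<not> eqv t (act g x0) \<and> dir t (act g x0) = dir t s"
    using dir_branch[of s t "act g x0"] S_V assms S_ne act_closed x0_V by blast
  then show ?thesis using dir_S_D assms by (auto simp: dom_at_def)
next
  case False
  then show ?thesis using dir_S_D assms by (auto simp: dom_at_def)
qed

text \<open>Since w is not an edge of the lifted tree, the paths from s1 to z and to s part at s1,
  and \<open>dir_branch\<close> applies.\<close>

lemma external_dir:
  assumes w: "external w" and s1: "s1 \<in> S" "origin w s1" and s: "s \<in> S" "s \<noteq> s1"
    and z: "z \<in> V" "z \<in> w"
  shows "\<not> eqv s z \<and> dir s z = dir s s1"
proof (rule dir_branch)
  have wW: "w \<in> W" using w D_W by (simp add: external_def)
  have "dir s1 z = w" using dir_eq_iff_mem[OF wW s1(2) z(1)] z(2) by simp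
  moreover have "dir s1 s \<noteq> w" using dir_S_not_external[of s1 s] s1 s w by metis
  ultimately show "eqv s1 z \<or> dir s1 z \<noteq> dir s1 s" by simp
qed (use S_V S_ne s1 s z in auto)

text \<open>Seen from s, the point \<open>act g x0\<close> lies behind w itself or behind an edge of
  the lifted tree, and both belong to \<open>D\<close>. This keeps the ping-pong sets of generators
  apart from those of stabilizers.\<close>

lemma half_sub_dom_at:
  assumes w: "external w" and s: "s \<in> S" and g: "g \<in> half w"
  shows "g \<in> dom_at s"
proof -
  have wD: "w \<in> D" using w by (simp add: external_def)
  obtain s1 where s1: "s1 \<in> S" "origin w s1" using D_origin[OF wD] by blast
  have z: "act g x0 \<in> V" "act g x0 \<in> w" and gc: "g \<in> carrier G"
    using g act_closed x0_V by (auto simp: half_def)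
  show ?thesis
  proof (cases "s = s1")
    case True
    then show ?thesis
      using dir_eq_iff_mem[OF D_W[OF wD] s1(2) z(1)] z(2) gc wD by (simp add: dom_at_def)
  next
    case False
    then show ?thesis
      using external_dir[OF w s1 s False z] dir_S_D[OF s s1(1) False] gc by (simp add: dom_at_def)
  qed
qed

text \<open>The path from the tail of u to a common point starts with u. It would also start with w
  if the tails agree, and with an edge of the lifted tree otherwise.\<close>

lemma half_disjoint:
  assumes w: "external w" and u: "external u" and ne: "w \<noteq> u"
  shows "half w \<inter> half u = {}"
proof (rule ccontr)
  assume "half w \<inter> half u \<noteq> {}"
  then obtain g where g: "g \<in> carrier G" "act g x0 \<in> w" "act g x0 \<in> u" by (auto simp: half_def)
  have z: "act g x0 \<in> V" using g act_closed x0_V by blast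
  have wD: "w \<in> D" and uD: "u \<in> D" using w u by (auto simp: external_def)
  obtain s where s: "s \<in> S" "origin w s" using D_origin[OF wD] by blast
  obtain t where t: "t \<in> S" "origin u t" using D_origin[OF uD] by blast
  have u': "dir t (act g x0) = u" using dir_eq_iff_mem[OF D_W[OF uD] t(2) z] g by simp
  show False
  proof (cases "t = s")
    case True
    then show False using u' dir_eq_iff_mem[OF D_W[OF wD] s(2) z] g ne by simp
  next
    case False
    then have "dir t s = u" using external_dir[OF w s t(1) False z g(2)] u' by simp
    then show False using dir_S_not_external[OF t(1) s(1) False] u by simp
  qed
qed

lemma one_not_half:
  assumes w: "external w"
  shows "\<one> \<notin> half w"
proof
  assume "\<one> \<in> half w"
  then have x: "x0 \<in> w" using act_one x0_V by (simp add: half_def)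
  have wD: "w \<in> D" using w by (simp add: external_def)
  obtain s where s: "s \<in> S" "origin w s" using D_origin[OF wD] by blast
  have "\<not> eqv s x0 \<and> dir s x0 = w" using dir_eq_iff_mem[OF D_W[OF wD] s(2) x0_V] x by blast
  moreover from this have "s \<noteq> x0" by auto
  ultimately show False using dir_S_not_external[OF s(1) x0_S] w by auto
qed

text \<open>Edge stabilizers are trivial, so a moves the first edge from s to a different edge of
  the same orbit, and \<open>D\<close> meets each orbit only once.\<close>

lemma Stab_step:
  assumes s: "s \<in> S" and a: "a \<in> Stab s" "a \<noteq> \<one>" and g: "g \<in> carrier G" "g \<in> dom_at s"
  shows "a \<otimes> g \<notin> dom_at s"
proof
  assume ag: "a \<otimes> g \<in> dom_at s"
  have ac: "a \<in> carrier G" and as: "eqv (act a s) s" using a by (auto simp: Stab_def)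
  have sV: "s \<in> V" using S_V s by blast
  let ?z = "act g x0"
  have z: "?z \<in> V" and az: "act a ?z \<in> V" and asV: "act a s \<in> V" using act_closed g ac x0_V sV by auto
  have m: "act (a \<otimes> g) x0 = act a ?z" using act_mult ac g x0_V by blast
  have e: "eqv s (act a ?z) \<longleftrightarrow> eqv s ?z"
    using eqv_act[OF ac sV z] eqv_trans[OF asV sV az as]
      eqv_trans[OF sV asV az eqv_sym[OF asV sV as]] by blast
  show False
  proof (cases "eqv s ?z")
    case True
    then have "g = \<one>" using g by (simp add: dom_at_def)
    moreover have "a \<otimes> g = \<one>" using ag e True by (simp add: dom_at_def m)
    ultimately show False using a ac by simp
  next
    case False
    have d: "dir s ?z \<in> D" using g False by (simp add: dom_at_def)
    have "dir s (act a ?z) = dir (act a s) (act a ?z)"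
      by (rule dir_cong[OF sV asV az az eqv_sym[OF asV sV as] eqv_refl])
    also have "\<dots> = act a ` dir s ?z" using dir_act[OF ac sV z False] .
    finally have "act a ` dir s ?z \<in> D" using ag e False by (simp add: dom_at_def m)
    then have "act a ` dir s ?z = dir s ?z" using D_unique[OF d ac] by blast
    then show False using wall_free[OF ac D_W[OF d]] a by blast
  qed
qed

section \<open>Ping-pong for the generators that pair external edges\<close>

lemma half_step:
  assumes "w \<in> W" "u \<in> W" "c \<in> carrier G" "act c ` u = V - w" "g \<in> carrier G" "g \<notin> half u"
  shows "c \<otimes> g \<in> half w"
proof -
  have z: "act g x0 \<in> V" "act g x0 \<notin> u" using assms(5,6) act_closed x0_V by (auto simp: half_def)
  then have "act c (act g x0) \<notin> V - w" using act_mem[OF assms(3) z(1) assms(2)] assms(4) by simp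
  then have "act (c \<otimes> g) x0 \<in> w"
    using act_closed[OF assms(3) z(1)] act_mult[OF assms(3,5) x0_V] by simp
  then show ?thesis using assms(3,5) by (simp add: half_def)
qed

text \<open>The element c throws everything outside \<open>half u\<close> into
  \<open>half w\<close>. As w differs from u (otherwise c would invert u), \<open>half w\<close>
  misses \<open>half u\<close>, so c can be applied again.\<close>

lemma half_nat_pow:
  assumes ext: "external w" "external u" and c: "c \<in> carrier G" "act c ` u = V - w"
    and g: "g \<in> carrier G" "g \<notin> half u"
  shows "c [^] Suc n \<otimes> g \<in> half w"
proof (induction n)
  case 0
  have wu: "w \<in> W" "u \<in> W" using ext D_W by (auto simp: external_def)
  show ?case using half_step[OF wu c g] c(1) by simp
next
  case (Suc n)
  have wu: "w \<in> W" "u \<in> W" using ext D_W by (auto simp: external_def)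
  have "w \<noteq> u" using no_inversion[OF c(1) wu(2)] c(2) by blast
  then have "c [^] Suc n \<otimes> g \<notin> half u" using half_disjoint[OF ext] Suc by blast
  then have "c \<otimes> (c [^] Suc n \<otimes> g) \<in> half w" 
    by (rule half_step[OF wu c m_closed[OF nat_pow_closed[OF c(1)] g(1)]])
  moreover have "c [^] Suc (Suc n) \<otimes> g = c \<otimes> (c [^] Suc n \<otimes> g)"
    using nat_pow_Suc2[OF c(1), of "Suc n"] c(1) g(1) by (simp add: m_assoc del: nat_pow_Suc)
  ultimately show ?case by (simp only:)
qed

text \<open>The inverse of c plays the same role with w and u exchanged, which covers the negative
  powers.\<close>

lemma flip_external:
  assumes "external w" "external u" "c \<in> carrier G" "act c ` u = V - w"
  shows "act (inv c) ` w = V - u"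
proof -
  have wu: "w \<in> W" "u \<in> W" using assms(1,2) D_W by (auto simp: external_def)
  have "act (inv c) ` (V - w) = u" using image_inv[OF assms(3) wu(2)] assms(4) by simp
  then show ?thesis
    using image_compl[OF inv_closed[OF assms(3)] wall_compl[OF wu(1)]] double_compl[OF wu(1)] by simp
qed

lemma cyclic_step:
  assumes ext: "external w" "external u" and c: "c \<in> carrier G" "act c ` u = V - w"
    and a: "a \<in> generate G {c}" "a \<noteq> \<one>" and g: "g \<in> carrier G" "g \<notin> half w \<union> half u"
  shows "a \<otimes> g \<in> half w \<union> half u"
proof -
  obtain k :: int where k: "a = c [^] k" using a generate_pow[OF c(1)] by blast
  have "k \<noteq> 0" using a k by auto
  then consider n where "k = int (Suc n)" | n where "k = - int (Suc n)"
    by (cases k rule: int_cases3) (metis gr0_implies_Suc of_nat_0_less_iff)+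
  then show ?thesis
  proof cases
    case 1
    then have "a = c [^] Suc n" using k int_pow_int by metis
    then show ?thesis using half_nat_pow[OF ext c g(1), of n] g(2) by auto
  next
    case 2
    then have "a = inv c [^] Suc n"
      using k c(1) int_pow_neg_int nat_pow_inv by metis
    then show ?thesis
      using half_nat_pow[OF ext(2,1) inv_closed[OF c(1)] flip_external[OF ext c] g(1), of n] g(2) by auto
  qed
qed

lemma D_same_orbit:
  assumes "w \<in> D" "w' \<in> D" "c \<in> carrier G" "c' \<in> carrier G" "u \<in> W"
    "act c ` u = w" "act c' ` u = w'"
  shows "w = w'"
proof -
  have "act (c' \<otimes> inv c) ` w = w'"
    using image_mult[OF assms(4) inv_closed[OF assms(3)] D_W[OF assms(1)]] image_inv[OF assms(3,5)] assms(6,7)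
    by simp
  then show ?thesis using D_unique[OF assms(1), of "c' \<otimes> inv c"] assms by simp
qed

lemma free_eq:
  assumes "u \<in> W" "c \<in> carrier G" "c' \<in> carrier G" "act c ` u = act c' ` u"
  shows "c = c'"
proof -
  have "act (inv c' \<otimes> c) ` u = u"
    using image_mult[OF inv_closed[OF assms(3)] assms(2,1)] image_inv[OF assms(3,1)] assms(4) by simp
  then have "inv c' \<otimes> c = \<one>" using wall_free[OF m_closed[OF inv_closed[OF assms(3)] assms(2)] assms(1)] by blast
  then show ?thesis using assms by (metis inv_closed inv_equality inv_inv)
qed

text \<open>The partner u is the only member of \<open>D\<close> in the orbit of the complement of
  w, and freeness on edges then determines c.\<close>

lemma cyclic_same_w:
  assumes ext: "external w" "external u" and c: "c \<in> carrier G" "act c ` u = V - w"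
    and ext': "external u'" and c': "c' \<in> carrier G" "act c' ` u' = V - w"
  shows "c = c'"
proof -
  have D: "w \<in> D" "u \<in> D" "u' \<in> D" using ext ext' by (auto simp: external_def)
  have e: "act (inv c) ` (V - w) = u" "act (inv c') ` (V - w) = u'"
    using image_inv[OF c(1) D_W[OF D(2)]] image_inv[OF c'(1) D_W[OF D(3)]] c(2) c'(2) by simp_all
  then have "u = u'"
    using D_same_orbit[OF D(2,3) inv_closed[OF c(1)] inv_closed[OF c'(1)] wall_compl[OF D_W[OF D(1)]]] by blast
  then show ?thesis using free_eq[OF D_W[OF D(2)] c(1) c'(1)] c(2) c'(2) by simp
qed

lemma generate_inv_singleton:
  assumes "c \<in> carrier G"
  shows "generate G {inv c} = generate G {c}"
proof -
  have "generate G {inv a} \<subseteq> generate G {a}" if "a \<in> carrier G" for a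
    using generate_subgroup_incl[of "{inv a}" "generate G {a}"] generate_is_subgroup[of "{a}"]
      generate.inv[of a "{a}" G] that by simp
  from this[of c] this[of "inv c"] show ?thesis using assms by auto
qed

text \<open>Any coincidence between an edge of the first pair and one of the second forces c' to be
  c or its inverse, and these generate the same subgroup.\<close>

lemma cyclic_disjoint:
  assumes ext: "external w" "external u" and c: "c \<in> carrier G" "act c ` u = V - w"
    and ext': "external w'" "external u'" and c': "c' \<in> carrier G" "act c' ` u' = V - w'"
    and ne: "generate G {c} \<noteq> generate G {c'}"
  shows "(half w \<union> half u) \<inter> (half w' \<union> half u') = {}"
proof -
  have f: "act (inv c) ` w = V - u" and f': "act (inv c') ` w' = V - u'"
    by (rule flip_external[OF ext c], rule flip_external[OF ext' c'])
  have i: "inv c \<in> carrier G" "inv c' \<in> carrier G" using c c' by auto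
  have 1: "w \<noteq> w'" using cyclic_same_w[OF ext c ext'(2) c'(1)] c'(2) ne by blast
  have 2: "u \<noteq> u'"
  proof
    assume "u = u'"
    then have "inv c = inv c'"
      using cyclic_same_w[OF ext(2,1) i(1) f ext'(1) i(2)] f' by simp
    then have "c = c'" using inv_inj c(1) c'(1) by (metis inv_inv)
    then show False using ne by simp
  qed
  have 3: "w \<noteq> u'"
  proof
    assume "w = u'"
    then have "c = inv c'"
      using cyclic_same_w[OF ext c ext'(1) i(2)] f' by simp
    then show False using ne c'(1) generate_inv_singleton by simp
  qed
  have 4: "u \<noteq> w'"
  proof
    assume "u = w'"
    then have "inv c = c'"
      using cyclic_same_w[OF ext(2,1) i(1) f ext'(2) c'(1)] c'(2) by simp
    then show False using ne c(1) generate_inv_singleton by auto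
  qed
  show ?thesis using 1 2 3 4 half_disjoint ext ext' by blast
qed

text \<open>Take u as the member of \<open>D\<close> in the orbit of the reversed edge. If u had its
  head in S, its reverse would be an edge of the lifted tree and so in \<open>D\<close>; being in
  the orbit of w it would equal w, giving w a head in S.\<close>

lemma external_partner:
  assumes w: "external w"
  shows "\<exists>u c. external u \<and> c \<in> carrier G \<and> act c ` u = V - w"
proof -
  have wD: "w \<in> D" and wW: "w \<in> W" using w D_W by (auto simp: external_def)
  obtain c where c: "c \<in> carrier G" "act c ` (V - w) \<in> D" using D_cover[OF wall_compl[OF wW]] by blast
  define u where "u = act c ` (V - w)"
  have uD: "u \<in> D" and uW: "u \<in> W" using c D_W by (auto simp: u_def)
  have cu: "act (inv c) ` u = V - w" using image_inv[OF c(1) wall_compl[OF wW]] by (simp add: u_def)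
  have "external u"
  proof (rule ccontr)
    assume "\<not> external u"
    then obtain t where t: "t \<in> S" "origin (V - u) t" using uD by (auto simp: external_def)
    obtain s where s: "s \<in> S" "origin u s" using D_origin[OF uD] by blast
    have "V - u \<in> D"
      using D_internal[OF wall_compl[OF uW] t(1) s(1) t(2)] s(2) double_compl[OF uW] by simp
    moreover have "act c ` w = V - u"
      using image_compl[OF c(1) wall_compl[OF wW]] double_compl[OF wW] by (simp add: u_def)
    ultimately have "V - u = w" using D_unique[OF wD c(1)] by simp
    then have "origin (V - w) s" using s(2) double_compl[OF uW] by simp
    then show False using w s(1) by (simp add: external_def)
  qed
  then show ?thesis using cu c(1) by blast
qed

lemma piecesE:
  assumes "(H, A) \<in> pieces"
  obtains (stab) s where "s \<in> S" "H = Stab s" "A = carrier G - dom_at s"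
    | (cyc) c w u where "external w" "external u" "c \<in> carrier G" "act c ` u = V - w"
      "H = generate G {c}" "A = half w \<union> half u"
  using assms unfolding pieces_def by blast

lemma pieces_subgroup: "(H, A) \<in> pieces \<Longrightarrow> subgroup H G"
  using subgroup_Stab S_V generate_is_subgroup by (elim piecesE) auto

text \<open>The generated subgroup moves S onto all vertices, by induction along paths from x0. If
  it contains c moving some s in S to \<open>act g x0\<close>, then s is x0, and g differs from c by
  an element of \<open>Stab x0\<close>.\<close>

lemma pieces_generate: "generate G (\<Union>(fst ` pieces)) = carrier G"
proof -
  let ?\<Gamma> = "generate G (\<Union>(fst ` pieces))"
  have sub: "\<Union>(fst ` pieces) \<subseteq> carrier G"
    using pieces_subgroup subgroup.subset by fastforce
  interpret K: subgroup ?\<Gamma> G using generate_is_subgroup[OF sub] .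
  have stab: "a \<in> ?\<Gamma>" if a: "a \<in> Stab s" "s \<in> S" for a s
  proof (rule generate.incl)
    have "(Stab s, carrier G - dom_at s) \<in> pieces" unfolding pieces_def using a(2) by blast
    from imageI[OF this, of fst] show "a \<in> \<Union>(fst ` pieces)" unfolding fst_conv using a(1) by (rule UnionI)
  qed
  have cyc: "c \<in> ?\<Gamma>" if c: "external w" "external u" "c \<in> carrier G" "act c ` u = V - w" for c w u
  proof (rule generate.incl)
    have "(generate G {c}, half w \<union> half u) \<in> pieces" unfolding pieces_def using c by blast
    moreover have "c \<in> generate G {c}" by (simp add: generate.incl)
    ultimately show "c \<in> \<Union>(fst ` pieces)" using imageI[of _ pieces fst] unfolding fst_conv by (metis UnionI fst_conv)
  qed
  have reach: "\<exists>g\<in>?\<Gamma>. \<exists>s\<in>S. eqv (act g s) z" if z: "z \<in> V" for z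
    using x0_V z
  proof (induction rule: reach_induct)
    case base
    have "eqv (act \<one> x0) x0" using act_one[OF x0_V] by simp
    then show ?case using K.one_closed x0_S by blast
  next
    case (step x h t)
    then obtain g s where g: "g \<in> ?\<Gamma>" and s: "s \<in> S" "eqv (act g s) x" by blast
    have gc: "g \<in> carrier G" using g K.subset by blast
    have igc: "inv g \<in> carrier G" using gc by simp
    have sV: "s \<in> V" using s S_V by blast
    have tV: "t \<in> V" using step by (simp add: origin_def)
    define k where "k = act (inv g) ` h"
    have k: "k \<in> W" using act_wall[OF igc step.hyps(2)] by (simp add: k_def)
    have "eqv s (act (inv g) x)" using eqv_act_inv[OF gc sV step.hyps(1)] s(2) by blast
    then have "eqv (act (inv g) x) s" using eqv_sym[OF sV act_closed[OF igc step.hyps(1)]] by blast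
    then have sk: "origin k s"
      using origin_cong[OF origin_act[OF igc step.hyps(3)] sV] by (simp add: k_def)
    have tk: "origin (V - k) (act (inv g) t)"
      using origin_act[OF igc step.hyps(4)] image_compl[OF igc step.hyps(2)] by (simp add: k_def)
    \<comment> \<open>The edge pulled back to s need not lie in \<open>D\<close>. After moving it
      there by b its tail is again a point of S, which must be s itself, so b stabilizes s.\<close>
    obtain b where b: "b \<in> carrier G" "act b ` k \<in> D" using D_cover[OF k] by blast
    define e where "e = act b ` k"
    have eD: "e \<in> D" and eW: "e \<in> W" using b D_W by (auto simp: e_def)
    obtain s' where s': "s' \<in> S" "origin e s'" using D_origin[OF eD] by blast
    have ebs: "origin e (act b s)" using origin_act[OF b(1) sk] by (simp add: e_def)
    have "eqv (act b s) s'" using origin_unique[OF eW ebs s'(2)] .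
    then have "b \<in> Stab s" using S_inequiv[OF s(1) s'(1) b(1)] b(1) by (simp add: Stab_def)
    then have bG: "b \<in> ?\<Gamma>" using stab s(1) by blast
    define p where "p = act b (act (inv g) t)"
    have pV: "p \<in> V" unfolding p_def by (intro act_closed b(1) igc tV)
    have pe: "origin (V - e) p"
      using origin_act[OF b(1) tk] image_compl[OF b(1) k] by (simp add: e_def p_def)
    have gbG: "g \<otimes> inv b \<in> ?\<Gamma>" and gbc: "g \<otimes> inv b \<in> carrier G" using g bG gc b(1) by auto
    have pt: "act (g \<otimes> inv b) p = t"
      using act_mult[OF gc inv_closed[OF b(1)] pV] act_inv[OF b(1) act_closed[OF igc tV]] act_inv'[OF gc tV]
      by (simp add: p_def)
    \<comment> \<open>Either the head of e is represented in S, or e is external and its partner c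
      brings the tail of u to that head.\<close>
    have "\<exists>c\<in>?\<Gamma>. \<exists>r\<in>S. eqv (act c r) p"
    proof (cases "\<exists>r\<in>S. origin (V - e) r")
      case True
      then obtain r where r: "r \<in> S" "origin (V - e) r" by blast
      have "eqv (act \<one> r) p" using origin_unique[OF wall_compl[OF eW] r(2) pe] act_one[OF S_V[OF r(1)]] by simp
      then show ?thesis using r(1) K.one_closed by blast
    next
      case False
      then have ext: "external e" using eD by (simp add: external_def)
      obtain u c where u: "external u" "c \<in> carrier G" "act c ` u = V - e" using external_partner[OF ext] by blast
      obtain r where r: "r \<in> S" "origin u r" using D_origin u(1) unfolding external_def by blast
      have "origin (V - e) (act c r)" using origin_act[OF u(2) r(2)] u(3) by simp
      then have "eqv (act c r) p" using origin_unique[OF wall_compl[OF eW] _ pe] by blast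
      then show ?thesis using r(1) cyc[OF ext u] by blast
    qed
    then obtain c r where c: "c \<in> ?\<Gamma>" "r \<in> S" "eqv (act c r) p" by blast
    have cc: "c \<in> carrier G" using c K.subset by blast
    have "eqv (act (g \<otimes> inv b) (act c r)) t"
      using eqv_act[OF gbc act_closed[OF cc S_V[OF c(2)]] pV] c(3) pt by simp
    then have "eqv (act (g \<otimes> inv b \<otimes> c) r) t" using act_mult[OF gbc cc S_V[OF c(2)]] by simp
    moreover have "g \<otimes> inv b \<otimes> c \<in> ?\<Gamma>" using gbG c(1) by blast
    ultimately show ?case using c(2) by blast
  next
    case (cong x y)
    then obtain g s where "g \<in> ?\<Gamma>" "s \<in> S" "eqv (act g s) x" by blast
    moreover from this have "eqv (act g s) y"
      using eqv_trans[OF act_closed[OF K.mem_carrier S_V] cong.hyps(1,2) _ cong.hyps(3)] by blast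
    ultimately show ?case by blast
  qed
  show ?thesis
  proof (intro equalityI subsetI)
    fix g assume g: "g \<in> carrier G"
    have gx: "act g x0 \<in> V" using act_closed g x0_V by blast
    obtain c s where c: "c \<in> ?\<Gamma>" "s \<in> S" "eqv (act c s) (act g x0)" using reach[OF gx] by blast
    have cc: "c \<in> carrier G" and sV: "s \<in> V" using c K.subset S_V by auto
    have m: "act (inv g \<otimes> c) s = act (inv g) (act c s)" using act_mult g cc sV by simp
    have "eqv (act (inv g) (act c s)) x0"
      using eqv_act[OF inv_closed[OF g] act_closed[OF cc sV] gx] c(3) act_inv[OF g x0_V] by simp
    then have e: "eqv (act (inv g \<otimes> c) s) x0" using m by simp
    have igc: "inv g \<otimes> c \<in> carrier G" using g cc by simp
    have "s = x0" using S_inequiv[OF c(2) x0_S igc e] .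
    then have "inv g \<otimes> c \<in> Stab x0" using e igc by (simp add: Stab_def)
    then have "inv g \<otimes> c \<in> ?\<Gamma>" using stab x0_S by blast
    then have "c \<otimes> inv (inv g \<otimes> c) \<in> ?\<Gamma>" by (rule K.m_closed[OF c(1) K.m_inv_closed])
    moreover have "c \<otimes> inv (inv g \<otimes> c) = g"
      using g cc by (simp add: inv_mult_group m_assoc[symmetric])
    ultimately show "g \<in> ?\<Gamma>" by simp
  qed (use K.subset in blast)
qed

theorem free_product_pieces: "free_product_of G (fst ` pieces)"
proof (rule free_product_of_pingpong)
  show "\<And>H A. (H, A) \<in> pieces \<Longrightarrow> subgroup H G" by (rule pieces_subgroup)
  show "generate G (\<Union>(fst ` pieces)) = carrier G" by (rule pieces_generate)
  show "\<one> \<notin> A" if "(H, A) \<in> pieces" for H A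
    using that one_dom_at one_not_half by (elim piecesE) auto
  show "A \<inter> B = {}" if HA: "(H, A) \<in> pieces" and KB: "(K, B) \<in> pieces" and ne: "H \<noteq> K" for H A K B
    using HA
  proof (cases rule: piecesE)
    case (stab s)
    note s = stab
    show ?thesis
      using KB
    proof (cases rule: piecesE)
      case (stab t)
      have "s \<noteq> t" using ne s(2) stab(2) by blast
      then show ?thesis using dom_at_or[OF s(1) stab(1)] s(3) stab(3) by blast
    next
      case (cyc c w u)
      then show ?thesis using half_sub_dom_at[OF _ s(1)] s(3) by blast
    qed
  next
    case (cyc c w u)
    note c = cyc
    show ?thesis
      using KB
    proof (cases rule: piecesE)
      case (stab t)
      then show ?thesis using half_sub_dom_at[OF _ stab(1)] c(1,2,6) by blast
    next
      case (cyc c' w' u')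
      show ?thesis using cyclic_disjoint[OF c(1-4) cyc(1-4)] ne unfolding c(5,6) cyc(5,6) by blast
    qed
  qed
  show "a \<otimes> g \<in> A" if HA: "(H, A) \<in> pieces" and a: "a \<in> H" "a \<noteq> \<one>" and g: "g \<in> carrier G" "g \<notin> A" for H A a g
    using HA
  proof (cases rule: piecesE)
    case (stab s)
    then have "a \<in> carrier G" using a by (simp add: Stab_def)
    then show ?thesis using Stab_step[OF stab(1), of a g] stab(2,3) a g by simp
  next
    case (cyc c w u)
    then show ?thesis using cyclic_step[OF cyc(1-4)] a g by simp
  qed
qed

end

text \<open>The structure theorem for groups acting on trees with trivial edge stabilizers. After
  the ping-pong argument only the choice of the transversal \<open>D\<close> remains.\<close>

theorem (in free_wall_action) free_product_of_stabilizers: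
  assumes "V \<noteq> {}"
  shows "\<exists>\<H>. free_product_of G \<H> \<and>
    (\<forall>H\<in>\<H>. (\<exists>x\<in>V. H = Stab x) \<or> (\<exists>c\<in>carrier G. H = generate G {c}))"
proof -
  obtain x0 where x0: "x0 \<in> V" using assms by blast
  obtain S where S: "lifted_tree x0 S" and cov: "\<And>x. x \<in> V \<Longrightarrow> \<exists>g\<in>carrier G. \<exists>s\<in>S. eqv (act g s) x"
    using lifted_tree_exists[OF x0] by blast
  have SV: "S \<subseteq> V" using S by (simp add: lifted_tree_def)
  define internal where "internal = (\<lambda>w. \<exists>s\<in>S. \<exists>t\<in>S. origin w s \<and> origin (V - w) t)"
  define orb where "orb = (\<lambda>w. {act g ` w | g. g \<in> carrier G})"
  \<comment> \<open>An orbit containing an edge inside the lifted tree must be represented by it;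
    any other orbit gets a representative with tail in S.\<close>
  define rep where "rep = (\<lambda>Q. if \<exists>k\<in>Q. internal k then SOME k. k \<in> Q \<and> internal k
                                else SOME k. k \<in> Q \<and> (\<exists>s\<in>S. origin k s))"
  have at_S: "\<exists>k\<in>orb w. \<exists>s\<in>S. origin k s" if w: "w \<in> W" for w
  proof -
    obtain x where x: "origin w x" using origin_exists[OF w] by blast
    then have xV: "x \<in> V" by (simp add: origin_def)
    obtain g s where g: "g \<in> carrier G" "s \<in> S" "eqv (act g s) x" using cov[OF xV] by blast
    have sV: "s \<in> V" using g SV by blast
    have ig: "inv g \<in> carrier G" using g by simp
    have "eqv s (act (inv g) x)" using eqv_act_inv[OF g(1) sV xV] g(3) by blast
    then have "eqv (act (inv g) x) s" using eqv_sym[OF sV act_closed[OF ig xV]] by blast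
    then have "origin (act (inv g) ` w) s" using origin_cong[OF origin_act[OF ig x] sV] by blast
    then show ?thesis using g ig unfolding orb_def by blast
  qed
  have rep: "rep (orb w) \<in> orb w \<and> (\<exists>s\<in>S. origin (rep (orb w)) s)
       \<and> ((\<exists>k\<in>orb w. internal k) \<longrightarrow> internal (rep (orb w)))" if w: "w \<in> W" for w
  proof (cases "\<exists>k\<in>orb w. internal k")
    case True
    then have "rep (orb w) = (SOME k. k \<in> orb w \<and> internal k)" by (simp add: rep_def)
    then have "rep (orb w) \<in> orb w \<and> internal (rep (orb w))"
      using someI_ex[of "\<lambda>k. k \<in> orb w \<and> internal k"] True by auto
    then show ?thesis unfolding internal_def by blast
  next
    case False
    then have "rep (orb w) = (SOME k. k \<in> orb w \<and> (\<exists>s\<in>S. origin k s))" by (simp add: rep_def)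
    then have "rep (orb w) \<in> orb w \<and> (\<exists>s\<in>S. origin (rep (orb w)) s)"
      using someI_ex[of "\<lambda>k. k \<in> orb w \<and> (\<exists>s\<in>S. origin k s)"] at_S[OF w] by auto
    then show ?thesis using False by blast
  qed
  have orb_W: "k \<in> W" if "k \<in> orb w" "w \<in> W" for k w
    using that act_wall by (auto simp: orb_def)
  have orb_self: "w \<in> orb w" if "w \<in> W" for w
  proof -
    have "w = act \<one> ` w" using image_one[OF that] by simp
    then show ?thesis unfolding orb_def using one_closed by blast
  qed
  have orb_eq: "orb (act g ` w) = orb w" if g: "g \<in> carrier G" and w: "w \<in> W" for g w
  proof (intro equalityI subsetI)
    fix k assume "k \<in> orb (act g ` w)"
    then obtain h where h: "h \<in> carrier G" "k = act h ` act g ` w" by (auto simp: orb_def)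
    then have "k = act (h \<otimes> g) ` w" using image_mult g w by simp
    then show "k \<in> orb w" using h g unfolding orb_def by blast
  next
    fix k assume "k \<in> orb w"
    then obtain h where h: "h \<in> carrier G" "k = act h ` w" by (auto simp: orb_def)
    then have "k = act (h \<otimes> inv g) ` act g ` w"
      using image_mult[of h "inv g" "act g ` w"] g w act_wall image_inv by simp
    then show "k \<in> orb (act g ` w)" using h g unfolding orb_def by blast
  qed
  \<comment> \<open>Corresponding ends of two internal edges of one orbit agree, because S has one
    point per orbit, and the ends determine the edge.\<close>
  have int_unique: "k = w" if w: "w \<in> W" "internal w" and k: "k \<in> orb w" "internal k" for w k
  proof -
    obtain s t where s: "s \<in> S" "t \<in> S" "origin w s" "origin (V - w) t" using w by (auto simp: internal_def)
    obtain s' t' where s': "s' \<in> S" "t' \<in> S" "origin k s'" "origin (V - k) t'" using k by (auto simp: internal_def)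
    obtain g where g: "g \<in> carrier G" "k = act g ` w" using k by (auto simp: orb_def)
    have kW: "k \<in> W" using g act_wall w by simp
    have "origin k (act g s)" "origin (V - k) (act g t)"
      using origin_act[OF g(1)] s image_compl[OF g(1) w(1)] g(2) by metis+
    then have "eqv (act g s) s'" "eqv (act g t) t'"
      using origin_unique[OF kW] origin_unique[OF wall_compl[OF kW]] s' by auto
    then have "s = s'" "t = t'" using S g(1) s s' unfolding lifted_tree_def by blast+
    then have "{k} = {w}" using sep_of_origins[OF w(1) s(3,4)] sep_of_origins[OF kW s'(3,4)] by simp
    then show ?thesis by simp
  qed
  define D where "D = (\<lambda>w. rep (orb w)) ` W"
  interpret wall_domain V W G act x0 S D
  proof
    show "lifted_tree x0 S" by (rule S)
    show "\<And>x. x \<in> V \<Longrightarrow> \<exists>g\<in>carrier G. \<exists>s\<in>S. eqv (act g s) x" by (rule cov)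
    show "D \<subseteq> W" using rep orb_W by (auto simp: D_def)
    show "\<exists>s\<in>S. origin w s" if "w \<in> D" for w using that rep by (auto simp: D_def)
    show "\<exists>g\<in>carrier G. act g ` w \<in> D" if "w \<in> W" for w
    proof -
      have "rep (orb w) \<in> orb w" "rep (orb w) \<in> D" using rep[OF that] that by (auto simp: D_def)
      then show ?thesis unfolding orb_def by auto
    qed
    have Drep: "w = rep (orb w)" "w \<in> W" if "w \<in> D" for w
    proof -
      obtain u where u: "u \<in> W" "w = rep (orb u)" using \<open>w \<in> D\<close> by (auto simp: D_def)
      then obtain g where "g \<in> carrier G" "w = act g ` u" using rep[OF u(1)] by (auto simp: orb_def)
      then show "w = rep (orb w)" "w \<in> W" using orb_eq u act_wall by auto
    qed
    show "act g ` w = w" if "w \<in> D" "g \<in> carrier G" "act g ` w \<in> D" for w g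
      using Drep[OF that(1)] Drep(1)[OF that(3)] orb_eq[OF that(2)] by simp
    show "w \<in> D" if "w \<in> W" "s \<in> S" "t \<in> S" "origin w s" "origin (V - w) t" for w s t
    proof -
      have i: "internal w" using that by (auto simp: internal_def)
      then have "rep (orb w) = w" using rep[OF that(1)] int_unique[OF that(1) i] orb_self[OF that(1)] by blast
      then show ?thesis using that(1) by (auto simp: D_def)
    qed
  qed
  have "(\<exists>x\<in>V. H = Stab x) \<or> (\<exists>c\<in>carrier G. H = generate G {c})" if "H \<in> fst ` pieces" for H
  proof -
    obtain A where "(H, A) \<in> pieces" using \<open>H \<in> fst ` pieces\<close> by auto
    then show ?thesis using S_V by (elim piecesE) auto
  qed
  then show ?thesis using free_product_pieces by blast
qed

subsection \<open>Finite groups with abelian centralizers\<close>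

context group
begin

definition cent :: "'a \<Rightarrow> 'a set" where
  "cent a = {x \<in> carrier G. x \<otimes> a = a \<otimes> x}"

definition conjs :: "'a \<Rightarrow> 'a set" where
  "conjs a = (\<lambda>(x, b). x \<otimes> b \<otimes> inv x) ` (carrier G \<times> (cent a - {\<one>}))"

lemma mult_inv_cancel:
  assumes "x \<in> carrier G" "y \<in> carrier G"
  shows "x \<otimes> (inv x \<otimes> y) = y" "inv x \<otimes> (x \<otimes> y) = y"
  using assms by (simp_all add: m_assoc[symmetric])

lemma conj_eq_iff:
  assumes "x \<in> carrier G" "y \<in> carrier G" "b \<in> carrier G" "c \<in> carrier G"
  shows "x \<otimes> b \<otimes> inv x = y \<otimes> c \<otimes> inv y \<longleftrightarrow> (inv y \<otimes> x) \<otimes> b \<otimes> inv (inv y \<otimes> x) = c"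
proof -
  have "(inv y \<otimes> x) \<otimes> b \<otimes> inv (inv y \<otimes> x) = inv y \<otimes> (x \<otimes> b \<otimes> inv x) \<otimes> y"
    using assms by (simp add: inv_mult_group m_assoc)
  moreover have "inv y \<otimes> t \<otimes> y = c \<longleftrightarrow> t = y \<otimes> c \<otimes> inv y" if t: "t \<in> carrier G" for t
  proof
    assume eq: "inv y \<otimes> t \<otimes> y = c"
    show "t = y \<otimes> c \<otimes> inv y" unfolding eq[symmetric] using t assms(2) by (simp add: m_assoc mult_inv_cancel)
  next
    assume eq: "t = y \<otimes> c \<otimes> inv y"
    show "inv y \<otimes> t \<otimes> y = c" unfolding eq using assms(2,4) by (simp add: m_assoc mult_inv_cancel)
  qed
  ultimately show ?thesis using assms by simp
qed

lemma conj_eq_self: "x \<in> carrier G \<Longrightarrow> b \<in> carrier G \<Longrightarrow> x \<otimes> b \<otimes> inv x = b \<longleftrightarrow> x \<otimes> b = b \<otimes> x"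
  by (metis inv_closed inv_solve_right m_closed)

text \<open>If the centralizers are abelian and self-normalizing, the conjugates of a proper centralizer
  cover at least half of the group but not all of it. The conjugates of the centralizer of an
  element that is missed are disjoint from these up to the identity, so together they would
  overfill the group.\<close>

lemma finite_abelian_of_centralizers:
  assumes fin: "finite (carrier G)"
    and CT: "\<And>g h k. g \<in> carrier G \<Longrightarrow> g \<noteq> \<one> \<Longrightarrow> h \<in> carrier G \<Longrightarrow> k \<in> carrier G \<Longrightarrow>
        g \<otimes> h = h \<otimes> g \<Longrightarrow> g \<otimes> k = k \<otimes> g \<Longrightarrow> h \<otimes> k = k \<otimes> h"
    and N: "\<And>g x. g \<in> carrier G \<Longrightarrow> g \<noteq> \<one> \<Longrightarrow> x \<in> carrier G \<Longrightarrow>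
        (x \<otimes> g \<otimes> inv x) \<otimes> g = g \<otimes> (x \<otimes> g \<otimes> inv x) \<Longrightarrow> x \<otimes> g = g \<otimes> x"
    and a: "a \<in> carrier G" and y: "y \<in> carrier G"
  shows "a \<otimes> y = y \<otimes> a"
proof (rule ccontr)
  assume nc: "a \<otimes> y \<noteq> y \<otimes> a"
  define n where "n = card (carrier G)"
  have cent_fin: "finite (cent b)" and cent_sub: "cent b \<subseteq> carrier G" for b
    using fin by (auto simp: cent_def)
  let ?f = "\<lambda>(x, b). x \<otimes> b \<otimes> inv x"
  \<comment> \<open>A conjugation between two members of an abelian centralizer centralizes them by
    \<open>N\<close>. So the fibres of \<open>?f\<close> are translates of \<open>cent b\<close>,
    which gives the class count below.\<close>
  have fiber: "{p \<in> carrier G \<times> (cent b - {\<one>}). ?f p = ?f (x, c)}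
      = (\<lambda>z. (x \<otimes> z, c)) ` cent b"
    if b: "b \<in> carrier G" "b \<noteq> \<one>" and x: "x \<in> carrier G" and c: "c \<in> cent b" "c \<noteq> \<one>" for b x c
  proof (intro equalityI subsetI)
    have cc: "c \<in> carrier G" "c \<otimes> b = b \<otimes> c" using c by (auto simp: cent_def)
    fix p assume "p \<in> {p \<in> carrier G \<times> (cent b - {\<one>}). ?f p = ?f (x, c)}"
    then obtain u d where p: "p = (u, d)" and u: "u \<in> carrier G" and d: "d \<in> carrier G" "d \<otimes> b = b \<otimes> d" "d \<noteq> \<one>"
      and eq: "u \<otimes> d \<otimes> inv u = x \<otimes> c \<otimes> inv x" by (auto simp: cent_def)
    define z where "z = inv x \<otimes> u"
    have z: "z \<in> carrier G" and xz: "x \<otimes> z = u" using x u by (simp_all add: z_def m_assoc[symmetric])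
    have zd: "z \<otimes> d \<otimes> inv z = c" using eq conj_eq_iff[OF u x d(1) cc(1)] by (simp add: z_def)
    have "c \<otimes> d = d \<otimes> c" using CT[OF b cc(1) d(1)] cc(2) d(2) by simp
    then have zd': "z \<otimes> d = d \<otimes> z" using N[OF d(1,3) z] zd by simp
    then have "d = c" using zd conj_eq_self[OF z d(1)] by simp
    moreover have "z \<otimes> b = b \<otimes> z" using CT[OF d(1,3) z b(1)] zd' d(2) by simp
    then have "z \<in> cent b" using z by (simp add: cent_def)
    ultimately show "p \<in> (\<lambda>z. (x \<otimes> z, c)) ` cent b" using p xz by auto
  next
    have cc: "c \<in> carrier G" "c \<otimes> b = b \<otimes> c" using c by (auto simp: cent_def)
    fix p assume "p \<in> (\<lambda>z. (x \<otimes> z, c)) ` cent b"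
    then obtain z where p: "p = (x \<otimes> z, c)" and z: "z \<in> carrier G" "z \<otimes> b = b \<otimes> z" by (auto simp: cent_def)
    have "z \<otimes> c = c \<otimes> z" using CT[OF b z(1) cc(1)] z(2) cc(2) by simp
    then have "z \<otimes> c \<otimes> inv z = c" using conj_eq_self[OF z(1) cc(1)] by simp
    moreover have "inv x \<otimes> (x \<otimes> z) = z" using x z by (simp add: m_assoc[symmetric])
    ultimately have "(x \<otimes> z) \<otimes> c \<otimes> inv (x \<otimes> z) = x \<otimes> c \<otimes> inv x"
      using conj_eq_iff[of "x \<otimes> z" x c c] x z(1) cc(1) by simp
    then show "p \<in> {p \<in> carrier G \<times> (cent b - {\<one>}). ?f p = ?f (x, c)}"
      using p x z(1) c by simp
  qed
  have count: "card (conjs b) * card (cent b) = n * (card (cent b) - 1)"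
    if b: "b \<in> carrier G" "b \<noteq> \<one>" for b
  proof -
    let ?P = "carrier G \<times> (cent b - {\<one>})"
    have finP: "finite ?P" using fin cent_fin by simp
    have "card {p \<in> ?P. ?f p = q} = card (cent b)" if q': "q \<in> conjs b" for q
    proof -
      obtain x c where xc: "x \<in> carrier G" "c \<in> cent b" "c \<noteq> \<one>" and q: "q = ?f (x, c)"
        using q' by (auto simp: conjs_def)
      have "inj_on (\<lambda>z. (x \<otimes> z, c)) (cent b)"
        using xc by (auto simp: inj_on_def cent_def)
      then show ?thesis using fiber[OF b xc] by (simp only: q card_image)
    qed
    moreover have "card ?P = (\<Sum>q\<in>conjs b. card {p \<in> ?P. ?f p = q})"
      using sum.image_gen[OF finP, of "\<lambda>_. 1::nat" ?f] by (simp add: conjs_def)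
    ultimately have "card ?P = card (conjs b) * card (cent b)" by simp
    moreover have "\<one> \<in> cent b" using b by (simp add: cent_def)
    then have "card (cent b - {\<one>}) = card (cent b) - 1" using cent_fin by simp
    ultimately show ?thesis by (simp add: card_cartesian_product n_def)
  qed
  have conjs_sub: "conjs b \<subseteq> carrier G - {\<one>}" for b
  proof
    fix q assume "q \<in> conjs b"
    then obtain x c where xc: "x \<in> carrier G" "c \<in> carrier G" "c \<noteq> \<one>" "q = x \<otimes> c \<otimes> inv x"
      by (auto simp: conjs_def cent_def)
    have "q \<noteq> \<one>"
    proof
      assume "q = \<one>"
      then have "inv x \<otimes> (x \<otimes> c \<otimes> inv x) \<otimes> x = \<one>" using xc by simp
      moreover have "inv x \<otimes> (x \<otimes> c \<otimes> inv x) \<otimes> x = c" using xc(1,2) by (simp add: m_assoc mult_inv_cancel)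
      ultimately show False using xc(3) by simp
    qed
    then show "q \<in> carrier G - {\<one>}" using xc by simp
  qed
  have two: "2 \<le> card (cent b)" if b: "b \<in> carrier G" "b \<noteq> \<one>" for b
  proof -
    have "{\<one>, b} \<subseteq> cent b" using b by (auto simp: cent_def)
    from card_mono[OF cent_fin this] show ?thesis using b by simp
  qed
  \<comment> \<open>The fraction of the group covered is 1 - 1/|C| for the centralizer C, and |C| is
    at least 2.\<close>
  have half: "n \<le> 2 * card (conjs b)" if b: "b \<in> carrier G" "b \<noteq> \<one>" for b
  proof -
    obtain m where m: "card (cent b) = Suc (Suc m)" using two[OF b] by (metis add_2_eq_Suc le_Suc_ex)
    have "n * Suc (Suc m) \<le> 2 * (n * Suc m)" by simp
    also have "\<dots> = 2 * card (conjs b) * Suc (Suc m)" using count[OF b] m by simp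
    finally show ?thesis by (metis mult_le_cancel2 zero_less_Suc)
  qed
  have a1: "a \<noteq> \<one>" using nc y by auto
  \<comment> \<open>If nothing were missed, the count would read (n - 1) |C| = n (|C| - 1) for C =
    \<open>cent a\<close>, so |C| = n, although y lies outside C.\<close>
  have "\<exists>b. b \<in> carrier G \<and> b \<noteq> \<one> \<and> b \<notin> conjs a"
  proof (rule ccontr)
    assume "\<not> ?thesis"
    then have "conjs a = carrier G - {\<one>}" using conjs_sub by blast
    then have "card (conjs a) = n - 1" using fin by (simp add: n_def)
    then have "(n - 1) * card (cent a) = n * (card (cent a) - 1)" using count[OF a a1] by simp
    moreover have "card (cent a) < n"
    proof -
      have "y \<notin> cent a" using nc y by (auto simp: cent_def)
      then have "cent a \<subset> carrier G" using y cent_sub by blast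
      then show ?thesis unfolding n_def using fin by (rule psubset_card_mono[rotated])
    qed
    ultimately show False using two[OF a a1]
      by (cases n; cases "card (cent a)") (auto simp: algebra_simps)
  qed
  then obtain b where b: "b \<in> carrier G" "b \<noteq> \<one>" "b \<notin> conjs a" by blast
  have "conjs a \<inter> conjs b = {}"
  proof (rule ccontr)
    assume "conjs a \<inter> conjs b \<noteq> {}"
    then obtain x c w d where xc: "x \<in> carrier G" "c \<in> carrier G" "c \<otimes> a = a \<otimes> c" "c \<noteq> \<one>"
      and wd: "w \<in> carrier G" "d \<in> carrier G" "d \<otimes> b = b \<otimes> d" "d \<noteq> \<one>"
      and eq: "x \<otimes> c \<otimes> inv x = w \<otimes> d \<otimes> inv w"
      by (auto simp: conjs_def cent_def)
    define z where "z = inv w \<otimes> x"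
    have z: "z \<in> carrier G" using xc wd by (simp add: z_def)
    have d: "z \<otimes> c \<otimes> inv z = d" using eq conj_eq_iff[OF xc(1) wd(1) xc(2) wd(2)] by (simp add: z_def)
    \<comment> \<open>This conjugate of b commutes with c, a nontrivial element of
      \<open>cent a\<close>. Hence it lies in \<open>cent a\<close>, and b would belong to
      \<open>conjs a\<close>.\<close>
    define e where "e = inv z \<otimes> b \<otimes> z"
    have e: "e \<in> carrier G" and be: "b = z \<otimes> e \<otimes> inv z"
      using z b(1) by (simp_all add: e_def m_assoc mult_inv_cancel)
    have c': "c = inv z \<otimes> d \<otimes> z"
      unfolding d[symmetric] using z xc(2) by (simp add: m_assoc mult_inv_cancel)
    have "c \<otimes> e = inv z \<otimes> (d \<otimes> b) \<otimes> z"
      unfolding c' e_def using z b(1) wd(2) by (simp add: m_assoc mult_inv_cancel)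
    also have "\<dots> = e \<otimes> c"
      unfolding c' e_def wd(3) using z b(1) wd(2) by (simp add: m_assoc mult_inv_cancel)
    finally have "e \<otimes> a = a \<otimes> e" using CT[OF xc(2,4) e a] xc(3) by simp
    moreover have "e \<noteq> \<one>" using be b(2) z by auto
    ultimately have "(z, e) \<in> carrier G \<times> (cent a - {\<one>})" using e z by (simp add: cent_def)
    then have "b \<in> conjs a" unfolding conjs_def be by (metis (mono_tags, lifting) case_prod_conv image_eqI)
    then show False using b(3) by simp
  qed
  then have "card (conjs a \<union> conjs b) = card (conjs a) + card (conjs b)"
    using card_Un_disjoint conjs_sub fin by (metis finite_Diff finite_subset)
  moreover have "card (conjs a \<union> conjs b) \<le> card (carrier G - {\<one>})"
    using conjs_sub fin by (intro card_mono) auto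
  moreover have "card (carrier G - {\<one>}) < n"
    unfolding n_def using fin by (intro psubset_card_mono) auto
  ultimately show False using half[OF a a1] half[OF b(1,2)] by simp
qed

end

subsection \<open>Two by two matrices\<close>

definition m2_det :: "'a::comm_ring_1 m2 \<Rightarrow> 'a" where
  "m2_det = (\<lambda>(a,b,c,d). a * d - b * c)"

definition m2_tr :: "'a::comm_ring_1 m2 \<Rightarrow> 'a" where
  "m2_tr = (\<lambda>(a,b,c,d). a + d)"

definition m2_adj :: "'a::comm_ring_1 m2 \<Rightarrow> 'a m2" where
  "m2_adj = (\<lambda>(a,b,c,d). (d, -b, -c, a))"

text \<open>The matrix x I + y A, a general element of the algebra generated by A.\<close>

definition m2_lin :: "'a::comm_ring_1 \<Rightarrow> 'a \<Rightarrow> 'a m2 \<Rightarrow> 'a m2" where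
  "m2_lin x y = (\<lambda>(a,b,c,d). (x + y * a, y * b, y * c, x + y * d))"

lemmas m2_simps = m2_mult_def m2_neg_def m2_one_def m2_det_def m2_tr_def m2_adj_def m2_lin_def

lemma m2_mult_assoc: "m2_mult (m2_mult A B) C = m2_mult A (m2_mult B C)"
  by (cases A; cases B; cases C) (simp add: m2_simps algebra_simps)

lemma m2_one_mult [simp]: "m2_mult m2_one A = A" "m2_mult A m2_one = A"
  by (cases A; simp add: m2_simps)+

lemma m2_neg_mult [simp]: "m2_mult (m2_neg A) B = m2_neg (m2_mult A B)" "m2_mult A (m2_neg B) = m2_neg (m2_mult A B)"
  by (cases A; cases B; simp add: m2_simps)+

lemma m2_neg_neg [simp]: "m2_neg (m2_neg A) = A"
  by (cases A) (simp add: m2_simps)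

lemma m2_det_mult [simp]: "m2_det (m2_mult A B) = m2_det A * m2_det B"
  by (cases A; cases B) (simp add: m2_simps algebra_simps)

lemma m2_det_neg [simp]: "m2_det (m2_neg A) = m2_det A"
  by (cases A) (simp add: m2_simps)

lemma m2_det_adj [simp]: "m2_det (m2_adj A) = m2_det A"
  by (cases A) (simp add: m2_simps algebra_simps)

lemma m2_det_one [simp]: "m2_det m2_one = 1"
  by (simp add: m2_simps)

lemma m2_tr_neg [simp]: "m2_tr (m2_neg A) = - m2_tr A"
  by (cases A) (simp add: m2_simps)

lemma m2_tr_comm: "m2_tr (m2_mult A B) = m2_tr (m2_mult B A)"
  by (cases A; cases B) (simp add: m2_simps algebra_simps)

lemma SL2_iff: "A \<in> SL2 \<longleftrightarrow> m2_det A = 1"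
  by (cases A) (simp add: SL2_def m2_det_def)

lemma m2_adj_mult: "m2_det A = 1 \<Longrightarrow> m2_mult (m2_adj A) A = m2_one" "m2_det A = 1 \<Longrightarrow> m2_mult A (m2_adj A) = m2_one"
  by (cases A; simp add: m2_simps algebra_simps)+

lemma m2_lin_mult:
  "m2_mult (m2_lin x y A) (m2_lin z w A) = m2_lin (x * z - y * w * m2_det A) (x * w + y * z + y * w * m2_tr A) A"
  by (cases A) (simp add: m2_simps algebra_simps)

lemma m2_lin_commute: "m2_mult (m2_lin x y A) (m2_lin z w A) = m2_mult (m2_lin z w A) (m2_lin x y A)"
  by (cases A) (simp add: m2_simps algebra_simps)

lemma m2_det_lin: "m2_det (m2_lin x y A) = x\<^sup>2 + x * y * m2_tr A + y\<^sup>2 * m2_det A"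
  by (cases A) (simp add: m2_simps algebra_simps power2_eq_square)

lemma m2_tr_lin: "m2_tr (m2_lin x y A) = 2 * x + y * m2_tr A"
  by (cases A) (simp add: m2_simps algebra_simps)

lemma m2_lin_self: "m2_lin 0 1 A = A" and m2_lin_scalar: "m2_lin 1 0 A = m2_one"
  by (cases A; simp add: m2_simps)+

lemma m2_neg_lin: "m2_neg (m2_lin x y A) = m2_lin (- x) (- y) A"
  by (cases A) (simp add: m2_simps)

lemma m2_cayley: "m2_mult A A = m2_lin (- m2_det A) (m2_tr A) A"
  by (cases A) (simp add: m2_simps algebra_simps)

text \<open>With determinant one, the trace condition excludes scalar matrices, so I and A are
  linearly independent.\<close>

lemma m2_lin_inj:
  fixes A :: "'a::field_char_0 m2"
  assumes "m2_det A = 1" "(m2_tr A)\<^sup>2 \<noteq> 4" "m2_lin x y A = m2_lin z w A"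
  shows "x = z \<and> y = w"
proof -
  obtain a b c d where A: "A = (a, b, c, d)" by (cases A)
  have det: "a * d - b * c = 1" using assms(1) by (simp add: A m2_det_def)
  have e: "x + y * a = z + w * a" "y * b = w * b" "y * c = w * c" "x + y * d = z + w * d"
    using assms(3) by (simp_all add: A m2_simps)
  have "y = w"
  proof (rule ccontr)
    assume ne: "y \<noteq> w"
    then have "b = 0" "c = 0" using e(2,3) by auto
    moreover have "(x + y * a) - (x + y * d) = (z + w * a) - (z + w * d)" using e(1,4) by simp
    then have "(y - w) * (a - d) = 0" by (simp add: algebra_simps)
    then have "a = d" using ne by simp
    ultimately have "(a + d)\<^sup>2 = 4" using det by (simp add: power2_eq_square)
    then show False using assms(2) by (simp add: A m2_tr_def)
  qed
  then show ?thesis using e(1) by simp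
qed

text \<open>A nonscalar 2 by 2 matrix commutes only with the algebra it generates. The coefficient
  of A is read off from a nonzero off-diagonal entry, or from the difference of the diagonal entries
  if A is diagonal.\<close>

lemma m2_commute_lin:
  fixes A :: "'a::field_char_0 m2"
  assumes "m2_det A = 1" "(m2_tr A)\<^sup>2 \<noteq> 4" "m2_mult A B = m2_mult B A"
  shows "\<exists>x y. B = m2_lin x y A"
proof -
  obtain a b c d where A: "A = (a, b, c, d)" by (cases A)
  obtain e f g h where B: "B = (e, f, g, h)" by (cases B)
  have det: "a * d - b * c = 1" using assms(1) by (simp add: A m2_det_def)
  have raw: "a * e + b * g = e * a + f * c" and eq: "a * f + b * h = e * b + f * d" "c * e + d * g = g * a + h * c"
    using assms(3) by (simp_all add: A B m2_simps)
  have bg: "b * g = f * c" using raw by (simp add: mult.commute[of e a])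
  consider "b \<noteq> 0" | "b = 0" "c \<noteq> 0" | "b = 0" "c = 0" "a \<noteq> d" | "b = 0" "c = 0" "a = d" by blast
  then show ?thesis
  proof cases
    case 1
    have "B = m2_lin (e - f / b * a) (f / b) A"
    proof -
      have "g = f / b * c" using 1 bg by (simp add: field_simps)
      moreover have "h = e - f / b * a + f / b * d" using 1 eq(1) by (simp add: field_simps)
      ultimately show ?thesis using 1 by (simp add: A B m2_simps)
    qed
    then show ?thesis by blast
  next
    case 2
    have "B = m2_lin (e - g / c * a) (g / c) A"
    proof -
      have "f = 0" using 2 bg by simp
      moreover have "h = e - g / c * a + g / c * d" using 2 eq(2) by (simp add: field_simps)
      ultimately show ?thesis using 2 by (simp add: A B m2_simps)
    qed
    then show ?thesis by blast
  next
    case 3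
    then have "f * (a - d) = 0" "g * (a - d) = 0" using eq by (simp_all add: right_diff_distrib mult.commute)
    then have fg: "f = 0" "g = 0" using 3 by simp_all
    define y where "y = (e - h) / (a - d)"
    have "y * (a - d) = e - h" using 3 by (simp add: y_def)
    then have "h = e - (y * a - y * d)" by (simp add: right_diff_distrib)
    then have "h = e - y * a + y * d" by simp
    then have "B = m2_lin (e - y * a) y A"
      using 3 fg by (simp add: A B m2_simps)
    then show ?thesis by blast
  next
    case 4
    then have "(a + d)\<^sup>2 = 4" using det by (simp add: power2_eq_square)
    then show ?thesis using assms(2) by (simp add: A m2_tr_def)
  qed
qed

text \<open>Conjugation by B turns A into its negative but preserves the trace, and 2 is
  invertible.\<close>

lemma m2_anticommute_tr:
  fixes A :: "'a::field_char_0 m2"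
  assumes "m2_det B = 1" "m2_mult A B = m2_neg (m2_mult B A)"
  shows "m2_tr A = 0"
proof -
  have "m2_tr A = m2_tr (m2_mult (m2_mult A B) (m2_adj B))"
    by (simp add: m2_mult_assoc m2_adj_mult assms(1))
  also have "\<dots> = - m2_tr (m2_mult (m2_mult B A) (m2_adj B))" by (simp add: assms(2))
  also have "\<dots> = - m2_tr A" using m2_tr_comm[of "m2_mult B A" "m2_adj B"]
    by (simp add: m2_mult_assoc[symmetric] m2_adj_mult assms(1))
  finally show ?thesis by simp
qed

text \<open>The normalizer of a torus: an element conjugating $A$ into its own centralizer
  sends $A$ to $A$ or to the inverse of $A$, and in the latter case it has trace zero.\<close>

lemma m2_normalizer:
  fixes A :: "'a::field_char_0 m2"
  assumes A: "m2_det A = 1" "(m2_tr A)\<^sup>2 \<noteq> 4" and B: "m2_det B = 1"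
    and com: "m2_mult A (m2_mult (m2_mult B A) (m2_adj B)) = m2_mult (m2_mult (m2_mult B A) (m2_adj B)) A"
  shows "m2_mult B A = m2_mult A B \<or> m2_tr B = 0"
proof -
  let ?U = "m2_mult (m2_mult B A) (m2_adj B)" and ?t = "m2_tr A"
  obtain x y where U: "?U = m2_lin x y A" using m2_commute_lin[OF A com] by blast
  have "m2_tr ?U = ?t" using m2_tr_comm[of "m2_mult B A" "m2_adj B"]
    by (simp add: m2_mult_assoc[symmetric] m2_adj_mult B)
  then have t: "2 * x + y * ?t = ?t" using U m2_tr_lin by metis
  have "m2_det ?U = 1" using A(1) B by simp
  then have d: "x\<^sup>2 + x * y * ?t + y\<^sup>2 = 1" using U m2_det_lin[of x y A] A(1) by simp
  \<comment> \<open>Multiplying the determinant equation by 4 makes x occur only as 2 x, which the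
    trace equation eliminates.\<close>
  have "4 * (x\<^sup>2 + x * y * ?t + y\<^sup>2) = (2 * x)\<^sup>2 + 2 * (2 * x) * y * ?t + 4 * y\<^sup>2"
    by (simp add: power2_eq_square algebra_simps)
  moreover have "2 * x = ?t - y * ?t" using t by (simp add: algebra_simps)
  ultimately have "4 = (?t - y * ?t)\<^sup>2 + 2 * (?t - y * ?t) * y * ?t + 4 * y\<^sup>2" using d by simp
  then have "(y\<^sup>2 - 1) * (?t\<^sup>2 - 4) = 0" by (simp add: power2_eq_square algebra_simps)
  then have "y\<^sup>2 = 1" using A(2) by simp
  then consider "y = 1" | "y = - 1" by (auto simp: power2_eq_1_iff)
  then show ?thesis
  proof cases
    case 1
    then have "?U = A" using t U m2_lin_self[of A] by simp
    then have "m2_mult ?U B = m2_mult A B" by simp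
    then show ?thesis by (simp add: m2_mult_assoc m2_adj_mult B)
  next
    case 2
    \<comment> \<open>In this case the conjugate of A is t - A, which is the inverse of A.\<close>
    then have "x = ?t" using t by simp
    then have "m2_mult ?U B = m2_mult (m2_lin ?t (- 1) A) B" using U 2 by simp
    then have BA: "m2_mult B A = m2_mult (m2_lin ?t (- 1) A) B" by (simp add: m2_mult_assoc m2_adj_mult B)
    obtain a b c d where Ae: "A = (a, b, c, d)" by (cases A)
    obtain e f g h where Be: "B = (e, f, g, h)" by (cases B)
    have det: "a * d - b * c = 1" using A(1) by (simp add: Ae m2_det_def)
    have eq: "e * a + f * c = d * e - b * g" "e * b + f * d = d * f - b * h"
       "g * a + h * c = a * g - c * e" "g * b + h * d = a * h - c * f"
      using BA by (simp_all add: Ae Be m2_simps algebra_simps)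
    show ?thesis
    proof (rule disjI2, rule ccontr)
      assume "m2_tr B \<noteq> 0"
      then have ne: "e + h \<noteq> 0" by (simp add: Be m2_tr_def)
      have "b * (e + h) = 0" using eq(2) by (simp add: algebra_simps)
      then have b: "b = 0" using ne by simp
      have "c * (e + h) = 0" using eq(3) by (simp add: algebra_simps)
      then have c: "c = 0" using ne by simp
      \<comment> \<open>With b and c zero, the two diagonal equations leave only a scalar A.\<close>
      have "(a - d) * (e + h) = (e * a - d * e) + (a * h - h * d)" by (simp add: algebra_simps)
      also have "\<dots> = 0"
      proof -
        have ea: "e * a = d * e - b * g - f * c" and ah: "a * h = g * b + h * d + c * f"
          using eq(1,4) by (simp_all add: eq_diff_eq)
        show ?thesis unfolding ea ah b c by simp
      qed
      finally have "a = d" using ne by simp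
      then have "(a + d)\<^sup>2 = 4" using det b by (simp add: power2_eq_square)
      then show False using A(2) by (simp add: Ae m2_tr_def)
    qed
  qed
qed

subsection \<open>The group $PSL_2$\<close>

lemma psl2_class_eq: "psl2_class A = psl2_class B \<longleftrightarrow> B = A \<or> B = m2_neg A"
  unfolding psl2_class_def by (auto simp: doubleton_eq_iff)

lemma psl2_class_neg [simp]: "psl2_class (m2_neg A) = psl2_class A"
  by (auto simp: psl2_class_def)

lemma psl2_mult [simp]: "psl2_class A \<otimes>\<^bsub>PSL2\<^esub> psl2_class B = psl2_class (m2_mult A B)"
proof -
  have "{m2_mult P Q | P Q. P \<in> {A, m2_neg A} \<and> Q \<in> {B, m2_neg B}} = {m2_mult A B, m2_neg (m2_mult A B)}"
  proof (intro equalityI subsetI)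
    fix Z assume "Z \<in> {m2_mult A B, m2_neg (m2_mult A B)}"
    then have "Z = m2_mult A B \<or> Z = m2_mult (m2_neg A) B" by simp
    then show "Z \<in> {m2_mult P Q | P Q. P \<in> {A, m2_neg A} \<and> Q \<in> {B, m2_neg B}}" by blast
  qed (auto simp del: split_paired_Ex)
  then show ?thesis by (simp add: PSL2_def psl2_class_def)
qed

lemma psl2_one: "\<one>\<^bsub>PSL2\<^esub> = psl2_class m2_one"
  by (simp add: PSL2_def)

lemma psl2_carrier: "carrier PSL2 = psl2_class ` SL2"
  by (simp add: PSL2_def)

lemma group_PSL2: "group (PSL2 :: ('a::field m2 set) monoid)"
proof (rule groupI)
  fix x :: "'a m2 set" assume "x \<in> carrier PSL2"
  then obtain A where A: "m2_det A = 1" "x = psl2_class A" by (auto simp: psl2_carrier SL2_iff)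
  then have "psl2_class (m2_adj A) \<in> carrier PSL2" by (auto simp: psl2_carrier SL2_iff)
  then show "\<exists>y\<in>carrier PSL2. y \<otimes>\<^bsub>PSL2\<^esub> x = \<one>\<^bsub>PSL2\<^esub>"
    using A m2_adj_mult by (metis psl2_mult psl2_one)
qed (auto simp: psl2_carrier SL2_iff psl2_one m2_mult_assoc)

abbreviation psl2_times (infixl "\<star>" 70) where
  "g \<star> h \<equiv> g \<otimes>\<^bsub>PSL2\<^esub> h"

abbreviation psl2_on :: "'a::field m2 set set \<Rightarrow> 'a m2 set monoid" where
  "psl2_on H \<equiv> PSL2\<lparr>carrier := H\<rparr>"

lemma psl2_inv: "m2_det A = 1 \<Longrightarrow> inv\<^bsub>PSL2\<^esub> psl2_class A = psl2_class (m2_adj A)"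
  by (rule group.inv_equality[OF group_PSL2]) (auto simp: psl2_carrier SL2_iff psl2_one m2_adj_mult)

subsection \<open>Non-archimedean local fields\<close>

locale local_field =
  fixes v :: "'a::field_char_0 \<Rightarrow> real"
  assumes local_field: "nonarch_local_field v"
begin

lemma v_nonneg [simp]: "0 \<le> v x"
  and v_eq_0 [simp]: "v x = 0 \<longleftrightarrow> x = 0"
  and v_mult [simp]: "v (x * y) = v x * v y"
  and v_add: "v (x + y) \<le> max (v x) (v y)"
  using local_field unfolding nonarch_local_field_def by auto

definition \<pi> :: 'a where
  "\<pi> = (SOME p. 0 < v p \<and> v p < 1 \<and> (\<forall>x. x \<noteq> 0 \<longrightarrow> (\<exists>k::int. v x = v p powi k)))"

lemma pi_props: "0 < v \<pi> \<and> v \<pi> < 1 \<and> (\<forall>x. x \<noteq> 0 \<longrightarrow> (\<exists>k::int. v x = v \<pi> powi k))"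
  unfolding \<pi>_def
  by (rule someI_ex) (use local_field in \<open>auto simp: nonarch_local_field_def\<close>)

lemma pi_pos: "0 < v \<pi>" and pi_less_1: "v \<pi> < 1" and v_pi_power: "x \<noteq> 0 \<Longrightarrow> \<exists>k::int. v x = v \<pi> powi k"
  using pi_props by auto

lemma pi_nonzero [simp]: "\<pi> \<noteq> 0"
  using pi_pos v_eq_0 by (metis less_irrefl)

lemma complete:
  fixes s :: "nat \<Rightarrow> 'a"
  assumes "\<And>e. e > 0 \<Longrightarrow> \<exists>N. \<forall>m\<ge>N. \<forall>n\<ge>N. v (s m - s n) < e"
  shows "\<exists>L. \<forall>e>0. \<exists>N. \<forall>n\<ge>N. v (s n - L) < e"
proof -
  have "\<forall>s::nat \<Rightarrow> 'a. (\<forall>e>0. \<exists>N. \<forall>m\<ge>N. \<forall>n\<ge>N. v (s m - s n) < e) \<longrightarrow>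
         (\<exists>L. \<forall>e>0. \<exists>N. \<forall>n\<ge>N. v (s n - L) < e)"
    using local_field unfolding nonarch_local_field_def by (elim conjE) assumption
  from mp[OF spec[OF this, of s]] show ?thesis using assms by simp
qed

lemma residue_finite: "finite ((\<lambda>x. {y. v y \<le> 1 \<and> v (x - y) < 1}) ` {x. v x \<le> 1})"
  using local_field unfolding nonarch_local_field_def by (elim conjE) assumption

lemma v_pos: "x \<noteq> 0 \<Longrightarrow> 0 < v x"
  using v_nonneg[of x] v_eq_0[of x] by linarith

lemma v_0 [simp]: "v 0 = 0"
  by simp

lemma v_1 [simp]: "v 1 = 1"
  using v_mult[of 1 1] v_eq_0[of 1] by simp

lemma v_minus [simp]: "v (- x) = v x"
proof -
  have "v (- 1) * v (- 1) = 1" using v_mult[of "- 1" "- 1"] by simp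
  then have "v (- 1) = 1" using v_nonneg[of "- 1"] by (simp add: square_eq_1_iff)
  then show ?thesis using v_mult[of "- 1" x] by simp
qed

lemma v_diff: "v (x - y) \<le> max (v x) (v y)"
  using v_add[of x "- y"] by simp

lemma v_diff_comm: "v (x - y) = v (y - x)"
  using v_minus[of "x - y"] by simp

lemma v_triangle: "v (x - z) \<le> max (v (x - y)) (v (y - z))"
  using v_add[of "x - y" "y - z"] by simp

lemma v_inverse [simp]: "v (inverse x) = inverse (v x)"
proof (cases "x = 0")
  case False
  then have "v x * v (inverse x) = 1" using v_mult[of x "inverse x"] by simp
  then show ?thesis by (simp add: inverse_unique)
qed simp

lemma v_divide [simp]: "v (x / y) = v x / v y"
  by (simp add: field_class.field_divide_inverse)

lemma v_power [simp]: "v (x ^ n) = v x ^ n"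
  by (induction n) simp_all

lemma v_powi [simp]: "v (x powi k) = v x powi k"
  by (cases k) (simp_all add: power_int_def)

lemma v_add_eq: "v x < v y \<Longrightarrow> v (x + y) = v y"
  using v_add[of x y] v_diff[of "x + y" x] by simp

lemma v_of_nat: "v (of_nat n) \<le> 1"
proof (induction n)
  case (Suc n)
  then show ?case using v_add[of 1 "of_nat n"] by simp
qed simp

lemma v_numeral: "v (numeral k) \<le> 1"
  using v_of_nat[of "numeral k"] by simp

section \<open>Discreteness of the value group and total boundedness of balls\<close>

lemma v_less_1: "v x < 1 \<Longrightarrow> v x \<le> v \<pi>"
proof (cases "x = 0")
  case False
  assume less: "v x < 1"
  obtain k :: int where k: "v x = v \<pi> powi k" using v_pi_power[OF False] by blast
  have "k \<ge> 1"
  proof (rule ccontr)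
    assume "\<not> k \<ge> 1"
    then have "v \<pi> powi 0 \<le> v \<pi> powi k" using pi_pos pi_less_1 by (intro power_int_decreasing) auto
    then show False using less k by simp
  qed
  then have "v \<pi> powi k \<le> v \<pi> powi 1" using pi_pos pi_less_1 by (intro power_int_decreasing) auto
  then show ?thesis using k by simp
qed (use pi_pos in simp)

text \<open>Writing x as y + \<pi> z, with y from a finite set of residue representatives and z
  integral, gains one digit per step. Here the finiteness of the residue field enters.\<close>

lemma unit_ball_net: "\<exists>F. finite F \<and> (\<forall>x. v x \<le> 1 \<longrightarrow> (\<exists>y\<in>F. v (x - y) \<le> v \<pi> ^ n))"
proof (induction n)
  case 0
  have "\<forall>x. v x \<le> 1 \<longrightarrow> (\<exists>y\<in>{0}. v (x - y) \<le> v \<pi> ^ 0)" by simp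
  then show ?case by blast
next
  case (Suc n)
  let ?f = "\<lambda>x. {y. v y \<le> 1 \<and> v (x - y) < 1}"
  obtain F where F: "finite F" "\<And>x. v x \<le> 1 \<Longrightarrow> \<exists>y\<in>F. v (x - y) \<le> v \<pi> ^ n" using Suc by blast
  obtain E where E: "E \<subseteq> {x. v x \<le> 1}" "finite E" "?f ` {x. v x \<le> 1} = ?f ` E"
    using finite_subset_image[OF residue_finite subset_refl] by blast
  have "\<exists>w\<in>(\<lambda>(y, z). y + \<pi> * z) ` (E \<times> F). v (x - w) \<le> v \<pi> ^ Suc n" if x: "v x \<le> 1" for x
  proof -
    obtain y where y: "y \<in> E" "?f x = ?f y" using x E(3) by blast
    then have "y \<in> ?f x" using E(1) by auto
    then have "v (x - y) \<le> v \<pi>" using v_less_1 by simp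
    then have "v ((x - y) / \<pi>) \<le> 1" using pi_pos by simp
    then obtain z where z: "z \<in> F" "v ((x - y) / \<pi> - z) \<le> v \<pi> ^ n" using F(2) by blast
    have "x - (y + \<pi> * z) = \<pi> * ((x - y) / \<pi> - z)" by (simp add: field_simps)
    then have "v (x - (y + \<pi> * z)) = v \<pi> * v ((x - y) / \<pi> - z)" by (simp only: v_mult)
    also have "\<dots> \<le> v \<pi> ^ Suc n" using z(2) pi_pos by simp
    finally have "v (x - (y + \<pi> * z)) \<le> v \<pi> ^ Suc n" .
    moreover have "y + \<pi> * z \<in> (\<lambda>(y, z). y + \<pi> * z) ` (E \<times> F)"
      by (rule image_eqI[of _ _ "(y, z)"]) (use y(1) z(1) in simp_all)
    ultimately show ?thesis by blast
  qed
  moreover have "finite ((\<lambda>(y, z). y + \<pi> * z) ` (E \<times> F))" using E(2) F(1) by simp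
  ultimately show ?case by blast
qed

lemma small_power: "e > 0 \<Longrightarrow> \<exists>n. v \<pi> ^ n < e"
  using real_arch_pow_inv[of e "v \<pi>"] pi_less_1 by simp

lemma large_power: "\<exists>n. R \<le> v (inverse \<pi> ^ n)"
proof -
  have "1 < inverse (v \<pi>)" using pi_pos pi_less_1 by (simp add: one_less_inverse)
  from real_arch_pow[OF this, of R] obtain n where "R < inverse (v \<pi>) ^ n" by blast
  then show ?thesis by (intro exI[of _ n]) simp
qed

lemma ball_net:
  assumes "e > 0"
  shows "\<exists>F. finite F \<and> (\<forall>x. v x \<le> R \<longrightarrow> (\<exists>y\<in>F. v (x - y) < e))"
proof -
  obtain m where m: "R \<le> v (inverse \<pi> ^ m)" using large_power by blast
  define c where "c = inverse \<pi> ^ m"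
  have c: "0 < v c" "c \<noteq> 0" using pi_pos by (simp_all add: c_def)
  obtain n where n: "v \<pi> ^ n < e / v c" using small_power[of "e / v c"] assms c by auto
  obtain F where F: "finite F" "\<And>x. v x \<le> 1 \<Longrightarrow> \<exists>y\<in>F. v (x - y) \<le> v \<pi> ^ n" using unit_ball_net by metis
  have "\<exists>w\<in>(\<lambda>y. c * y) ` F. v (x - w) < e" if x: "v x \<le> R" for x
  proof -
    have "v (x / c) \<le> 1" using x m c by (simp add: c_def[symmetric])
    then obtain y where y: "y \<in> F" "v (x / c - y) \<le> v \<pi> ^ n" using F(2) by blast
    have "x - c * y = c * (x / c - y)" using c by (simp add: right_diff_distrib)
    then have "v (x - c * y) = v c * v (x / c - y)" by (simp only: v_mult)
    also have "\<dots> \<le> v c * v \<pi> ^ n" using y(2) c by simp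
    also have "\<dots> < e" using n c by (simp add: pos_less_divide_eq mult.commute)
    finally show ?thesis using y(1) by blast
  qed
  then show ?thesis using F(1) by blast
qed

definition m2_norm :: "'a m2 \<Rightarrow> real" where
  "m2_norm = (\<lambda>(a,b,c,d). max (max (v a) (v b)) (max (v c) (v d)))"

definition m2_diff :: "'a m2 \<Rightarrow> 'a m2 \<Rightarrow> 'a m2" where
  "m2_diff = (\<lambda>(a,b,c,d) (e,f,g,h). (a - e, b - f, c - g, d - h))"

lemma m2_dist_norm: "m2_dist v A B = m2_norm (m2_diff A B)"
  by (cases A; cases B) (simp add: m2_dist_def m2_norm_def m2_diff_def)

lemma m2_norm_adj [simp]: "m2_norm (m2_adj A) = m2_norm A"
  by (cases A) (simp add: m2_norm_def m2_adj_def max.assoc max.commute max.left_commute)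

lemma m2_norm_nonneg: "0 \<le> m2_norm A"
  by (cases A) (simp add: m2_norm_def le_max_iff_disj)

lemma m2_norm_entries: "m2_norm (a, b, c, d) \<le> R \<longleftrightarrow> v a \<le> R \<and> v b \<le> R \<and> v c \<le> R \<and> v d \<le> R"
  by (auto simp: m2_norm_def)

lemma m2_norm_mult: "m2_norm (m2_mult A B) \<le> m2_norm A * m2_norm B"
proof -
  obtain a b c d where A: "A = (a, b, c, d)" by (cases A)
  obtain e f g h where B: "B = (e, f, g, h)" by (cases B)
  have vA: "v a \<le> m2_norm A" "v b \<le> m2_norm A" "v c \<le> m2_norm A" "v d \<le> m2_norm A"
    by (auto simp: A m2_norm_def)
  have vB: "v e \<le> m2_norm B" "v f \<le> m2_norm B" "v g \<le> m2_norm B" "v h \<le> m2_norm B"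
    by (auto simp: B m2_norm_def)
  have bound: "v (x * y + z * w) \<le> m2_norm A * m2_norm B"
    if "v x \<le> m2_norm A" "v y \<le> m2_norm B" "v z \<le> m2_norm A" "v w \<le> m2_norm B" for x y z w
  proof -
    have "v x * v y \<le> m2_norm A * m2_norm B" "v z * v w \<le> m2_norm A * m2_norm B"
      using that m2_norm_nonneg[of A] m2_norm_nonneg[of B] by (auto intro!: mult_mono)
    then show ?thesis using v_add[of "x * y" "z * w"] by simp
  qed
  have "m2_mult A B = (a * e + b * g, a * f + b * h, c * e + d * g, c * f + d * h)"
    by (simp add: A B m2_mult_def)
  then show ?thesis using bound vA vB by (simp only: m2_norm_entries)
qed

text \<open>The difference of I and A^-1 B is A^-1 (A - B), and the adjugate has the same norm as A.
  So close lifts have a quotient close to I.\<close>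

lemma m2_dist_lift:
  assumes "m2_det A = 1" "m2_norm A \<le> R"
  shows "m2_dist v m2_one (m2_mult (m2_adj A) B) \<le> R * m2_dist v A B"
proof -
  have "m2_diff m2_one (m2_mult (m2_adj A) B) = m2_mult (m2_adj A) (m2_diff A B)"
    unfolding m2_adj_mult(1)[OF assms(1), symmetric]
    by (cases A; cases B) (simp add: m2_simps m2_diff_def algebra_simps)
  then have "m2_dist v m2_one (m2_mult (m2_adj A) B) \<le> m2_norm (m2_adj A) * m2_norm (m2_diff A B)"
    using m2_norm_mult[of "m2_adj A" "m2_diff A B"] by (simp add: m2_dist_norm)
  also have "\<dots> \<le> R * m2_dist v A B"
    using assms(2) by (simp add: m2_dist_norm mult_right_mono m2_norm_nonneg)
  finally show ?thesis .
qed

text \<open>Pigeonhole: rounding the entries to a finite net identifies two members of an infinite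
  set.\<close>

lemma bounded_infinite_close:
  assumes inf: "infinite T" and bdd: "\<And>A. A \<in> T \<Longrightarrow> m2_norm A \<le> R" and e: "e > 0"
  shows "\<exists>A\<in>T. \<exists>B\<in>T. A \<noteq> B \<and> m2_dist v A B < e"
proof -
  obtain F where F: "finite F" "\<And>x. v x \<le> R \<Longrightarrow> \<exists>y\<in>F. v (x - y) < e" using ball_net[OF e] by metis
  define p where "p x = (SOME y. y \<in> F \<and> v (x - y) < e)" for x
  have p: "p x \<in> F \<and> v (x - p x) < e" if "v x \<le> R" for x
    unfolding p_def by (rule someI_ex) (use F(2)[OF that] in blast)
  define q where "q = (\<lambda>(a, b, c, d). (p a, p b, p c, p d))"
  have "q ` T \<subseteq> F \<times> F \<times> F \<times> F"
  proof
    fix z assume "z \<in> q ` T"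
    then obtain a b c d where A: "(a, b, c, d) \<in> T" "z = q (a, b, c, d)" by auto
    then show "z \<in> F \<times> F \<times> F \<times> F" using bdd[OF A(1)] p by (simp add: m2_norm_entries q_def)
  qed
  then have "finite (q ` T)" using F(1) finite_subset by blast
  then have "\<not> inj_on q T" using inf finite_imageD by blast
  then obtain A B where AB: "A \<in> T" "B \<in> T" "A \<noteq> B" "q A = q B" unfolding inj_on_def by blast
  obtain a b c d where A: "A = (a, b, c, d)" by (cases A)
  obtain a' b' c' d' where B: "B = (a', b', c', d')" by (cases B)
  have close: "v (x - y) < e" if "v x \<le> R" "v y \<le> R" "p x = p y" for x y
  proof -
    have "v (x - p x) < e" "v (p x - y) < e"
      using p[OF that(1)] p[OF that(2)] that(3) v_diff_comm[of "p x" y] by auto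
    then show ?thesis using v_triangle[of x y "p x"] by linarith
  qed
  have "v a \<le> R" "v b \<le> R" "v c \<le> R" "v d \<le> R" "v a' \<le> R" "v b' \<le> R" "v c' \<le> R" "v d' \<le> R"
    using bdd[OF AB(1)] bdd[OF AB(2)] by (simp_all add: A B m2_norm_entries)
  moreover have "p a = p a'" "p b = p b'" "p c = p c'" "p d = p d'" using AB(4) by (simp_all add: q_def A B)
  ultimately have "m2_dist v A B < e" using close by (simp add: A B m2_dist_def)
  then show ?thesis using AB by blast
qed

end

subsection \<open>Discrete subgroups without 2-torsion\<close>

locale discrete_PSL2 = local_field v for v :: "'a::field_char_0 \<Rightarrow> real" +
  fixes G :: "'a m2 set set"
  assumes sub: "subgroup G PSL2"
    and discrete: "psl2_discrete v G"
    and no_2_torsion: "\<forall>g\<in>G. g \<star> g = \<one>\<^bsub>PSL2\<^esub> \<longrightarrow> g = \<one>\<^bsub>PSL2\<^esub>"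
begin

sublocale PSL2: group "PSL2 :: ('a m2 set) monoid"
  by (rule group_PSL2)

sublocale G: subgroup G PSL2
  by (rule sub)

lemma G_lift:
  assumes "g \<in> G"
  obtains A where "m2_det A = 1" "g = psl2_class A"
  using G.mem_carrier[OF assms] by (auto simp: psl2_carrier SL2_iff)

text \<open>Openness in the quotient is tested on lifts, so an open set isolating the neutral
  element contains the class of every matrix of determinant one near I.\<close>

lemma isolated_one: "\<exists>e>0. \<forall>B. m2_det B = 1 \<longrightarrow> psl2_class B \<in> G \<longrightarrow> m2_dist v m2_one B < e \<longrightarrow> psl2_class B = \<one>\<^bsub>PSL2\<^esub>"
proof -
  obtain U where U: "psl2_open v U" "U \<inter> G = {\<one>\<^bsub>PSL2\<^esub>}"
    using discrete G.one_closed unfolding psl2_discrete_def by blast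
  have one: "m2_one \<in> \<Union>U" using U(2) by (auto simp: psl2_one psl2_class_def)
  obtain e where e: "e > 0" "\<And>B. B \<in> SL2 \<Longrightarrow> m2_dist v m2_one B < e \<Longrightarrow> B \<in> \<Union>U"
    using U(1) one unfolding psl2_open_def by blast
  have "psl2_class B = \<one>\<^bsub>PSL2\<^esub>" if B: "m2_det B = 1" "psl2_class B \<in> G" "m2_dist v m2_one B < e" for B
  proof -
    obtain P where P: "B \<in> P" "P \<in> U" using e(2)[of B] B by (auto simp: SL2_iff)
    then obtain A where "P = psl2_class A" using U(1) by (auto simp: psl2_open_def psl2_carrier)
    then have "P = psl2_class B" using P(1) by (auto simp: psl2_class_def)
    then show ?thesis using P(2) U(2) B(2) by blast
  qed
  then show ?thesis using e(1) by blast
qed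

text \<open>Among infinitely many bounded lifts two are so close that their quotient falls into the
  isolating ball, and then they represent the same element.\<close>

lemma bounded_finite:
  assumes T: "T \<subseteq> G" and bdd: "\<And>g. g \<in> T \<Longrightarrow> \<exists>A. m2_det A = 1 \<and> g = psl2_class A \<and> m2_norm A \<le> R"
  shows "finite T"
proof (rule ccontr)
  assume inf: "infinite T"
  define L where "L g = (SOME A. m2_det A = 1 \<and> g = psl2_class A \<and> m2_norm A \<le> R)" for g
  have L: "m2_det (L g) = 1 \<and> g = psl2_class (L g) \<and> m2_norm (L g) \<le> R" if "g \<in> T" for g
    unfolding L_def by (rule someI_ex) (rule bdd[OF that])
  have "inj_on L T" using L by (metis inj_onI)
  then have infL: "infinite (L ` T)" using inf finite_imageD by blast
  obtain e where e: "e > 0" and iso: "\<And>B. m2_det B = 1 \<Longrightarrow> psl2_class B \<in> G \<Longrightarrow> m2_dist v m2_one B < e \<Longrightarrow> psl2_class B = \<one>\<^bsub>PSL2\<^esub>"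
    using isolated_one by blast
  \<comment> \<open>Taking the maximum with 1 makes the bound positive, so that e can be divided by
    it.\<close>
  define R' where "R' = max R 1"
  have R': "R' > 0" "R \<le> R'" by (simp_all add: R'_def)
  obtain A B where AB: "A \<in> L ` T" "B \<in> L ` T" "A \<noteq> B" "m2_dist v A B < e / R'"
  proof -
    have "\<And>A. A \<in> L ` T \<Longrightarrow> m2_norm A \<le> R" using L by blast
    from bounded_infinite_close[OF infL this divide_pos_pos[OF e R'(1)]] show ?thesis using that by blast
  qed
  obtain g h where g: "g \<in> T" "A = L g" and h: "h \<in> T" "B = L h" using AB by blast
  have gA: "m2_det A = 1" "g = psl2_class A" "m2_norm A \<le> R'" using L[OF g(1)] g(2) R' by auto
  have hB: "m2_det B = 1" "h = psl2_class B" using L[OF h(1)] h(2) by auto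
  let ?C = "m2_mult (m2_adj A) B"
  have C: "psl2_class ?C = inv\<^bsub>PSL2\<^esub> g \<star> h" using gA hB by (simp add: psl2_inv)
  have gh: "g \<in> G" "h \<in> G" using g h T by auto
  then have "psl2_class ?C \<in> G" unfolding C by blast
  moreover have "m2_dist v m2_one ?C < e"
    using m2_dist_lift[OF gA(1,3), of B] AB(4) R' by (simp add: pos_less_divide_eq mult.commute)
  ultimately have "inv\<^bsub>PSL2\<^esub> g \<star> h = \<one>\<^bsub>PSL2\<^esub>" using iso[of ?C] gA(1) hB(1) C by simp
  then have "g = h" using gh by (metis G.mem_carrier PSL2.inv_closed PSL2.inv_equality PSL2.inv_inv)
  then show False using AB(3) g(2) h(2) by simp
qed

text \<open>Two different eigenvalues, and not an involution; neither condition depends on the sign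
  of the lift.\<close>

definition regular :: "'a m2 set \<Rightarrow> bool" where
  "regular g \<longleftrightarrow> g \<in> G \<and> (\<exists>A. m2_det A = 1 \<and> g = psl2_class A \<and> m2_tr A \<noteq> 0 \<and> (m2_tr A)\<^sup>2 \<noteq> 4)"

lemma tr_zero:
  assumes "psl2_class A \<in> G" "m2_det A = 1" "m2_tr A = 0"
  shows "psl2_class A = \<one>\<^bsub>PSL2\<^esub>"
proof -
  have "m2_mult A A = m2_neg m2_one"
  proof -
    have "m2_lin (- 1) 0 A = m2_neg m2_one" by (cases A) (simp add: m2_simps)
    then show ?thesis using m2_cayley[of A] assms(2,3) by simp
  qed
  then have "psl2_class A \<star> psl2_class A = \<one>\<^bsub>PSL2\<^esub>" by (simp add: psl2_one)
  then show ?thesis using no_2_torsion assms(1) by blast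
qed

text \<open>Lifts of commuting classes commute up to sign, and the sign -1 would force trace
  zero.\<close>

lemma commute_lift:
  fixes A B :: "'a m2"
  assumes "m2_det A = 1" "m2_tr A \<noteq> 0" "m2_det B = 1"
    and "psl2_class A \<star> psl2_class B = psl2_class B \<star> psl2_class A"
  shows "m2_mult A B = m2_mult B A"
proof -
  have "m2_mult B A = m2_mult A B \<or> m2_mult B A = m2_neg (m2_mult A B)"
    using assms(4) by (simp add: psl2_class_eq)
  moreover have "m2_mult B A \<noteq> m2_neg (m2_mult A B)"
  proof
    assume "m2_mult B A = m2_neg (m2_mult A B)"
    then have "m2_mult A B = m2_neg (m2_mult B A)" by simp
    then show False using m2_anticommute_tr[OF assms(3)] assms(2) by blast
  qed
  ultimately show ?thesis by simp
qed

lemma regular_centralizer: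
  assumes g: "regular g" and h: "h \<in> G" "g \<star> h = h \<star> g"
    and k: "k \<in> G" "g \<star> k = k \<star> g"
  shows "h \<star> k = k \<star> h"
proof -
  obtain A where A: "m2_det A = 1" "g = psl2_class A" "m2_tr A \<noteq> 0" "(m2_tr A)\<^sup>2 \<noteq> 4"
    using g by (auto simp: regular_def)
  obtain B where B: "m2_det B = 1" "h = psl2_class B" using G_lift[OF h(1)] .
  obtain C where C: "m2_det C = 1" "k = psl2_class C" using G_lift[OF k(1)] .
  have "m2_mult A B = m2_mult B A" "m2_mult A C = m2_mult C A"
    using commute_lift[OF A(1,3) B(1)] commute_lift[OF A(1,3) C(1)] h(2) k(2)
    unfolding A(2) B(2) C(2) by simp_all
  then obtain x y z w where "B = m2_lin x y A" "C = m2_lin z w A"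
    using m2_commute_lin[OF A(1,4)] by metis
  then have "m2_mult B C = m2_mult C B" using m2_lin_commute by simp
  then show ?thesis using B C by simp
qed

text \<open>By \<open>m2_normalizer\<close> the lifts commute or the lift of x has trace zero; in
  the second case x is trivial, as there is no 2-torsion.\<close>

lemma regular_normalizer:
  assumes g: "regular g" and x: "x \<in> G"
    and com: "(x \<star> g \<star> inv\<^bsub>PSL2\<^esub> x) \<star> g = g \<star> (x \<star> g \<star> inv\<^bsub>PSL2\<^esub> x)"
  shows "x \<star> g = g \<star> x"
proof -
  obtain A where A: "m2_det A = 1" "g = psl2_class A" "m2_tr A \<noteq> 0" "(m2_tr A)\<^sup>2 \<noteq> 4"
    using g by (auto simp: regular_def)
  obtain B where B: "m2_det B = 1" "x = psl2_class B" using G_lift[OF x] .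
  let ?U = "m2_mult (m2_mult B A) (m2_adj B)"
  have "x \<star> g \<star> inv\<^bsub>PSL2\<^esub> x = psl2_class ?U" using A B by (simp add: psl2_inv)
  then have "m2_mult A ?U = m2_mult ?U A"
    using commute_lift[OF A(1,3), of ?U] A B com by simp
  then consider "m2_mult B A = m2_mult A B" | "m2_tr B = 0"
    using m2_normalizer[OF A(1,4) B(1)] by blast
  then show ?thesis
  proof cases
    case 1
    then show ?thesis using A B by simp
  next
    case 2
    then have "x = \<one>\<^bsub>PSL2\<^esub>" using tr_zero B x by simp
    then show ?thesis using G.mem_carrier g by (simp add: regular_def)
  qed
qed

text \<open>Since A - I squares to zero, the n-th power of A is I + n (A - I).\<close>

lemma unipotent_pow:
  fixes A :: "'a m2"
  assumes "m2_det A = 1" "m2_tr A = 2"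
  shows "psl2_class A [^]\<^bsub>PSL2\<^esub> n = psl2_class (m2_lin (1 - of_nat n) (of_nat n) A)"
proof (induction n)
  case 0
  then show ?case by (simp add: psl2_one m2_lin_scalar)
next
  case (Suc n)
  have "psl2_class A [^]\<^bsub>PSL2\<^esub> Suc n = psl2_class (m2_mult (m2_lin (1 - of_nat n) (of_nat n) A) (m2_lin 0 1 A))"
    by (simp add: Suc m2_lin_self)
  also have "m2_mult (m2_lin (1 - of_nat n) (of_nat n) A) (m2_lin 0 1 A) = m2_lin (1 - of_nat (Suc n)) (of_nat (Suc n)) A"
    unfolding m2_lin_mult by (simp add: assms algebra_simps)
  finally show ?case .
qed

text \<open>If I + n (A - I) is scalar then so is A, because n is invertible in characteristic zero;
  trace 2 then makes A the identity.\<close>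

lemma unipotent_torsion:
  fixes A :: "'a m2" and n :: nat
  assumes A: "m2_det A = 1" "m2_tr A = 2" and n: "n > 0" "psl2_class A [^]\<^bsub>PSL2\<^esub> n = \<one>\<^bsub>PSL2\<^esub>"
  shows "psl2_class A = \<one>\<^bsub>PSL2\<^esub>"
proof -
  obtain a b c d where Ae: "A = (a, b, c, d)" by (cases A)
  define N where "N = (of_nat n :: 'a)"
  have N: "N \<noteq> 0" using n by (simp add: N_def)
  have "psl2_class m2_one = psl2_class (m2_lin (1 - N) N A)"
    using n(2) unipotent_pow[OF A] by (simp add: psl2_one N_def)
  then have "m2_lin (1 - N) N A = m2_one \<or> m2_lin (1 - N) N A = m2_neg m2_one"
    by (simp only: psl2_class_eq)
  then obtain u where "m2_lin (1 - N) N A = (u, 0, 0, u)" by (auto simp: m2_one_def m2_neg_def)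
  then have "N * b = 0" "N * c = 0" "1 - N + N * a = u" "1 - N + N * d = u"
    by (simp_all add: Ae m2_lin_def)
  then have "N * b = 0" "N * c = 0" "N * a = N * d" by (metis add_left_cancel)+
  then have "b = 0" "c = 0" "a = d" using N by auto
  moreover have "a + d = 2" using A(2) by (simp add: Ae m2_tr_def)
  ultimately have "a = 1" "A = m2_one" by (auto simp: Ae m2_one_def)
  then show ?thesis by (simp add: psl2_one)
qed

lemma torsion_regular:
  fixes n :: nat
  assumes g: "g \<in> G" "g \<noteq> \<one>\<^bsub>PSL2\<^esub>" and n: "n > 0" "g [^]\<^bsub>PSL2\<^esub> n = \<one>\<^bsub>PSL2\<^esub>"
  shows "regular g"
proof -
  obtain A where A: "m2_det A = 1" "g = psl2_class A" using G_lift[OF g(1)] .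
  have "m2_tr A \<noteq> 0"
  proof
    assume "m2_tr A = 0"
    then have "g = \<one>\<^bsub>PSL2\<^esub>" using tr_zero[OF _ A(1)] A(2) g(1) by simp
    then show False using g(2) by simp
  qed
  moreover have "(m2_tr A)\<^sup>2 \<noteq> 4"
  proof
    assume "(m2_tr A)\<^sup>2 = 4"
    then have "(m2_tr A)\<^sup>2 = 2\<^sup>2" by simp
    then consider "m2_tr A = 2" | "m2_tr A = - 2" using power2_eq_iff by blast
    then show False
    proof cases
      case 1
      then show False using unipotent_torsion[OF A(1)] n g A by simp
    next
      case 2
      then show False using unipotent_torsion[of "m2_neg A" n] n g A by simp
    qed
  qed
  ultimately show ?thesis unfolding regular_def using A g(1) by blast
qed

lemma finite_subgroup_regular:
  assumes K: "subgroup K PSL2" "K \<subseteq> G" "finite K" and g: "g \<in> K" "g \<noteq> \<one>\<^bsub>PSL2\<^esub>"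
  shows "regular g"
proof -
  interpret K: group "psl2_on K" using PSL2.subgroup_imp_group[OF K(1)] .
  show ?thesis
  proof (rule torsion_regular)
    have "g [^]\<^bsub>psl2_on K\<^esub> Coset.order (psl2_on K) = \<one>\<^bsub>psl2_on K\<^esub>"
      using K.pow_order_eq_1 g(1) by simp
    then show "g [^]\<^bsub>PSL2\<^esub> Coset.order (psl2_on K) = \<one>\<^bsub>PSL2\<^esub>"
      using PSL2.nat_pow_consistent[of g _ K] by simp
    show "0 < Coset.order (psl2_on K)" using K(3) g(1) by (auto simp: Coset.order_def card_gt_0_iff)
  qed (use g K in auto)
qed

lemma finite_subgroup_abelian:
  assumes K: "subgroup K PSL2" "K \<subseteq> G" "finite K" and a: "a \<in> K" and b: "b \<in> K"
  shows "a \<star> b = b \<star> a"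
proof -
  interpret K: group "psl2_on K" using PSL2.subgroup_imp_group[OF K(1)] .
  have inv: "inv\<^bsub>psl2_on K\<^esub> x = inv\<^bsub>PSL2\<^esub> x" if "x \<in> K" for x
    using PSL2.m_inv_consistent[OF K(1) that] .
  note reg = finite_subgroup_regular[OF K]
  have "a \<otimes>\<^bsub>psl2_on K\<^esub> b = b \<otimes>\<^bsub>psl2_on K\<^esub> a"
  proof (rule K.finite_abelian_of_centralizers)
    show "h \<otimes>\<^bsub>psl2_on K\<^esub> k = k \<otimes>\<^bsub>psl2_on K\<^esub> h"
      if "g \<in> carrier (psl2_on K)" "g \<noteq> \<one>\<^bsub>psl2_on K\<^esub>"
        "h \<in> carrier (psl2_on K)" "k \<in> carrier (psl2_on K)"
        "g \<otimes>\<^bsub>psl2_on K\<^esub> h = h \<otimes>\<^bsub>psl2_on K\<^esub> g"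
        "g \<otimes>\<^bsub>psl2_on K\<^esub> k = k \<otimes>\<^bsub>psl2_on K\<^esub> g" for g h k
      using regular_centralizer[OF reg[of g], of h k] that K(2) by (simp add: subset_iff)
    show "x \<otimes>\<^bsub>psl2_on K\<^esub> g = g \<otimes>\<^bsub>psl2_on K\<^esub> x"
      if "g \<in> carrier (psl2_on K)" "g \<noteq> \<one>\<^bsub>psl2_on K\<^esub>" "x \<in> carrier (psl2_on K)"
        "x \<otimes>\<^bsub>psl2_on K\<^esub> g \<otimes>\<^bsub>psl2_on K\<^esub> inv\<^bsub>psl2_on K\<^esub> x \<otimes>\<^bsub>psl2_on K\<^esub> g =
         g \<otimes>\<^bsub>psl2_on K\<^esub> (x \<otimes>\<^bsub>psl2_on K\<^esub> g \<otimes>\<^bsub>psl2_on K\<^esub> inv\<^bsub>psl2_on K\<^esub> x)" for g x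
      using regular_normalizer[OF reg[of g], of x] that K(2) inv by (simp add: subset_iff)
  qed (use K a b in auto)
  then show ?thesis by simp
qed

end

subsection \<open>Two criteria for abelian groups\<close>

lemma (in comm_group) ord_mult_coprime:
  assumes x: "x \<in> carrier G" and y: "y \<in> carrier G" and cop: "coprime (ord x) (ord y)"
  shows "ord (x \<otimes> y) = ord x * ord y"
proof (rule dvd_antisym)
  show "ord (x \<otimes> y) dvd ord x * ord y" using abelian_ord_mul_divides x y .
  let ?n = "ord (x \<otimes> y)"
  have xy: "x [^] ?n \<otimes> y [^] ?n = \<one>"
    using pow_ord_eq_1[of "x \<otimes> y"] nat_pow_distrib[OF x y, of ?n] x y by (metis m_closed)
  have "x [^] (?n * ord y) = (x [^] ?n \<otimes> y [^] ?n) [^] ord y"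
    using x y by (simp add: nat_pow_distrib nat_pow_pow) (simp add: mult.commute[of ?n] nat_pow_pow[symmetric])
  then have "x [^] (?n * ord y) = \<one>" using xy by simp
  then have 1: "ord x dvd ?n" using pow_eq_id x cop coprime_dvd_mult_left_iff by blast
  have "y [^] (?n * ord x) = (x [^] ?n \<otimes> y [^] ?n) [^] ord x"
    using x y by (simp add: nat_pow_distrib nat_pow_pow) (simp add: mult.commute[of ?n] nat_pow_pow[symmetric])
  then have "y [^] (?n * ord x) = \<one>" using xy by simp
  then have "ord y dvd ?n" using pow_eq_id y cop coprime_dvd_mult_left_iff coprime_commute by blast
  then show "ord x * ord y dvd ?n" using 1 cop by (simp add: divides_mult)
qed

text \<open>Take a of maximal order. If some prime p divided \<open>ord b\<close> to a higher power
  than \<open>ord a\<close>, then the prime-to-p part of a times the p-part of b would have larger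
  order.\<close>

lemma (in comm_group) exists_exponent_element:
  assumes fin: "finite (carrier G)"
  shows "\<exists>a\<in>carrier G. \<forall>b\<in>carrier G. ord b dvd ord a"
proof -
  have "finite (ord ` carrier G)" "ord ` carrier G \<noteq> {}" using fin by auto
  then have "Max (ord ` carrier G) \<in> ord ` carrier G" by (rule Max_in)
  then obtain a where a: "a \<in> carrier G" "ord a = Max (ord ` carrier G)" by auto
  have max: "ord b \<le> ord a" if "b \<in> carrier G" for b
    unfolding a(2) using fin that by simp
  have pos: "ord b > 0" if "b \<in> carrier G" for b using ord_ge_1[OF fin that] by simp
  have "ord b dvd ord a" if b: "b \<in> carrier G" for b
  proof (rule ccontr)
    assume nd: "\<not> ord b dvd ord a"
    have b0: "ord b \<noteq> 0" using pos[OF b] by simp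
    then obtain p where p: "Factorial_Ring.prime p" "multiplicity p (ord b) > multiplicity p (ord a)"
      using multiplicity_le_imp_dvd[of "ord b" "ord a"] nd not_le by blast
    define e f where "e = multiplicity p (ord b)" and "f = multiplicity p (ord a)"
    obtain s where s: "ord a = p ^ f * s" "\<not> p dvd s"
      using multiplicity_decompose'[of "ord a" p] pos[OF a(1)] p(1) unfolding f_def
      by (metis not_prime_unit not_less0)
    obtain r where r: "ord b = p ^ e * r" using multiplicity_dvd[of p "ord b"] unfolding e_def by (auto elim: dvdE)
    have p0: "p > 0" using p(1) prime_gt_0_nat by blast
    have r0: "r \<noteq> 0" using r b0 by auto
    have oa: "ord (a [^] (p ^ f)) = s" using ord_pow[OF a(1), of "p ^ f"] s(1) p0 by simp
    have ob: "ord (b [^] r) = p ^ e" using ord_pow[OF b, of r] r r0 by simp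
    have "coprime p s" using prime_imp_coprime[OF p(1) s(2)] .
    then have "coprime s (p ^ e)" by (simp add: coprime_commute)
    then have "ord (a [^] (p ^ f) \<otimes> b [^] r) = s * p ^ e"
      using ord_mult_coprime[of "a [^] (p ^ f)" "b [^] r"] a(1) b oa ob by simp
    then have "s * p ^ e \<le> p ^ f * s" using max[of "a [^] (p ^ f) \<otimes> b [^] r"] a(1) b s(1) by simp
    moreover have "s > 0" using s(1) pos[OF a(1)] by (cases s) auto
    moreover have "p ^ f < p ^ e" using p prime_gt_1_nat by (simp add: e_def f_def)
    ultimately show False by (simp add: mult.commute)
  qed
  then show ?thesis using a(1) by blast
qed

text \<open>All values of f are roots of X^m - 1 for the exponent m, so there are at most m
  elements, and an element of order m generates.\<close>

lemma (in group) finite_cyclic_of_field_hom: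
  fixes f :: "'a \<Rightarrow> 'c::field"
  assumes fin: "finite (carrier G)"
    and mult: "\<And>x y. x \<in> carrier G \<Longrightarrow> y \<in> carrier G \<Longrightarrow> f (x \<otimes> y) = f x * f y"
    and inj: "inj_on f (carrier G)"
    and nz: "\<And>x. x \<in> carrier G \<Longrightarrow> f x \<noteq> 0"
  shows "cyclic_group G"
proof -
  have comm: "x \<otimes> y = y \<otimes> x" if "x \<in> carrier G" "y \<in> carrier G" for x y
    using inj_onD[OF inj, of "x \<otimes> y" "y \<otimes> x"] mult that by (simp add: mult.commute)
  interpret comm_group G by (rule group_comm_groupI) (rule comm)
  have one: "f \<one> = 1" using mult[of \<one> \<one>] nz[of \<one>] by simp
  have pow: "f (x [^] (n::nat)) = f x ^ n" if "x \<in> carrier G" for x n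
    using that by (induction n) (simp_all add: one mult)
  obtain a where a: "a \<in> carrier G" "\<And>b. b \<in> carrier G \<Longrightarrow> ord b dvd ord a"
    using exists_exponent_element[OF fin] by blast
  let ?m = "ord a" and ?p = "monom 1 (ord a) - 1 :: 'c poly"
  have m: "?m > 0" using ord_ge_1[OF fin a(1)] by simp
  have root: "poly ?p (f x) = 0" if x: "x \<in> carrier G" for x
  proof -
    have "x [^] ?m = \<one>" using pow_eq_id[OF x] a(2)[OF x] by simp
    then show ?thesis using pow[OF x, of ?m] one by (simp add: poly_monom)
  qed
  have "poly ?p 0 \<noteq> 0" using m by (simp add: poly_monom zero_power)
  then have p0: "?p \<noteq> 0" by auto
  have deg: "degree ?p \<le> ?m" by (intro degree_diff_le) (simp_all add: degree_monom_le)
  have "card (carrier G) = card (f ` carrier G)" using card_image[OF inj] by simp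
  also have "\<dots> \<le> card {z. poly ?p z = 0}"
    by (intro card_mono[OF poly_roots_finite[OF p0]]) (use root in blast)
  also have "\<dots> \<le> ?m" using card_poly_roots_bound[OF p0] deg by simp
  finally have "card (carrier G) \<le> card (generate G {a})" using generate_pow_card[OF a(1)] by simp
  then have "generate G {a} = carrier G"
    using card_seteq[OF fin, of "generate G {a}"] generate_incl[of "{a}"] a(1) by simp
  then have "carrier G = range (\<lambda>n::int. a [^] n)" using generate_pow[OF a(1)] by (simp add: full_SetCompr_eq)
  then show ?thesis using cyclic_group a(1) by blast
qed

text \<open>The image of e is generated by its least positive value, attained at some u. The powers
  of u split the extension, so exponents of k, modulo its order, and of u are coordinates.\<close>

lemma (in comm_group) cyclic_times_integers:
  fixes e :: "'a \<Rightarrow> int"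
  assumes hom: "\<And>x y. x \<in> carrier G \<Longrightarrow> y \<in> carrier G \<Longrightarrow> e (x \<otimes> y) = e x + e y"
    and fin: "finite {x \<in> carrier G. e x = 0}"
    and k: "k \<in> carrier G" and ker: "{x \<in> carrier G. e x = 0} = range (\<lambda>i::int. k [^] i)"
    and h: "h \<in> carrier G" "e h \<noteq> 0"
  shows "\<exists>n>0. G \<cong> integer_mod_group n \<times>\<times> integer_group"
proof -
  have e1: "e \<one> = 0" using hom[of \<one> \<one>] by simp
  have einv: "e (inv x) = - e x" if "x \<in> carrier G" for x
    using hom[of x "inv x"] that e1 by simp
  have enat: "e (x [^] (n::nat)) = int n * e x" if "x \<in> carrier G" for x n
    using that by (induction n) (simp_all add: e1 hom algebra_simps)
  have epow: "e (x [^] (i::int)) = i * e x" if x: "x \<in> carrier G" for x i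
  proof (cases i rule: int_cases2)
    case (nonneg n)
    then show ?thesis using enat[OF x] by (simp add: int_pow_int)
  next
    case (nonpos n)
    then show ?thesis using enat[OF x] einv x by (simp add: int_pow_neg int_pow_int)
  qed
  define Q where "Q = (\<lambda>j::nat. j > 0 \<and> (\<exists>x\<in>carrier G. e x = int j))"
  have "\<exists>j. Q j"
  proof (cases "e h > 0")
    case True
    then have "Q (nat (e h))" using h(1) unfolding Q_def by auto
    then show ?thesis ..
  next
    case False
    then have "Q (nat (e (inv h)))" using h einv[OF h(1)] unfolding Q_def by (auto intro!: bexI[of _ "inv h"])
    then show ?thesis ..
  qed
  define m where "m = (LEAST j. Q j)"
  have "Q m" unfolding m_def using \<open>\<exists>j. Q j\<close> by (rule LeastI_ex)
  then obtain u where m: "m > 0" and u: "u \<in> carrier G" "e u = int m" unfolding Q_def by blast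
  have least: "\<not> Q j" if "j < m" for j using not_less_Least that unfolding m_def by blast
  have dvd: "int m dvd e x" if x: "x \<in> carrier G" for x
  proof -
    define y where "y = x \<otimes> u [^] (- (e x div int m))"
    have y: "y \<in> carrier G" using x u by (simp add: y_def)
    have "e y = e x - (e x div int m) * int m" using x u epow by (simp add: y_def hom)
    then have ey: "e y = e x mod int m" by (simp add: minus_div_mult_eq_mod)
    have "\<not> Q (nat (e y))" using least[of "nat (e y)"] m ey by (simp add: nat_less_iff)
    then have "\<not> e y > 0" using y unfolding Q_def by auto
    then show ?thesis using ey m by (metis dvd_eq_mod_eq_0 of_nat_0_less_iff order_le_imp_less_or_eq pos_mod_sign)
  qed
  define n where "n = ord k"
  have gk: "generate G {k} = {x \<in> carrier G. e x = 0}" using generate_pow[OF k] ker by (simp add: full_SetCompr_eq)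
  \<comment> \<open>Elements of infinite order have \<open>ord\<close> zero; finiteness of the
    kernel rules this out.\<close>
  have "card (generate G {k}) > 0" unfolding gk using fin e1 by (auto simp: card_gt_0_iff)
  then have n: "n > 0" using generate_pow_card[OF k] by (simp add: n_def)
  have ek: "e (k [^] (i::int)) = 0" for i using ker by auto
  let ?Z = "integer_mod_group n \<times>\<times> integer_group"
  define \<phi> where "\<phi> = (\<lambda>(i::int, j::int). k [^] i \<otimes> u [^] j)"
  have e\<phi>: "e (\<phi> (i, j)) = j * int m" for i j using k u ek epow by (simp add: \<phi>_def hom)
  have kmod: "k [^] (i mod int n) = k [^] i" for i :: int
    using int_pow_eq[OF k, of "i mod int n" i] by (simp add: n_def minus_mod_eq_mult_div)
  have "\<phi> \<in> iso (?Z) G"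
    unfolding iso_def
  proof (intro CollectI conjI homI)
    fix x assume "x \<in> carrier ?Z"
    then show "\<phi> x \<in> carrier G" using k u by (cases x) (simp add: \<phi>_def)
  next
    fix x y assume "x \<in> carrier ?Z" "y \<in> carrier ?Z"
    obtain i j i' j' where xy: "x = (i, j)" "y = (i', j')" by (cases x; cases y)
    have "\<phi> (x \<otimes>\<^bsub>?Z\<^esub> y) = k [^] (i + i') \<otimes> u [^] (j + j')"
      by (simp add: xy \<phi>_def kmod)
    also have "\<dots> = (k [^] i \<otimes> k [^] i') \<otimes> (u [^] j \<otimes> u [^] j')" using k u by (simp add: int_pow_mult)
    also have "\<dots> = \<phi> x \<otimes> \<phi> y" using k u by (simp add: xy \<phi>_def m_ac)
    finally show "\<phi> (x \<otimes>\<^bsub>?Z\<^esub> y) = \<phi> x \<otimes> \<phi> y" .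
  next
    show "bij_betw \<phi> (carrier ?Z) (carrier G)"
      unfolding bij_betw_def
    proof (intro conjI inj_onI equalityI subsetI)
      fix x y assume x: "x \<in> carrier ?Z"
        and y: "y \<in> carrier ?Z" and eq: "\<phi> x = \<phi> y"
      obtain i j i' j' where xy: "x = (i, j)" "y = (i', j')" by (cases x; cases y)
      have ii: "0 \<le> i" "i < int n" "0 \<le> i'" "i' < int n"
        using x y n by (simp_all add: xy carrier_integer_mod_group)
      have "j * int m = j' * int m" using e\<phi>[of i j] e\<phi>[of i' j'] eq xy by metis
      then have j: "j = j'" using m by simp
      then have "k [^] i = k [^] i'" using eq k u by (simp add: xy \<phi>_def)
      then have "int n dvd i' - i" using int_pow_eq[OF k] by (simp add: n_def)
      then have "i = i'" using ii by (metis mod_eq_dvd_iff mod_pos_pos_trivial)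
      then show "x = y" using j xy by simp
    next
      fix x assume "x \<in> \<phi> ` carrier ?Z"
      then show "x \<in> carrier G" using k u by (auto simp: \<phi>_def)
    next
      fix x assume x: "x \<in> carrier G"
      obtain q where q: "e x = int m * q" using dvd[OF x] by (auto elim: dvdE)
      have "e (x \<otimes> u [^] (- q)) = 0" using x u epow q by (simp add: hom mult.commute)
      moreover have c: "x \<otimes> u [^] (- q) \<in> carrier G" using x u by simp
      ultimately obtain l :: int where "x \<otimes> u [^] (- q) = k [^] l" using ker by blast
      then have l: "x \<otimes> u [^] (- q) = k [^] (l mod int n)" using kmod by simp
      have "\<phi> (l mod int n, q) = x \<otimes> (u [^] (- q) \<otimes> u [^] q)" using l[symmetric] x u by (simp add: \<phi>_def m_assoc)
      also have "u [^] (- q) \<otimes> u [^] q = u [^] (- q + q)" by (rule int_pow_mult[OF u(1), symmetric])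
      finally have "x = \<phi> (l mod int n, q)" using x by simp
      moreover have "(l mod int n, q) \<in> carrier ?Z"
        using n by (simp add: carrier_integer_mod_group)
      ultimately show "x \<in> \<phi> ` carrier ?Z" by blast
    qed
  qed
  then have "integer_mod_group n \<times>\<times> integer_group \<cong> G" unfolding is_iso_def by blast
  then have "G \<cong> integer_mod_group n \<times>\<times> integer_group"
    using group.iso_sym[OF DirProd_group[OF group_integer_mod_group group_integer_group]] by blast
  then show ?thesis using n by blast
qed

subsection \<open>Discrete subgroups of a torus\<close>

context local_field
begin

text \<open>The larger root is the fixed point of the map taking x to
  \<open>\<tau> - inverse x\<close>, which contracts distances between elements of absolute value
  \<open>v \<tau>\<close>; completeness provides the limit of its iteration.\<close>

lemma split_quadratic:
  assumes \<tau>: "1 < v \<tau>"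
  shows "\<exists>x. x\<^sup>2 - \<tau> * x + 1 = 0"
proof -
  define s where "s = rec_nat \<tau> (\<lambda>_ x. \<tau> - inverse x)"
  have s0: "s 0 = \<tau>" and sS: "s (Suc n) = \<tau> - inverse (s n)" for n by (simp_all add: s_def)
  have vs: "v (s n) = v \<tau>" for n
  proof (induction n)
    case (Suc n)
    have "v (- inverse (s n)) < v \<tau>" using Suc \<tau> by (simp add: inverse_eq_divide) (smt (verit) divide_less_eq_1_pos)
    then show ?case using v_add_eq[of "- inverse (s n)" \<tau>] by (simp add: sS)
  qed (simp add: s0)
  have nz: "s n \<noteq> 0" for n using vs[of n] \<tau> by auto
  define r where "r = inverse (v \<tau>)"
  have r: "0 < r" "r < 1" using \<tau> by (simp_all add: r_def inverse_less_1_iff)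
  have step: "v (s (Suc n) - s n) \<le> r ^ n" for n
  proof (induction n)
    case 0
    have "v (s (Suc 0) - s 0) = r" by (simp add: sS s0 r_def)
    then show ?case using r by simp
  next
    case (Suc n)
    have "s (Suc (Suc n)) - s (Suc n) = (s (Suc n) - s n) * (inverse (s n) * inverse (s (Suc n)))"
      using nz[of n] nz[of "Suc n"] by (simp add: sS[of "Suc n"] sS[of n] field_simps)
    then have "v (s (Suc (Suc n)) - s (Suc n)) = v (s (Suc n) - s n) * (r * r)" by (simp add: vs r_def)
    also have "\<dots> \<le> r ^ n * (r * 1)" using Suc r by (intro mult_mono) auto
    finally show ?case by (simp add: mult.commute)
  qed
  have far: "v (s (n + k) - s n) \<le> r ^ n" for n k
  proof (induction k)
    case (Suc k)
    have "v (s (n + Suc k) - s (n + k)) \<le> r ^ (n + k)" using step[of "n + k"] by simp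
    also have "\<dots> \<le> r ^ n" using r by (intro power_decreasing) auto
    finally show ?case using Suc v_triangle[of "s (n + Suc k)" "s n" "s (n + k)"] by simp
  qed (use r in simp)
  have "\<exists>L. \<forall>e>0. \<exists>N. \<forall>n\<ge>N. v (s n - L) < e"
  proof (rule complete)
    fix e :: real assume "e > 0"
    then obtain N where N: "r ^ N < e" using real_arch_pow_inv[of e r] r by auto
    have "v (s m - s n) < e" if "m \<ge> N" "n \<ge> N" for m n
    proof -
      have "v (s m - s N) \<le> r ^ N" "v (s n - s N) \<le> r ^ N"
        using far[of N "m - N"] far[of N "n - N"] that by simp_all
      then show ?thesis using v_triangle[of "s m" "s n" "s N"] v_diff_comm[of "s N" "s n"] N by linarith
    qed
    then show "\<exists>N. \<forall>m\<ge>N. \<forall>n\<ge>N. v (s m - s n) < e" by blast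
  qed
  then obtain L where L: "\<And>e. e > 0 \<Longrightarrow> \<exists>N. \<forall>n\<ge>N. v (s n - L) < e" by blast
  have "v (L\<^sup>2 - \<tau> * L + 1) \<le> 0"
  proof (rule field_le_epsilon)
    fix e :: real assume e: "e > 0"
    define M where "M = max (v L) (v \<tau>)"
    have M: "M > 0" using \<tau> by (simp add: M_def)
    obtain N where N: "\<And>n. n \<ge> N \<Longrightarrow> v (s n - L) < e / M" using L[of "e / M"] e M by auto
    have a: "v (L - s N) < e / M" "v (L - s (Suc N)) < e / M"
      using N[of N] N[of "Suc N"] v_diff_comm by simp_all
    \<comment> \<open>The recursion cleared of its denominator; it bounds the polynomial at L by the
      distances from L to two consecutive terms.\<close>
    have "s (Suc N) * s N = \<tau> * s N - 1" using nz[of N] by (simp add: sS left_diff_distrib)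
    then have "L\<^sup>2 - \<tau> * L + 1 = (L * (L - s (Suc N)) + s (Suc N) * (L - s N)) - \<tau> * (L - s N)"
      by (simp add: power2_eq_square algebra_simps)
    then have "v (L\<^sup>2 - \<tau> * L + 1) \<le> max (max (v L * v (L - s (Suc N))) (v \<tau> * v (L - s N))) (v \<tau> * v (L - s N))"
      using v_diff[of "L * (L - s (Suc N)) + s (Suc N) * (L - s N)" "\<tau> * (L - s N)"]
        v_add[of "L * (L - s (Suc N))" "s (Suc N) * (L - s N)"] by (simp add: vs)
    also have "\<dots> \<le> M * (e / M)"
    proof -
      have "v L * v (L - s (Suc N)) \<le> M * (e / M)" "v \<tau> * v (L - s N) \<le> M * (e / M)"
        using a M by (intro mult_mono; simp add: M_def less_imp_le)+
      then show ?thesis by simp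
    qed
    also have "\<dots> = 0 + e" using M by simp
    finally show "v (L\<^sup>2 - \<tau> * L + 1) \<le> 0 + e" .
  qed
  then have "v (L\<^sup>2 - \<tau> * L + 1) = 0" using v_nonneg[of "L\<^sup>2 - \<tau> * L + 1"] by linarith
  then show ?thesis by (auto simp del: v_nonneg)
qed

end

text \<open>The roots of X^2 - t X + 1 are l and t - l; if they coincide, the discriminant t^2 - 4
  vanishes.\<close>

lemma double_eigenvalue:
  fixes l t :: "'b::field_char_0"
  assumes l: "l * l = t * l - 1" and t: "t = 2 * l"
  shows "t * t = 4"
proof -
  have "l * l + 1 = t * l" unfolding l by simp
  also have "t * l = l * l + l * l" unfolding t by (simp add: algebra_simps)
  finally have "l * l = 1" by (simp only: add_left_cancel)
  then show ?thesis unfolding t by simp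
qed

locale torus_subgroup = discrete_PSL2 v G for v :: "'a::field_char_0 \<Rightarrow> real" and G +
  fixes H :: "'a m2 set set" and C :: "'a m2"
  assumes H_sub: "subgroup H PSL2" and H_G: "H \<subseteq> G" and C_H: "psl2_class C \<in> H"
    and det_C: "m2_det C = 1" and tr_C: "m2_tr C \<noteq> 0" "(m2_tr C)\<^sup>2 \<noteq> 4"
    and H_comm: "h \<in> H \<Longrightarrow> psl2_class C \<star> h = h \<star> psl2_class C"
begin

sublocale H: subgroup H PSL2
  by (rule H_sub)

abbreviation t :: 'a where "t \<equiv> m2_tr C"

text \<open>Coordinates of a lift in the basis I, C of the algebra generated by C. They are
  determined up to a common sign.\<close>

definition coords :: "'a m2 set \<Rightarrow> 'a \<times> 'a" where
  "coords h = (SOME p. h = psl2_class (m2_lin (fst p) (snd p) C) \<and> m2_det (m2_lin (fst p) (snd p) C) = 1)"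

definition cx :: "'a m2 set \<Rightarrow> 'a" where "cx h = fst (coords h)"
definition cy :: "'a m2 set \<Rightarrow> 'a" where "cy h = snd (coords h)"

lemma coords:
  assumes h: "h \<in> H"
  shows "h = psl2_class (m2_lin (cx h) (cy h) C)" "m2_det (m2_lin (cx h) (cy h) C) = 1"
proof -
  obtain B where B: "m2_det B = 1" "h = psl2_class B" using G_lift[of h] H_G h by blast
  have "m2_mult C B = m2_mult B C"
    using commute_lift[OF det_C tr_C(1) B(1)] H_comm[OF h] B(2) by simp
  then obtain x y where "B = m2_lin x y C" using m2_commute_lin[OF det_C tr_C(2)] by blast
  then have "h = psl2_class (m2_lin (fst (x, y)) (snd (x, y)) C) \<and> m2_det (m2_lin (fst (x, y)) (snd (x, y)) C) = 1"
    using B by simp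
  then have "h = psl2_class (m2_lin (cx h) (cy h) C) \<and> m2_det (m2_lin (cx h) (cy h) C) = 1"
    unfolding cx_def cy_def coords_def by (rule someI)
  then show "h = psl2_class (m2_lin (cx h) (cy h) C)" "m2_det (m2_lin (cx h) (cy h) C) = 1" by auto
qed

lemma coords_norm: "h \<in> H \<Longrightarrow> (cx h)\<^sup>2 + cx h * cy h * t + (cy h)\<^sup>2 = 1"
  using coords(2)[of h] by (simp add: m2_det_lin det_C)

lemma coords_unique:
  assumes h: "h \<in> H" and e: "h = psl2_class (m2_lin x y C)"
  shows "(cx h = x \<and> cy h = y) \<or> (cx h = - x \<and> cy h = - y)"
proof -
  have "psl2_class (m2_lin x y C) = psl2_class (m2_lin (cx h) (cy h) C)" using coords(1)[OF h] e by simp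
  then have "m2_lin (cx h) (cy h) C = m2_lin x y C \<or> m2_lin (cx h) (cy h) C = m2_lin (- x) (- y) C"
    by (simp only: psl2_class_eq m2_neg_lin)
  then show ?thesis using m2_lin_inj[OF det_C tr_C(2)] by blast
qed

text \<open>The sign s compares the chosen lift of the product with the product of the chosen lifts;
  the formulas are multiplication modulo C^2 = t C - I.\<close>

lemma coords_mult:
  assumes g: "g \<in> H" and h: "h \<in> H"
  shows "\<exists>s. s\<^sup>2 = 1 \<and> cx (g \<star> h) = s * (cx g * cx h - cy g * cy h)
    \<and> cy (g \<star> h) = s * (cx g * cy h + cy g * cx h + cy g * cy h * t)"
proof -
  define x y where "x = cx g * cx h - cy g * cy h" and "y = cx g * cy h + cy g * cx h + cy g * cy h * t"
  have "g \<star> h = psl2_class (m2_lin (cx g) (cy g) C) \<star> psl2_class (m2_lin (cx h) (cy h) C)"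
    using coords(1)[OF g] coords(1)[OF h] by simp
  also have "\<dots> = psl2_class (m2_lin x y C)" by (simp add: m2_lin_mult det_C x_def y_def)
  finally have "(cx (g \<star> h) = x \<and> cy (g \<star> h) = y) \<or> (cx (g \<star> h) = - x \<and> cy (g \<star> h) = - y)"
    by (rule coords_unique[OF H.m_closed[OF g h]])
  then have "\<exists>s. s\<^sup>2 = 1 \<and> cx (g \<star> h) = s * x \<and> cy (g \<star> h) = s * y"
  proof
    assume "cx (g \<star> h) = x \<and> cy (g \<star> h) = y"
    then show ?thesis by (intro exI[of _ 1]) simp
  next
    assume "cx (g \<star> h) = - x \<and> cy (g \<star> h) = - y"
    then show ?thesis by (intro exI[of _ "- 1"]) simp
  qed
  then show ?thesis unfolding x_def y_def .
qed

lemma coords_one: "(cx \<one>\<^bsub>PSL2\<^esub>)\<^sup>2 = 1 \<and> cy \<one>\<^bsub>PSL2\<^esub> = 0"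
  using coords_unique[OF H.one_closed, of 1 0] by (auto simp: psl2_one m2_lin_scalar)

lemma H_abelian:
  assumes "g \<in> H" "h \<in> H"
  shows "g \<star> h = h \<star> g"
  using coords(1)[OF assms(1)] coords(1)[OF assms(2)] m2_lin_commute psl2_mult by metis

lemma comm_group_sub:
  assumes "subgroup K PSL2" "K \<subseteq> H"
  shows "comm_group (psl2_on K)"
proof -
  interpret K: group "psl2_on K" using PSL2.subgroup_imp_group[OF assms(1)] .
  show ?thesis by (rule K.group_comm_groupI) (use H_abelian assms(2) in auto)
qed

text \<open>An eigenvalue of $C$ over the algebraic closure gives a character of the torus; squaring
  removes the sign ambiguity of the lifts.\<close>

lemma finite_cyclic:
  assumes K: "subgroup K PSL2" "K \<subseteq> H" "finite K"
  shows "cyclic_group (psl2_on K)"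
proof -
  define t' where "t' = to_ac t"
  have "degree [:1, - t', 1:] > 0" by simp
  then obtain l where "poly [:1, - t', 1:] l = 0" using alg_closed_imp_poly_has_root by blast
  then have l: "l * l = t' * l - 1" by (simp add: algebra_simps)
  \<comment> \<open>As l is an eigenvalue of C, this is the corresponding eigenvalue of the chosen
    lift of h.\<close>
  define u where "u = (\<lambda>h. to_ac (cx h) + to_ac (cy h) * l)"
  define f where "f = (\<lambda>h. (u h)\<^sup>2)"
  have mult: "f (g \<star> h) = f g * f h" if gh: "g \<in> H" "h \<in> H" for g h
  proof -
    obtain s where s: "s\<^sup>2 = 1" "cx (g \<star> h) = s * (cx g * cx h - cy g * cy h)"
      "cy (g \<star> h) = s * (cx g * cy h + cy g * cx h + cy g * cy h * t)"
      using coords_mult[OF gh] by blast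
    have ugh: "u g * u h = to_ac (cx g) * to_ac (cx h) + (to_ac (cx g) * to_ac (cy h) + to_ac (cy g) * to_ac (cx h)) * l
        + to_ac (cy g) * to_ac (cy h) * (l * l)"
      by (simp add: u_def algebra_simps)
    have "u (g \<star> h) = to_ac s * (u g * u h)"
      unfolding ugh l by (simp add: u_def s(2,3) t'_def algebra_simps)
    moreover have "(to_ac s)\<^sup>2 = 1" using s(1) to_ac_power[of s 2] by simp
    ultimately show ?thesis by (simp add: f_def power_mult_distrib)
  qed
  have one: "f \<one>\<^bsub>PSL2\<^esub> = 1" using coords_one to_ac_power[of "cx \<one>\<^bsub>PSL2\<^esub>" 2] by (simp add: f_def u_def)
  have ker: "h = \<one>\<^bsub>PSL2\<^esub>" if h: "h \<in> H" "f h = 1" for h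
  proof -
    define x y where "x = to_ac (cx h)" and "y = to_ac (cy h)"
    have "to_ac ((cx h)\<^sup>2 + cx h * cy h * t + (cy h)\<^sup>2) = to_ac 1" using coords_norm[OF h(1)] by simp
    then have n: "x * x + x * y * t' + y * y = 1" by (simp add: x_def y_def t'_def power2_eq_square)
    have uu: "u h * u h = 1" using h(2) by (simp add: f_def power2_eq_square)
    \<comment> \<open>The second factor is the other eigenvalue, the inverse of \<open>u h\<close>.
      If \<open>u h\<close> squares to one, both agree, and since l differs from t' - l this forces
      y = 0.\<close>
    have "u h * (x + y * (t' - l)) = x * x + x * y * t' + y * y * (t' * l - l * l)"
      by (simp add: u_def x_def[symmetric] y_def[symmetric] algebra_simps)
    also have "\<dots> = 1" using n by (simp add: l)
    finally have "u h * (x + y * (t' - l)) = u h * u h" using uu by simp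
    moreover have "u h \<noteq> 0" using uu by auto
    ultimately have "x + y * (t' - l) = x + y * l" by (simp add: u_def x_def y_def)
    then have "y * (t' - 2 * l) = 0" by (simp add: algebra_simps)
    moreover have "t' - 2 * l \<noteq> 0"
    proof
      assume "t' - 2 * l = 0"
      then have "t' = 2 * l" by simp
      then have "t' * t' = 4" using double_eigenvalue l by blast
      then have "to_ac (t\<^sup>2) = to_ac 4" by (simp add: t'_def power2_eq_square)
      then show False using tr_C(2) by (simp only: to_ac_eq_iff)
    qed
    ultimately have y: "cy h = 0" by (simp add: y_def)
    then have "cx h = 1 \<or> cx h = - 1" using coords_norm[OF h(1)] by (simp add: power2_eq_1_iff)
    moreover have "m2_lin (- 1) 0 C = m2_neg (m2_lin 1 0 C)" by (simp add: m2_neg_lin)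
    ultimately have "psl2_class (m2_lin (cx h) (cy h) C) = psl2_class m2_one"
      using y m2_lin_scalar by (metis psl2_class_neg)
    then show ?thesis using coords(1)[OF h(1)] by (simp add: psl2_one)
  qed
  have inv1: "f h * f (inv\<^bsub>PSL2\<^esub> h) = 1" if h: "h \<in> H" for h
    using mult[OF h H.m_inv_closed[OF h]] one PSL2.r_inv H.mem_carrier[OF h] by simp
  interpret K: group "psl2_on K" using PSL2.subgroup_imp_group[OF K(1)] .
  show ?thesis
  proof (rule K.finite_cyclic_of_field_hom[of f])
    show "inj_on f (carrier (psl2_on K))"
    proof (rule inj_onI)
      fix g h assume gh: "g \<in> carrier (psl2_on K)" "h \<in> carrier (psl2_on K)" "f g = f h"
      then have gH: "g \<in> H" "h \<in> H" using K(2) by auto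
      have "f (g \<star> inv\<^bsub>PSL2\<^esub> h) = 1"
        using mult[OF gH(1) H.m_inv_closed[OF gH(2)]] inv1[OF gH(2)] gh(3) by simp
      then have "g \<star> inv\<^bsub>PSL2\<^esub> h = \<one>\<^bsub>PSL2\<^esub>"
        using ker[OF H.m_closed[OF gH(1) H.m_inv_closed[OF gH(2)]]] by blast
      then show "g = h"
        using gH H.mem_carrier PSL2.inv_closed PSL2.inv_equality PSL2.inv_inv by metis
    qed
  next
    fix h assume "h \<in> carrier (psl2_on K)"
    then have "h \<in> H" using K(2) by auto
    then show "f h \<noteq> 0" using inv1[of h] by auto
  qed (use K mult in auto)
qed

lemma bounded_coords_finite:
  assumes T: "T \<subseteq> H" and x: "\<And>h. h \<in> T \<Longrightarrow> v (cx h) \<le> R" and y: "\<And>h. h \<in> T \<Longrightarrow> v (cy h) \<le> R"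
  shows "finite T"
proof (rule bounded_finite)
  obtain a b c d where C: "C = (a, b, c, d)" by (cases C)
  define N where "N = max 1 (m2_norm C)"
  have n: "v a \<le> N" "v b \<le> N" "v c \<le> N" "v d \<le> N" by (auto simp: N_def C m2_norm_def)
  fix h assume h: "h \<in> T"
  have hH: "h \<in> H" using h T by blast
  have R: "0 \<le> R" using x[OF h] v_nonneg[of "cx h"] by linarith
  have 1: "v (cy h * z) \<le> R * N" if "v z \<le> N" for z
    using that y[OF h] R by (auto intro!: mult_mono)
  have "R * 1 \<le> R * N" using R by (intro mult_left_mono) (auto simp: N_def)
  then have 2: "v (cx h + cy h * z) \<le> R * N" if "v z \<le> N" for z
    using 1[OF that] v_add[of "cx h" "cy h * z"] x[OF h] by linarith
  have entries: "m2_lin x y C = (x + y * a, y * b, y * c, x + y * d)" for x y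
    by (simp add: C m2_lin_def)
  have "m2_norm (m2_lin (cx h) (cy h) C) \<le> R * N"
    unfolding entries m2_norm_entries by (intro conjI 1 2 n)
  then show "\<exists>A. m2_det A = 1 \<and> h = psl2_class A \<and> m2_norm A \<le> R * N"
    using coords[OF hH] by blast
qed (use T H_G in blast)

text \<open>The traces of h and of h C^-1 are linear forms in the coordinates of h, with determinant
  4 - t^2 up to sign. Bounded traces thus bound the coordinates, and discreteness makes H
  finite.\<close>

lemma elliptic_finite:
  assumes tr: "\<And>h. h \<in> H \<Longrightarrow> v (2 * cx h + cy h * t) \<le> 1"
  shows "finite H"
proof -
  have d: "4 - t\<^sup>2 \<noteq> 0" using tr_C(2) by simp
  define R where "R = 1 / v (4 - t\<^sup>2)"
  have vd: "v (4 - t\<^sup>2) > 0" using v_pos[OF d] .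
  have "cx (psl2_class C) = 0 \<and> cy (psl2_class C) = 1 \<or> cx (psl2_class C) = 0 \<and> cy (psl2_class C) = - 1"
    using coords_unique[OF C_H, of 0 1] by (simp add: m2_lin_self)
  then have vt: "v t \<le> 1" using tr[OF C_H] by auto
  have v2: "v 2 \<le> 1" by (rule v_numeral)
  have ic: "inv\<^bsub>PSL2\<^esub> psl2_class C \<in> H" using C_H by blast
  have icl: "inv\<^bsub>PSL2\<^esub> psl2_class C = psl2_class (m2_lin t (- 1) C)"
  proof -
    have "m2_adj C = m2_lin t (- 1) C" by (cases C) (simp add: m2_simps)
    then show ?thesis using psl2_inv[OF det_C] by simp
  qed
  have main: "v (cx h) \<le> R \<and> v (cy h) \<le> R" if h: "h \<in> H" for h
  proof -
    let ?x = "cx h" and ?y = "cy h"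
    have p: "v (2 * ?x + ?y * t) \<le> 1" using tr[OF h] .
    have hi: "h \<star> inv\<^bsub>PSL2\<^esub> psl2_class C \<in> H" using h ic by blast
    have "h \<star> inv\<^bsub>PSL2\<^esub> psl2_class C = psl2_class (m2_lin ?x ?y C) \<star> psl2_class (m2_lin t (- 1) C)"
      using coords(1)[OF h] icl by simp
    also have "\<dots> = psl2_class (m2_lin (?x * t + ?y) (- ?x) C)"
      by (simp add: m2_lin_mult det_C)
    finally have e: "h \<star> inv\<^bsub>PSL2\<^esub> psl2_class C = psl2_class (m2_lin (?x * t + ?y) (- ?x) C)" .
    define z where "z = ?x * t + 2 * ?y"
    have "2 * cx (h \<star> inv\<^bsub>PSL2\<^esub> psl2_class C) + cy (h \<star> inv\<^bsub>PSL2\<^esub> psl2_class C) * t \<in> {z, - z}"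
    proof (rule disjE[OF coords_unique[OF hi e]]; elim conjE)
      let ?c = "h \<star> inv\<^bsub>PSL2\<^esub> psl2_class C"
      assume c: "cx ?c = ?x * t + ?y" "cy ?c = - ?x"
      have "2 * cx ?c + cy ?c * t = z" unfolding c by (simp add: z_def algebra_simps)
      then show ?thesis by simp
    next
      let ?c = "h \<star> inv\<^bsub>PSL2\<^esub> psl2_class C"
      assume c: "cx ?c = - (?x * t + ?y)" "cy ?c = - (- ?x)"
      have "2 * cx ?c + cy ?c * t = - z" unfolding c by (simp add: z_def algebra_simps)
      then show ?thesis by simp
    qed
    then have q: "v z \<le> 1" using tr[OF hi] v_minus[of z] by auto
    define w where "w = 2 * ?x + ?y * t"
    have w: "v w \<le> 1" using p by (simp add: w_def)
    have small: "v (2 * a - t * b) \<le> 1" if "v a \<le> 1" "v b \<le> 1" for a b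
    proof -
      have "v 2 * v a \<le> 1 * 1" "v t * v b \<le> 1 * 1" using that v2 vt by (intro mult_mono; simp)+
      then show ?thesis using v_diff[of "2 * a" "t * b"] by simp
    qed
    have "(4 - t\<^sup>2) * ?x = 2 * w - t * z" "(4 - t\<^sup>2) * ?y = 2 * z - t * w"
      by (simp_all add: z_def w_def power2_eq_square algebra_simps)
    then have "v (4 - t\<^sup>2) * v ?x \<le> 1" "v (4 - t\<^sup>2) * v ?y \<le> 1"
      using small[OF w q] small[OF q w] by (metis v_mult)+
    then show ?thesis using vd by (simp add: R_def pos_le_divide_eq mult.commute)
  qed
  show ?thesis using bounded_coords_finite[of H R] main by blast
qed

text \<open>A trace of absolute value above one puts the eigenvalues of h0, and with them those of
  C, into K. The valuation of an eigenvalue is a homomorphism to the integers; its kernel has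
  bounded coordinates, so it is finite and cyclic.\<close>

lemma split_structure:
  assumes h0: "h0 \<in> H" "1 < v (2 * cx h0 + cy h0 * t)"
  shows "\<exists>n>0. psl2_on H \<cong> integer_mod_group n \<times>\<times> integer_group"
proof -
  define \<tau> where "\<tau> = 2 * cx h0 + cy h0 * t"
  obtain \<mu> where \<mu>: "\<mu>\<^sup>2 - \<tau> * \<mu> + 1 = 0" using split_quadratic[of \<tau>] h0(2) by (auto simp: \<tau>_def)
  \<comment> \<open>Otherwise h0 is trivial and its trace is 2 or -2, of absolute value at most
    one.\<close>
  have y0: "cy h0 \<noteq> 0"
  proof
    assume y: "cy h0 = 0"
    then have "(cx h0)\<^sup>2 = 1" using coords_norm[OF h0(1)] by simp
    then have "v (cx h0) ^ 2 = 1" by (metis v_power v_1)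
    then have "v (cx h0) = 1" using v_nonneg[of "cx h0"] by (simp add: power2_eq_1_iff) 
    then have "v (2 * cx h0) \<le> 1" using v_numeral by simp
    then show False using h0(2) y by simp
  qed
  \<comment> \<open>Solved from the requirement that h0 has eigenvalue \<mu> when C has eigenvalue
    l.\<close>
  define l where "l = (\<mu> - cx h0) / cy h0"
  have m: "\<mu> = cx h0 + cy h0 * l" using y0 by (simp add: l_def)
  have l: "l * l = t * l - 1"
  proof -
    have "(cy h0)\<^sup>2 * (l * l - t * l + 1) = (\<mu>\<^sup>2 - \<tau> * \<mu> + 1) + ((cx h0)\<^sup>2 + cx h0 * cy h0 * t + (cy h0)\<^sup>2 - 1)"
      by (simp add: m \<tau>_def power2_eq_square algebra_simps)
    also have "\<dots> = 0" using \<mu> coords_norm[OF h0(1)] by simp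
    finally have "l * l - t * l + 1 = 0" using y0 by simp
    then show ?thesis by (simp add: algebra_simps eq_diff_eq add_eq_0_iff)
  qed
  define u where "u = (\<lambda>h. cx h + cy h * l)"
  have unorm: "u h * (cx h + cy h * (t - l)) = 1" if h: "h \<in> H" for h
  proof -
    have "u h * (cx h + cy h * (t - l)) = (cx h)\<^sup>2 + cx h * cy h * t + (cy h)\<^sup>2 * (t * l - l * l)"
      by (simp add: u_def power2_eq_square algebra_simps)
    then show ?thesis using coords_norm[OF h] by (simp add: l)
  qed
  have vmult: "v (u (g \<star> h)) = v (u g) * v (u h)" if gh: "g \<in> H" "h \<in> H" for g h
  proof -
    obtain s where s: "s\<^sup>2 = 1" "cx (g \<star> h) = s * (cx g * cx h - cy g * cy h)"
      "cy (g \<star> h) = s * (cx g * cy h + cy g * cx h + cy g * cy h * t)"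
      using coords_mult[OF gh] by blast
    have ugh: "u g * u h = cx g * cx h + (cx g * cy h + cy g * cx h) * l + cy g * cy h * (l * l)"
      by (simp add: u_def algebra_simps)
    have "u (g \<star> h) = s * (u g * u h)"
      unfolding ugh l by (simp add: u_def s(2,3) algebra_simps)
    moreover have "v s = 1" using s(1) by (auto simp: power2_eq_1_iff)
    ultimately show ?thesis by simp
  qed
  have unz: "u h \<noteq> 0" if "h \<in> H" for h using unorm[OF that] by auto
  \<comment> \<open>In the absolute value of the eigenvalue the sign ambiguity of lifts
    disappears.\<close>
  define e where "e = (\<lambda>h. SOME k::int. v (u h) = v \<pi> powi k)"
  have e: "v (u h) = v \<pi> powi e h" if "h \<in> H" for h
    unfolding e_def by (rule someI_ex) (rule v_pi_power[OF unz[OF that]])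
  have powi_inj: "i = j" if "v \<pi> powi i = v \<pi> powi j" for i j :: int
    using that pi_pos pi_less_1 by (smt (verit, best) power_int_strict_decreasing)
  interpret HG: comm_group "psl2_on H" using comm_group_sub[OF H_sub] by simp
  have ehom: "e (g \<star> h) = e g + e h" if gh: "g \<in> H" "h \<in> H" for g h
  proof (rule powi_inj)
    show "v \<pi> powi e (g \<star> h) = v \<pi> powi (e g + e h)"
      using vmult[OF gh] e[OF gh(1)] e[OF gh(2)] e[OF H.m_closed[OF gh]] pi_pos by (simp add: power_int_add)
  qed
  have e1: "e \<one>\<^bsub>PSL2\<^esub> = 0" using ehom[OF H.one_closed H.one_closed] by simp
  have einv: "e (inv\<^bsub>PSL2\<^esub> h) = - e h" if h: "h \<in> H" for h
    using ehom[OF h H.m_inv_closed[OF h]] e1 PSL2.r_inv[OF H.mem_carrier[OF h]] by simp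
  let ?K = "{h \<in> H. e h = 0}"
  have K: "subgroup ?K PSL2"
  proof
    show "?K \<subseteq> carrier PSL2" using H.subset by blast
  qed (use ehom e1 einv in auto)
  have ld: "l - (t - l) \<noteq> 0"
  proof
    assume "l - (t - l) = 0"
    then have "t = 2 * l" by (simp add: algebra_simps)
    then have "t * t = 4" using double_eigenvalue l by blast
    then show False using tr_C(2) by (simp add: power2_eq_square)
  qed
  have finK: "finite ?K"
  proof (rule bounded_coords_finite)
    let ?R = "1 / v (l - (t - l))"
    fix h assume h: "h \<in> ?K"
    then have hH: "h \<in> H" by simp
    have vu: "v (u h) = 1" using e[OF hH] h by simp
    \<comment> \<open>On the kernel both eigenvalues of h have absolute value one; their difference
      is \<open>cy h\<close> times the nonzero difference of the eigenvalues of C.\<close>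
    have "v (u h) * v (cx h + cy h * (t - l)) = 1" using unorm[OF hH] by (metis v_mult v_1)
    then have vu': "v (cx h + cy h * (t - l)) = 1" using vu by simp
    have "u h - (cx h + cy h * (t - l)) = cy h * (l - (t - l))" by (simp add: u_def algebra_simps)
    then have "v (cy h) * v (l - (t - l)) \<le> 1"
      using v_diff[of "u h" "cx h + cy h * (t - l)"] vu vu' by (simp flip: v_mult)
    then have y: "v (cy h) \<le> ?R" using v_pos[OF ld] by (simp add: pos_le_divide_eq)
    have "cx h = u h - cy h * l" by (simp add: u_def)
    then have "v (cx h) \<le> max 1 (v (cy h) * v l)" using v_diff[of "u h" "cy h * l"] vu by simp
    moreover have "v (cy h) * v l \<le> ?R * v l" using y by (intro mult_right_mono) auto
    ultimately show "v (cx h) \<le> max (max 1 (?R * v l)) ?R" by linarith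
    show "v (cy h) \<le> max (max 1 (?R * v l)) ?R" using y by linarith
  qed auto
  have "cyclic_group (psl2_on ?K)" using finite_cyclic[OF K _ finK] by blast
  then obtain k where k: "k \<in> ?K" "?K = range (\<lambda>n::int. k [^]\<^bsub>psl2_on ?K\<^esub> n)"
    using group.cyclic_group[OF PSL2.subgroup_imp_group[OF K]] by auto
  have kpow: "k [^]\<^bsub>psl2_on ?K\<^esub> (n::int) = k [^]\<^bsub>psl2_on H\<^esub> n" for n
    using PSL2.int_pow_consistent[OF K k(1)] PSL2.int_pow_consistent[OF H_sub, of k] k(1) by simp
  have eh0: "e h0 \<noteq> 0"
  proof
    assume "e h0 = 0"
    then have "v \<mu> = 1" using e[OF h0(1)] by (simp add: u_def m)
    \<comment> \<open>The trace is the sum of the two eigenvalues, so it would be integral if \<mu>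
      were a unit.\<close>
    moreover have "\<tau> = \<mu> + inverse \<mu>"
    proof -
      have "\<mu> \<noteq> 0" using \<open>v \<mu> = 1\<close> by auto
      moreover have "\<mu> * \<tau> = \<mu> * \<mu> + 1" using \<mu> by (simp add: power2_eq_square algebra_simps)
      ultimately show ?thesis by (simp add: field_simps)
    qed
    ultimately have "v \<tau> \<le> 1" using v_add[of \<mu> "inverse \<mu>"] by simp
    then show False using h0(2) by (simp add: \<tau>_def)
  qed
  show ?thesis
  proof (rule HG.cyclic_times_integers[of e k h0])
    show "{x \<in> carrier (psl2_on H). e x = 0} = range (\<lambda>i::int. k [^]\<^bsub>psl2_on H\<^esub> i)"
      using k(2) kpow by simp
  qed (use ehom finK k(1) h0 eh0 in auto)
qed

theorem torus_structure:
  "cyclic_group (psl2_on H) \<or> (\<exists>n>0. psl2_on H \<cong> integer_mod_group n \<times>\<times> integer_group)"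
proof (cases "\<exists>h0\<in>H. 1 < v (2 * cx h0 + cy h0 * t)")
  case True
  then show ?thesis using split_structure by blast
next
  case False
  then have "finite H" using elliptic_finite by force
  then show ?thesis using finite_cyclic[OF H_sub] by blast
qed

end

subsection \<open>Walls with trivial stabilizer\<close>

context wall_action
begin

definition free_walls :: "'x set set" where
  "free_walls = {w \<in> W. \<forall>g\<in>carrier G. act g ` w = w \<longrightarrow> g = \<one>}"

lemma free_walls_compl: "w \<in> free_walls \<Longrightarrow> V - w \<in> free_walls"
proof -
  assume w: "w \<in> free_walls"
  then have wW: "w \<in> W" by (simp add: free_walls_def)
  have "g = \<one>" if g: "g \<in> carrier G" "act g ` (V - w) = V - w" for g
  proof -
    have gw: "act g ` w \<in> W" using act_wall g wW by blast
    have "V - act g ` w = V - w" using image_compl[OF g(1) wW] g(2) by simp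
    then have "act g ` w = w" using double_compl[OF gw] double_compl[OF wW] by metis
    then show ?thesis using w g(1) by (simp add: free_walls_def)
  qed
  then show ?thesis using wall_compl[OF wW] by (simp add: free_walls_def)
qed

text \<open>The stabilizer of a translated edge is a conjugate of the original stabilizer.\<close>

lemma free_walls_act:
  assumes g: "g \<in> carrier G" and w: "w \<in> free_walls"
  shows "act g ` w \<in> free_walls"
proof -
  have wW: "w \<in> W" using w by (simp add: free_walls_def)
  have "h = \<one>" if h: "h \<in> carrier G" "act h ` act g ` w = act g ` w" for h
  proof -
    have "act (inv g \<otimes> (h \<otimes> g)) ` w = act (inv g) ` act g ` w"
      using image_mult[of "inv g" "h \<otimes> g" w] image_mult[of h g w] g h wW by simp
    then have "act (inv g \<otimes> (h \<otimes> g)) ` w = w" using image_inv[OF g wW] by simp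
    then have "inv g \<otimes> (h \<otimes> g) = \<one>" using w g h(1) by (simp add: free_walls_def)
    then have "h \<otimes> g = g" using g h(1) by (metis inv_inv inv_equality m_closed inv_closed)
    then show ?thesis using g h(1) by simp
  qed
  then show ?thesis using act_wall[OF g wW] by (simp add: free_walls_def)
qed

text \<open>An inverted wall is fixed by the square of the inverting element, so in the absence of
  2-torsion free walls are not inverted.\<close>

lemma free_walls_action:
  assumes no2: "\<And>g. g \<in> carrier G \<Longrightarrow> g \<otimes> g = \<one> \<Longrightarrow> g = \<one>"
  shows "free_wall_action V free_walls G act"
proof unfold_locales
  fix h assume h: "h \<in> free_walls"
  then have hW: "h \<in> W" by (simp add: free_walls_def)
  show "h \<subseteq> V" using wall_subset hW .
  show "V - h \<in> free_walls" using free_walls_compl h .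
  show "h \<subseteq> k \<or> k \<subseteq> h \<or> h \<inter> k = {} \<or> h \<union> k = V" if "k \<in> free_walls" for k
    using nested[OF hW] that by (simp add: free_walls_def)
  show "\<exists>x\<in>V - h. \<exists>y\<in>h. {k \<in> free_walls. x \<notin> k \<and> y \<in> k} = {h}"
  proof -
    obtain x y where xy: "x \<in> V - h" "y \<in> h" "{k \<in> W. x \<notin> k \<and> y \<in> k} = {h}" using wall_edge[OF hW] by blast
    have "{k \<in> free_walls. x \<notin> k \<and> y \<in> k} \<subseteq> {k \<in> W. x \<notin> k \<and> y \<in> k}" by (auto simp: free_walls_def)
    then have "{k \<in> free_walls. x \<notin> k \<and> y \<in> k} \<subseteq> {h}" unfolding xy(3) .
    then have "{k \<in> free_walls. x \<notin> k \<and> y \<in> k} = {h}" using xy(1,2) h by blast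
    then show ?thesis using xy(1,2) by blast
  qed
next
  fix x y assume "x \<in> V" "y \<in> V"
  then show "finite {h \<in> free_walls. x \<notin> h \<and> y \<in> h}"
    using finite_sep[of x y] by (rule_tac finite_subset[of _ "{h \<in> W. x \<notin> h \<and> y \<in> h}"]) (auto simp: free_walls_def)
next
  fix g w assume g: "g \<in> carrier G" and w: "w \<in> free_walls"
  then have wW: "w \<in> W" by (simp add: free_walls_def)
  show "act g ` w \<in> free_walls" using free_walls_act g w .
  show "act g ` w = w \<Longrightarrow> g = \<one>" using g w by (simp add: free_walls_def)
  show "act g ` w \<noteq> V - w"
  proof
    assume inv: "act g ` w = V - w"
    have "act (g \<otimes> g) ` w = act g ` (V - w)" using image_mult[OF g g wW] inv by simp
    also have "\<dots> = w" using image_compl[OF g wW] inv double_compl[OF wW] by simp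
    finally have "g \<otimes> g = \<one>" using w g by (simp add: free_walls_def)
    then have "g = \<one>" using no2 g by blast
    then have "w = V - w" using inv image_one[OF wW] by simp
    moreover obtain x y where "x \<in> V - w" using wall_edge[OF wW] by blast
    ultimately show False by blast
  qed
qed (use act_closed act_one act_mult in auto)

end

subsection \<open>The Bruhat--Tits tree as a space of norms\<close>

lemma nested_halves:
  assumes "A \<subseteq> V" "B \<subseteq> V" "A \<subseteq> B \<or> B \<subseteq> A \<or> A \<inter> B = {}" "h = A \<or> h = V - A" "k = B \<or> k = V - B"
  shows "h \<subseteq> k \<or> k \<subseteq> h \<or> h \<inter> k = {} \<or> h \<union> k = V"
proof -
  have "A \<subseteq> B \<Longrightarrow> V - B \<subseteq> V - A" "A \<subseteq> B \<Longrightarrow> A \<inter> (V - B) = {}" "A \<subseteq> B \<Longrightarrow> (V - A) \<union> B = V"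
    "B \<subseteq> A \<Longrightarrow> V - A \<subseteq> V - B" "B \<subseteq> A \<Longrightarrow> A \<union> (V - B) = V" "B \<subseteq> A \<Longrightarrow> (V - A) \<inter> B = {}"
    "A \<inter> B = {} \<Longrightarrow> A \<subseteq> V - B" "A \<inter> B = {} \<Longrightarrow> B \<subseteq> V - A" "A \<inter> B = {} \<Longrightarrow> (V - A) \<union> (V - B) = V"
    using assms(1,2) by blast+
  then show ?thesis using assms(3-5) by metis
qed

context local_field
begin

definition vm :: "'a \<times> 'a \<Rightarrow> 'a m2 \<Rightarrow> 'a \<times> 'a" where
  "vm = (\<lambda>(p, q) (a, b, c, d). (p * a + q * c, p * b + q * d))"

definition mnorm :: "'a m2 \<Rightarrow> 'a \<times> 'a \<Rightarrow> real" where
  "mnorm z \<phi> = max (v (fst (vm \<phi> z))) (v (snd (vm \<phi> z)))"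

definition cross :: "'a \<times> 'a \<Rightarrow> 'a \<times> 'a \<Rightarrow> 'a" where
  "cross = (\<lambda>(p, q) (r, s). p * s - q * r)"

definition norms :: "('a \<times> 'a \<Rightarrow> real) set" where
  "norms = mnorm ` {z. m2_det z \<noteq> 0}"

text \<open>The comparison is homogeneous, so homothetic norms are never separated. Hence plain
  norms serve as points, and \<open>eqv\<close> takes the place of homothety classes.\<close>

definition wall :: "'a \<times> 'a \<Rightarrow> 'a \<times> 'a \<Rightarrow> ('a \<times> 'a \<Rightarrow> real) set" where
  "wall \<phi> \<psi> = {N \<in> norms. N \<phi> \<le> N \<psi>}"

definition walls :: "('a \<times> 'a \<Rightarrow> real) set set" where
  "walls = {wall \<phi> \<psi> | \<phi> \<psi>. cross \<phi> \<psi> \<noteq> 0}"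

lemma vm_mult: "vm (vm \<phi> A) z = vm \<phi> (m2_mult A z)"
  by (cases \<phi>; cases A; cases z) (simp add: vm_def m2_mult_def algebra_simps)

lemma vm_one: "vm \<phi> m2_one = \<phi>"
  by (cases \<phi>) (simp add: vm_def m2_one_def)

lemma mnorm_neg: "mnorm z (vm \<phi> (m2_neg A)) = mnorm z (vm \<phi> A)"
proof -
  have "vm (vm \<phi> (m2_neg A)) z = (- fst (vm (vm \<phi> A) z), - snd (vm (vm \<phi> A) z))"
    by (cases \<phi>; cases A; cases z) (simp add: vm_def m2_neg_def algebra_simps)
  then show ?thesis by (simp add: mnorm_def)
qed

lemma cross_vm: "cross (vm \<phi> A) (vm \<psi> A) = cross \<phi> \<psi> * m2_det A"
  by (cases \<phi>; cases \<psi>; cases A) (simp add: vm_def m2_det_def cross_def algebra_simps)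

lemma max_shift:
  assumes "v c \<le> 1"
  shows "max (v x) (v (c * x + y)) = max (v x) (v y)"
proof -
  have cx: "v (c * x) \<le> v x" using assms mult_right_mono[of "v c" 1 "v x"] by simp
  have "v (c * x + y) \<le> max (v x) (v y)" using v_add[of "c * x" y] cx by linarith
  moreover have "v y \<le> max (v x) (v (c * x + y))" using v_diff[of "c * x + y" "c * x"] cx by simp
  ultimately show ?thesis by linarith
qed

text \<open>Iwasawa decomposition: up to scaling the norms are given by the balls of $K$ with centre
  \<open>\<alpha>\<close> and radius \<open>v \<pi> powi n\<close>.\<close>

definition ball_norm :: "real \<Rightarrow> 'a \<Rightarrow> int \<Rightarrow> 'a \<times> 'a \<Rightarrow> real" where
  "ball_norm s \<alpha> n = (\<lambda>(p, q). s * max (v (p + q * \<alpha>)) (v \<pi> powi n * v q))"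

text \<open>A column operation with an integral factor makes z triangular without changing the
  maximum, after exchanging the columns if necessary. The clause on the determinant pins down the
  scale s, which bounds vertex stabilizers later.\<close>

lemma mnorm_ball_norm:
  assumes z: "m2_det z \<noteq> 0"
  shows "\<exists>s \<alpha> n. s > 0 \<and> s\<^sup>2 * v \<pi> powi n = v (m2_det z) \<and> mnorm z = ball_norm s \<alpha> n"
proof -
  have main: "\<exists>s \<alpha> n. s > 0 \<and> s\<^sup>2 * v \<pi> powi n = v (a * d - b * c) \<and>
      (\<forall>p q. max (v (p * a + q * c)) (v (p * b + q * d)) = ball_norm s \<alpha> n (p, q))"
    if "v b \<le> v a" and det: "a * d - b * c \<noteq> 0" for a b c d
  proof -
    have a0: "a \<noteq> 0"
    proof
      assume "a = 0"
      then have "b = 0" using that(1) v_nonneg[of b] by (simp add: antisym)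
      then show False using det \<open>a = 0\<close> by simp
    qed
    then obtain n :: int where n: "v ((a * d - b * c) / (a * a)) = v \<pi> powi n"
      using v_pi_power[of "(a * d - b * c) / (a * a)"] det by auto
    have va: "v a > 0" using v_pos a0 .
    have "max (v (p * a + q * c)) (v (p * b + q * d)) = ball_norm (v a) (c / a) n (p, q)" for p q
    proof -
      have e: "p * b + q * d = (b / a) * (p * a + q * c) + q * (a * d - b * c) / a"
        using a0 by (simp add: field_simps)
      have "v (b / a) \<le> 1" using that(1) va by simp
      then have 1: "max (v (p * a + q * c)) (v (p * b + q * d)) = max (v (p * a + q * c)) (v (q * (a * d - b * c) / a))"
        unfolding e by (rule max_shift)
      have 2: "p * a + q * c = a * (p + q * (c / a))" using a0 by (simp add: field_simps)
      have 3: "q * (a * d - b * c) / a = a * (((a * d - b * c) / (a * a)) * q)" using a0 by (simp add: field_simps)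
      have "max (v (p * a + q * c)) (v (p * b + q * d)) = max (v (a * (p + q * (c / a)))) (v (a * (((a * d - b * c) / (a * a)) * q)))"
        using 1 unfolding 2 3 .
      also have "\<dots> = v a * max (v (p + q * (c / a))) (v \<pi> powi n * v q)"
        unfolding v_mult[of a] v_mult[of _ q] n using va a0 by (simp add: max_mult_distrib_left)
      finally show ?thesis by (simp add: ball_norm_def)
    qed
    moreover have "(v a)\<^sup>2 * v \<pi> powi n = v (a * d - b * c)"
      unfolding n[symmetric] using va a0 by (simp add: power2_eq_square)
    ultimately show ?thesis using va by blast
  qed
  obtain a b c d where ze: "z = (a, b, c, d)" by (cases z)
  have det: "a * d - b * c \<noteq> 0" using z by (simp add: ze m2_det_def)
  have mn: "mnorm z (p, q) = max (v (p * a + q * c)) (v (p * b + q * d))" for p q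
    by (simp add: mnorm_def vm_def ze)
  show ?thesis
  proof (cases "v b \<le> v a")
    case True
    then obtain s \<alpha> n where "s > 0" "s\<^sup>2 * v \<pi> powi n = v (a * d - b * c)"
      "\<forall>p q. max (v (p * a + q * c)) (v (p * b + q * d)) = ball_norm s \<alpha> n (p, q)" using main det by blast
    moreover from this have "mnorm z = ball_norm s \<alpha> n" using mn by auto
    ultimately show ?thesis by (auto simp: ze m2_det_def)
  next
    case False
    have "v a \<le> v b" "b * c - a * d \<noteq> 0" using False det by auto
    then obtain s \<alpha> n where s: "s > 0" "s\<^sup>2 * v \<pi> powi n = v (b * c - a * d)"
      "\<forall>p q. max (v (p * b + q * d)) (v (p * a + q * c)) = ball_norm s \<alpha> n (p, q)" using main by blast
    then have "mnorm z = ball_norm s \<alpha> n" using mn by (auto simp: max.commute)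
    moreover have "v (b * c - a * d) = v (m2_det z)" by (simp add: ze m2_det_def v_diff_comm)
    ultimately show ?thesis using s(1,2) by auto
  qed
qed

section \<open>Halfspaces as families of ultrametric balls\<close>

definition pt :: "'a \<Rightarrow> int \<Rightarrow> 'a \<times> 'a \<Rightarrow> real" where
  "pt \<alpha> n = mnorm (1, 0, \<alpha>, \<pi> powi n)"

lemma pt_norms: "pt \<alpha> n \<in> norms"
  by (auto simp: pt_def norms_def m2_det_def)

lemma pt_ball_norm: "pt \<alpha> n = ball_norm 1 \<alpha> n"
  by (auto simp: pt_def mnorm_def vm_def ball_norm_def mult.commute)

lemma norms_ball_norm:
  assumes "N \<in> norms"
  obtains s \<alpha> n where "s > 0" "N = ball_norm s \<alpha> n"
proof -
  obtain z where z: "m2_det z \<noteq> 0" "N = mnorm z" using assms unfolding norms_def by blast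
  show ?thesis using mnorm_ball_norm[OF z(1)] that z(2) by metis
qed

lemma norms_add: "N \<in> norms \<Longrightarrow> N (p + r, q + s) \<le> max (N (p, q)) (N (r, s))"
proof -
  assume "N \<in> norms"
  then obtain a b c d where N: "N = mnorm (a, b, c, d)" by (auto simp: norms_def)
  have "N (p + r, q + s) = max (v ((p * a + q * c) + (r * a + s * c))) (v ((p * b + q * d) + (r * b + s * d)))"
    by (simp add: N mnorm_def vm_def algebra_simps)
  then show ?thesis
    using v_add[of "p * a + q * c" "r * a + s * c"] v_add[of "p * b + q * d" "r * b + s * d"]
    by (simp add: N mnorm_def vm_def) linarith
qed

lemma norms_scale: "N \<in> norms \<Longrightarrow> N (c * p, c * q) = v c * N (p, q)"
proof -
  assume "N \<in> norms"
  then obtain a b c' d where N: "N = mnorm (a, b, c', d)" by (auto simp: norms_def)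
  have "N (c * p, c * q) = max (v (c * (p * a + q * c'))) (v (c * (p * b + q * d)))"
    by (simp add: N mnorm_def vm_def algebra_simps)
  then show ?thesis by (simp add: N mnorm_def vm_def max_mult_distrib_left del: v_mult) (simp add: max_mult_distrib_left)
qed

text \<open>In the language of balls, these are the norms whose ball is contained in the ball with
  centre a and radius \<open>v \<pi> powi m\<close>.\<close>

definition down :: "'a \<Rightarrow> int \<Rightarrow> ('a \<times> 'a \<Rightarrow> real) set" where
  "down a m = {N \<in> norms. N (- a, 1) \<le> v \<pi> powi m * N (1, 0)}"

lemma powi_le_iff: "v \<pi> powi i \<le> v \<pi> powi j \<longleftrightarrow> j \<le> i"
  using pi_pos pi_less_1
  by (metis linorder_not_le order_less_imp_le power_int_decreasing power_int_strict_decreasing)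

lemma powi_pos: "0 < v \<pi> powi i"
  using pi_pos by simp

lemma ball_norm_down:
  assumes "N \<in> norms" "s > 0" "N = ball_norm s \<alpha> n"
  shows "N \<in> down a m \<longleftrightarrow> v (\<alpha> - a) \<le> v \<pi> powi m \<and> m \<le> n"
proof -
  have "N (- a, 1) = s * max (v (\<alpha> - a)) (v \<pi> powi n)" "N (1, 0) = s"
    using powi_pos[of n] by (simp_all add: assms(3) ball_norm_def add.commute)
  then show ?thesis
    using assms(1,2) by (simp add: down_def mult.commute[of _ s] powi_le_iff)
qed

lemma pt_down: "pt \<alpha> n \<in> down a m \<longleftrightarrow> v (\<alpha> - a) \<le> v \<pi> powi m \<and> m \<le> n"
  using ball_norm_down[OF pt_norms zero_less_one pt_ball_norm] .

text \<open>The ratio of \<open>N (- a, 1)\<close> to \<open>N (1, 0)\<close> is a power of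
  \<open>v \<pi>\<close>, so exceeding the power m means being at least the power m - 1. Thus
  complements are again given by a weak inequality.\<close>

lemma compl_down: "norms - down a m = {N \<in> norms. v \<pi> powi (m - 1) * N (1, 0) \<le> N (- a, 1)}"
proof -
  have "N \<notin> down a m \<longleftrightarrow> v \<pi> powi (m - 1) * N (1, 0) \<le> N (- a, 1)" if N: "N \<in> norms" for N
  proof -
    obtain s \<alpha> n where s: "s > 0" "N = ball_norm s \<alpha> n" using norms_ball_norm[OF N] .
    have e: "N (- a, 1) = s * max (v (\<alpha> - a)) (v \<pi> powi n)" "N (1, 0) = s"
      using powi_pos[of n] by (simp_all add: s(2) ball_norm_def add.commute)
    have "\<exists>k. max (v (\<alpha> - a)) (v \<pi> powi n) = v \<pi> powi k"
    proof (cases "v (\<alpha> - a) \<le> v \<pi> powi n")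
      case False
      then have "\<alpha> - a \<noteq> 0" using powi_pos[of n] by auto
      then show ?thesis using v_pi_power False by (simp add: max_def)
    qed auto
    then obtain k where k: "max (v (\<alpha> - a)) (v \<pi> powi n) = v \<pi> powi k" ..
    have "N \<notin> down a m \<longleftrightarrow> \<not> v \<pi> powi k \<le> v \<pi> powi m"
      using N s(1) by (simp add: down_def e k mult.commute[of _ s])
    also have "\<dots> \<longleftrightarrow> v \<pi> powi (m - 1) \<le> v \<pi> powi k" by (auto simp: powi_le_iff)
    also have "\<dots> \<longleftrightarrow> v \<pi> powi (m - 1) * N (1, 0) \<le> N (- a, 1)" using s(1) by (simp add: e k mult.commute[of _ s])
    finally show ?thesis .
  qed
  then show ?thesis by (auto simp: down_def)
qed

text \<open>By the ultrametric inequality the comparison survives subtracting a suitable integral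
  multiple of one vector from the other. This makes one second coordinate zero, and comparing with
  \<open>(1, 0)\<close> is a condition on balls.\<close>

lemma wall_down:
  assumes cross: "cross \<phi> \<psi> \<noteq> 0"
  shows "\<exists>a m. wall \<phi> \<psi> = down a m \<or> wall \<phi> \<psi> = norms - down a m"
proof -
  obtain x y x' y' where e: "\<phi> = (x, y)" "\<psi> = (x', y')" by (cases \<phi>; cases \<psi>)
  have cr: "x * y' - y * x' \<noteq> 0" using cross by (simp add: e cross_def)
  show ?thesis
  proof (cases "v y \<le> v y'")
    case True
    have y': "y' \<noteq> 0"
    proof
      assume "y' = 0"
      then have "v y = 0" using True v_nonneg[of y] by simp
      then show False using cr \<open>y' = 0\<close> by simp
    qed
    define c where "c = y / y'"
    have vc: "v c \<le> 1" using True v_pos[OF y'] by (simp add: c_def)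
    define f where "f = x - c * x'"
    have f: "f \<noteq> 0" using cr y' by (auto simp: f_def c_def field_simps)
    obtain k :: int where k: "v (f / y') = v \<pi> powi k" using v_pi_power[of "f / y'"] f y' by auto
    \<comment> \<open>The exponent k is written as k + 1 - 1 to fit
      \<open>compl_down\<close>.\<close>
    have "N (x, y) \<le> N (x', y') \<longleftrightarrow> v \<pi> powi (k + 1 - 1) * N (1, 0) \<le> N (- (- (x' / y')), 1)" if N: "N \<in> norms" for N
    proof -
      have cN: "N (c * x', c * y') \<le> N (x', y')" "N (- c * x', - c * y') \<le> N (x', y')"
      proof -
        have "N (x', y') \<ge> 0" using N by (auto simp: norms_def mnorm_def le_max_iff_disj)
        then show "N (c * x', c * y') \<le> N (x', y')" "N (- c * x', - c * y') \<le> N (x', y')"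
          using norms_scale[OF N, of c x' y'] norms_scale[OF N, of "- c" x' y'] vc mult_right_mono[of "v c" 1 "N (x', y')"] by simp_all
      qed
      have "N (x, y) \<le> max (N (f, 0)) (N (c * x', c * y'))"
        using norms_add[OF N, of f "c * x'" 0 "c * y'"] y' by (simp add: f_def c_def)
      moreover have "N (f, 0) \<le> max (N (x, y)) (N (- c * x', - c * y'))"
        using norms_add[OF N, of x "- c * x'" y "- c * y'"] y' by (simp add: f_def c_def)
      ultimately have 1: "N (x, y) \<le> N (x', y') \<longleftrightarrow> N (f, 0) \<le> N (x', y')" using cN by linarith
      have 2: "N (f, 0) = v f * N (1, 0)" using norms_scale[OF N, of f 1 0] by simp
      have 3: "N (x', y') = v y' * N (x' / y', 1)" using norms_scale[OF N, of y' "x' / y'" 1] y' by simp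
      have "N (f, 0) \<le> N (x', y') \<longleftrightarrow> v \<pi> powi k * N (1, 0) \<le> N (x' / y', 1)"
        unfolding 2 3 k[symmetric] using v_pos[OF y'] by (simp add: pos_divide_le_eq mult.commute)
      then show ?thesis using 1 by simp
    qed
    then have "wall \<phi> \<psi> = norms - down (- (x' / y')) (k + 1)"
      unfolding compl_down wall_def e by blast
    then show ?thesis by blast
  next
    case False
    then have less: "v y' < v y" by simp
    then have "v y \<noteq> 0" using v_nonneg[of y'] by linarith
    then have y: "y \<noteq> 0" by simp
    define c where "c = y' / y"
    \<comment> \<open>Now the second vector is modified by a multiple of the first. Strictness makes
      that multiple shorter than the first vector, so it cannot decide the comparison.\<close>
    have vc: "v c < 1" using less v_pos[OF y] by (simp add: c_def)
    define f where "f = x' - c * x"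
    have f: "f \<noteq> 0" using cr y by (auto simp: f_def c_def field_simps)
    obtain k :: int where k: "v (f / y) = v \<pi> powi k" using v_pi_power[of "f / y"] f y by auto
    have "N (x, y) \<le> N (x', y') \<longleftrightarrow> N (- (- (x / y)), 1) \<le> v \<pi> powi k * N (1, 0)" if N: "N \<in> norms" for N
    proof -
      have "N (x, y) > 0"
      proof -
        obtain s \<alpha> n where s: "s > 0" "N = ball_norm s \<alpha> n" using norms_ball_norm[OF N] .
        have "v \<pi> powi n * v y > 0" using powi_pos v_pos[OF y] by simp
        then show ?thesis using s by (simp add: ball_norm_def less_max_iff_disj)
      qed
      then have cN: "N (c * x, c * y) < N (x, y)" "N (- c * x, - c * y) < N (x, y)"
        using norms_scale[OF N, of c x y] norms_scale[OF N, of "- c" x y] vc mult_strict_right_mono[of "v c" 1 "N (x, y)"] by simp_all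
      have "N (x', y') \<le> max (N (f, 0)) (N (c * x, c * y))"
        using norms_add[OF N, of f "c * x" 0 "c * y"] y by (simp add: f_def c_def)
      moreover have "N (f, 0) \<le> max (N (x', y')) (N (- c * x, - c * y))"
        using norms_add[OF N, of x' "- c * x" y' "- c * y"] y by (simp add: f_def c_def)
      ultimately have 1: "N (x, y) \<le> N (x', y') \<longleftrightarrow> N (x, y) \<le> N (f, 0)" using cN by linarith
      have 2: "N (f, 0) = v f * N (1, 0)" using norms_scale[OF N, of f 1 0] by simp
      have 3: "N (x, y) = v y * N (x / y, 1)" using norms_scale[OF N, of y "x / y" 1] y by simp
      have "N (x, y) \<le> N (f, 0) \<longleftrightarrow> N (x / y, 1) \<le> v \<pi> powi k * N (1, 0)"
        unfolding 2 3 k[symmetric] using v_pos[OF y] by (simp add: pos_le_divide_eq mult.commute)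
      then show ?thesis using 1 by simp
    qed
    then have "wall \<phi> \<psi> = down (- (x / y)) k"
      unfolding down_def wall_def e by blast
    then show ?thesis by blast
  qed
qed

lemma down_wall: "down a m \<in> walls" and compl_down_wall: "norms - down a m \<in> walls"
proof -
  have s: "N (\<pi> powi i, 0) = v \<pi> powi i * N (1, 0)" if "N \<in> norms" for N i
    using norms_scale[OF that, of "\<pi> powi i" 1 0] by simp
  have "down a m = wall (- a, 1) (\<pi> powi m, 0)" by (auto simp: down_def wall_def s)
  then show "down a m \<in> walls" by (auto simp: walls_def cross_def intro!: exI)
  have "norms - down a m = wall (\<pi> powi (m - 1), 0) (- a, 1)" unfolding compl_down by (auto simp: wall_def s)
  then show "norms - down a m \<in> walls" by (auto simp: walls_def cross_def intro!: exI)
qed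

lemma walls_cases:
  assumes "h \<in> walls"
  obtains a m where "h = down a m" | a m where "h = norms - down a m"
  using assms wall_down unfolding walls_def by blast

text \<open>Every point of an ultrametric ball is a centre of it.\<close>

lemma down_eq:
  assumes "v (a - b) \<le> v \<pi> powi m"
  shows "down a m = down b m"
proof -
  have "N \<in> down a m \<longleftrightarrow> N \<in> down b m" if N: "N \<in> norms" for N
  proof -
    obtain s \<alpha> n where s: "s > 0" "N = ball_norm s \<alpha> n" using norms_ball_norm[OF N] .
    have "v (\<alpha> - a) \<le> v \<pi> powi m \<longleftrightarrow> v (\<alpha> - b) \<le> v \<pi> powi m"
      using v_triangle[of \<alpha> b a] v_triangle[of \<alpha> a b] v_diff_comm[of a b] assms by linarith
    then show ?thesis by (simp add: ball_norm_down[OF N s])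
  qed
  then show ?thesis by (auto simp: down_def)
qed

text \<open>Two ultrametric balls are nested or disjoint.\<close>

lemma down_nested: "down a m \<subseteq> down b j \<or> down b j \<subseteq> down a m \<or> down a m \<inter> down b j = {}"
proof -
  have main: "down a m \<subseteq> down b j \<or> down a m \<inter> down b j = {}" if jm: "j \<le> m" for a b m j
  proof (cases "v (a - b) \<le> v \<pi> powi j")
    case True
    have "down a m \<subseteq> down a j"
    proof
      fix N assume N: "N \<in> down a m"
      then have Nn: "N \<in> norms" by (simp add: down_def)
      obtain s \<alpha> n where s: "s > 0" "N = ball_norm s \<alpha> n" using norms_ball_norm[OF Nn] .
      have "v \<pi> powi m \<le> v \<pi> powi j" using jm powi_le_iff by blast
      then show "N \<in> down a j" using N jm by (simp add: ball_norm_down[OF Nn s])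
    qed
    then show ?thesis using down_eq[OF True] by blast
  next
    case False
    have "N \<notin> down b j" if N: "N \<in> down a m" for N
    proof
      assume Nb: "N \<in> down b j"
      have Nn: "N \<in> norms" using N by (simp add: down_def)
      obtain s \<alpha> n where s: "s > 0" "N = ball_norm s \<alpha> n" using norms_ball_norm[OF Nn] .
      have "v \<pi> powi m \<le> v \<pi> powi j" using jm powi_le_iff by blast
      moreover have "v (\<alpha> - a) \<le> v \<pi> powi m" "v (\<alpha> - b) \<le> v \<pi> powi j"
        using N Nb by (simp_all add: ball_norm_down[OF Nn s])
      ultimately show False
        using False v_triangle[of a b \<alpha>] v_diff_comm[of a \<alpha>] by linarith
    qed
    then show ?thesis by blast
  qed
  show ?thesis using main[of j m a b] main[of m j b a] by (cases "j \<le> m") (auto simp: Int_commute)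
qed

text \<open>The ball defining a separating halfspace contains one of the two given balls and can be
  recentred there. Its exponent is bounded above by that of the given ball and below by M.\<close>

lemma walls_finite_sep:
  assumes x: "x \<in> norms" and y: "y \<in> norms"
  shows "finite {h \<in> walls. x \<notin> h \<and> y \<in> h}"
proof -
  obtain s \<alpha> n where s: "s > 0" "x = ball_norm s \<alpha> n" using norms_ball_norm[OF x] .
  obtain s' \<beta> k where s': "s' > 0" "y = ball_norm s' \<beta> k" using norms_ball_norm[OF y] .
  obtain l where "v (\<alpha> - \<beta>) \<le> v (inverse \<pi> ^ l)" using large_power by blast
  then have l: "v (\<alpha> - \<beta>) \<le> v \<pi> powi (- int l)" by (simp add: power_int_minus power_inverse)
  \<comment> \<open>From this exponent downwards the balls around \<alpha> and \<beta> coincide and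
    contain both given balls, so they separate nothing.\<close>
  define M where "M = min (- int l) (min n k)"
  have big: "v (\<alpha> - \<beta>) \<le> v \<pi> powi j" if "j \<le> M" for j
    using l powi_le_iff[of "- int l" j] that by (simp add: M_def)
  have mx: "x \<in> down b j \<longleftrightarrow> v (\<alpha> - b) \<le> v \<pi> powi j \<and> j \<le> n" for b j using ball_norm_down[OF x s] .
  have my: "y \<in> down b j \<longleftrightarrow> v (\<beta> - b) \<le> v \<pi> powi j \<and> j \<le> k" for b j using ball_norm_down[OF y s'] .
  have "{h \<in> walls. x \<notin> h \<and> y \<in> h} \<subseteq> down \<beta> ` {M..k} \<union> (\<lambda>j. norms - down \<alpha> j) ` {M..n}"
  proof
    fix h assume h: "h \<in> {h \<in> walls. x \<notin> h \<and> y \<in> h}"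
    then have "h \<in> walls" by blast
    then show "h \<in> down \<beta> ` {M..k} \<union> (\<lambda>j. norms - down \<alpha> j) ` {M..n}"
    proof (cases rule: walls_cases)
      case (1 b j)
      then have b: "v (\<beta> - b) \<le> v \<pi> powi j" "j \<le> k" using h my by auto
      then have e: "down \<beta> j = h" using 1 down_eq by simp
      have "M \<le> j"
      proof (rule ccontr)
        assume "\<not> M \<le> j"
        then have "j \<le> M" "j \<le> n" by (auto simp: M_def)
        then have "x \<in> down \<beta> j" using big[of j] by (simp add: mx)
        then show False using e h by blast
      qed
      then show ?thesis using e b(2) by auto
    next
      case (2 b j)
      then have b: "v (\<alpha> - b) \<le> v \<pi> powi j" "j \<le> n" using h mx x by auto
      then have e: "norms - down \<alpha> j = h" using 2 down_eq by simp
      have "M \<le> j"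
      proof (rule ccontr)
        assume "\<not> M \<le> j"
        then have "j \<le> M" "j \<le> k" by (auto simp: M_def)
        then have "y \<in> down \<alpha> j" using big[of j] v_diff_comm[of \<alpha> \<beta>] by (simp add: my)
        then show False using e h by blast
      qed
      then show ?thesis using e b(2) by auto
    qed
  qed
  then show ?thesis by (rule finite_subset) simp
qed

text \<open>Balls with the same centre and consecutive exponents are adjacent vertices.\<close>

lemma down_edge: "{k \<in> walls. pt a (m - 1) \<notin> k \<and> pt a m \<in> k} = {down a m}"
proof (intro equalityI subsetI)
  fix k assume k: "k \<in> {k \<in> walls. pt a (m - 1) \<notin> k \<and> pt a m \<in> k}"
  then have "k \<in> walls" by blast
  then show "k \<in> {down a m}"
  proof (cases rule: walls_cases)
    case (1 b j)
    then have "v (a - b) \<le> v \<pi> powi j" "j = m" using k by (auto simp: pt_down)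
    then show ?thesis using 1 down_eq by simp
  next
    case (2 b j)
    then show ?thesis using k pt_norms by (auto simp: pt_down)
  qed
qed (use down_wall powi_pos[of m] in \<open>simp add: pt_down\<close>)

lemma wall_space_norms: "wall_space norms walls"
proof
  fix h assume h: "h \<in> walls"
  show "h \<subseteq> norms" using h by (auto simp: walls_def wall_def)
  show c: "norms - h \<in> walls" if "h \<in> walls" for h
    using that
  proof (cases rule: walls_cases)
    case (2 a m)
    then have "norms - h = down a m" by (auto simp: down_def)
    then show ?thesis using down_wall by simp
  qed (use compl_down_wall in simp)
  show "\<exists>x\<in>norms - h. \<exists>y\<in>h. {k \<in> walls. x \<notin> k \<and> y \<in> k} = {h}"
    using h
  proof (cases rule: walls_cases)
    case (1 a m)
    have "pt a (m - 1) \<in> norms - h" "pt a m \<in> h" using pt_norms powi_pos[of m] by (auto simp: 1 pt_down)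
    then show ?thesis using down_edge[of a m] 1 by blast
  next
    case (2 a m)
    have p: "pt a m \<in> norms - h" "pt a (m - 1) \<in> h" using pt_norms powi_pos[of m] by (auto simp: 2 pt_down)
    have "k = h" if k: "k \<in> walls" "pt a m \<notin> k" "pt a (m - 1) \<in> k" for k
    proof -
      have "norms - k \<in> {k \<in> walls. pt a (m - 1) \<notin> k \<and> pt a m \<in> k}" using c k pt_norms by simp
      then have "norms - k = down a m" using down_edge by simp
      moreover have "k \<subseteq> norms" using k(1) by (auto simp: walls_def wall_def)
      ultimately show ?thesis using 2 by blast
    qed
    then have "{k \<in> walls. pt a m \<notin> k \<and> pt a (m - 1) \<in> k} \<subseteq> {h}" by blast
    moreover have "h \<in> {k \<in> walls. pt a m \<notin> k \<and> pt a (m - 1) \<in> k}" using h p by simp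
    ultimately have "{k \<in> walls. pt a m \<notin> k \<and> pt a (m - 1) \<in> k} = {h}" by (simp only: subset_singleton_iff) blast
    with p show ?thesis by (intro bexI)
  qed
  show "h \<subseteq> k \<or> k \<subseteq> h \<or> h \<inter> k = {} \<or> h \<union> k = norms" if k: "k \<in> walls" for k
  proof -
    have sub: "down a m \<subseteq> norms" for a m by (auto simp: down_def)
    obtain a m where a: "h = down a m \<or> h = norms - down a m" using h walls_cases by metis
    obtain b j where b: "k = down b j \<or> k = norms - down b j" using k walls_cases by metis
    show ?thesis
      by (rule nested_halves[OF sub[of a m] sub[of b j] down_nested[of a m b j] a b])
  qed
qed (rule walls_finite_sep)

end

subsection \<open>The action on the tree\<close>

context discrete_PSL2
begin

text \<open>Norms are even, so the choice of the lift does not matter. Matrices multiply row vectors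
  from the right, which makes this a left action on norms.\<close>

definition act :: "'a m2 set \<Rightarrow> ('a \<times> 'a \<Rightarrow> real) \<Rightarrow> 'a \<times> 'a \<Rightarrow> real" where
  "act P N \<phi> = N (vm \<phi> (SOME A. A \<in> P))"

abbreviation \<Gamma> where "\<Gamma> \<equiv> psl2_on G"

lemma act_class:
  assumes "N \<in> norms"
  shows "act (psl2_class A) N \<phi> = N (vm \<phi> A)"
proof -
  obtain z where z: "N = mnorm z" using assms by (auto simp: norms_def)
  have "(SOME B. B \<in> psl2_class A) \<in> psl2_class A" by (rule someI[of _ A]) (simp add: psl2_class_def)
  then have "(SOME B. B \<in> psl2_class A) = A \<or> (SOME B. B \<in> psl2_class A) = m2_neg A"
    by (simp add: psl2_class_def)
  then show ?thesis unfolding act_def z using mnorm_neg by metis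
qed

lemma act_mnorm: "m2_det z \<noteq> 0 \<Longrightarrow> act (psl2_class A) (mnorm z) = mnorm (m2_mult A z)"
proof
  fix \<phi> assume "m2_det z \<noteq> 0"
  then have "mnorm z \<in> norms" by (auto simp: norms_def)
  then show "act (psl2_class A) (mnorm z) \<phi> = mnorm (m2_mult A z) \<phi>"
    by (simp add: act_class) (simp add: mnorm_def vm_mult)
qed

lemma act_norms: "m2_det A = 1 \<Longrightarrow> N \<in> norms \<Longrightarrow> act (psl2_class A) N \<in> norms"
  by (auto simp: norms_def act_mnorm)

lemma act_wall_image:
  assumes A: "m2_det A = 1"
  shows "act (psl2_class A) ` wall \<phi> \<psi> = wall (vm \<phi> (m2_adj A)) (vm \<psi> (m2_adj A))"
proof (intro equalityI subsetI)
  fix N assume "N \<in> act (psl2_class A) ` wall \<phi> \<psi>"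
  then obtain M where M: "M \<in> wall \<phi> \<psi>" "N = act (psl2_class A) M" by blast
  then have Mn: "M \<in> norms" by (simp add: wall_def)
  have "N (vm \<chi> (m2_adj A)) = M \<chi>" for \<chi>
    by (simp add: M(2) act_class[OF Mn] vm_mult m2_adj_mult[OF A] vm_one)
  then show "N \<in> wall (vm \<phi> (m2_adj A)) (vm \<psi> (m2_adj A))"
    using M(1) act_norms[OF A Mn] by (simp add: wall_def M(2))
next
  fix N assume N: "N \<in> wall (vm \<phi> (m2_adj A)) (vm \<psi> (m2_adj A))"
  then have Nn: "N \<in> norms" by (simp add: wall_def)
  let ?M = "act (psl2_class (m2_adj A)) N"
  have Mn: "?M \<in> norms" using act_norms[of "m2_adj A"] A Nn by simp
  have "?M \<in> wall \<phi> \<psi>" using N Mn by (simp add: wall_def act_class[OF Nn])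
  moreover have "act (psl2_class A) ?M = N"
  proof
    fix \<chi> show "act (psl2_class A) ?M \<chi> = N \<chi>"
      by (simp add: act_class[OF Mn] act_class[OF Nn] vm_mult m2_adj_mult[OF A] vm_one)
  qed
  ultimately show "N \<in> act (psl2_class A) ` wall \<phi> \<psi>" by force
qed

lemma Gamma_lift:
  assumes "g \<in> carrier \<Gamma>"
  shows "\<exists>A. m2_det A = 1 \<and> g = psl2_class A"
proof -
  have g: "g \<in> G" using assms by simp
  obtain A where "m2_det A = 1" "g = psl2_class A" using G_lift[OF g] .
  then show ?thesis by blast
qed

lemma wall_action_norms: "wall_action norms walls \<Gamma> act"
proof -
  interpret wall_space norms walls by (rule wall_space_norms)
  interpret \<Gamma>: group \<Gamma> using PSL2.subgroup_imp_group[OF sub] .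
  show ?thesis
  proof
    fix g N assume "g \<in> carrier \<Gamma>" and N: "N \<in> norms"
    then obtain A where A: "m2_det A = 1" "g = psl2_class A" using Gamma_lift by blast
    then show "act g N \<in> norms" using act_norms N by simp
  next
    fix N assume N: "N \<in> norms"
    show "act \<one>\<^bsub>\<Gamma>\<^esub> N = N" by (rule ext) (simp add: psl2_one act_class[OF N] vm_one)
  next
    fix g h N assume "g \<in> carrier \<Gamma>" "h \<in> carrier \<Gamma>" and N: "N \<in> norms"
    then obtain A B where A: "m2_det A = 1" "g = psl2_class A" and B: "m2_det B = 1" "h = psl2_class B"
      using Gamma_lift by blast
    have "act h N \<in> norms" using act_norms[OF B(1) N] B(2) by simp
    then show "act (g \<otimes>\<^bsub>\<Gamma>\<^esub> h) N = act g (act h N)"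
      by (intro ext) (simp add: A B act_class N vm_mult)
  next
    fix g w assume "g \<in> carrier \<Gamma>" "w \<in> walls"
    then obtain A \<phi> \<psi> where A: "m2_det A = 1" "g = psl2_class A" and w: "w = wall \<phi> \<psi>" "cross \<phi> \<psi> \<noteq> 0"
      using Gamma_lift[of g] unfolding walls_def by blast
    have "cross (vm \<phi> (m2_adj A)) (vm \<psi> (m2_adj A)) \<noteq> 0" using w A by (simp add: cross_vm)
    then show "act g ` w \<in> walls" unfolding A(2) w(1) act_wall_image[OF A(1)] walls_def by blast
  qed
qed

sublocale T: wall_action norms walls \<Gamma> act
  by (rule wall_action_norms)

lemma eqv_down:
  assumes "x \<in> norms" "y \<in> norms" "T.eqv x y"
  shows "x \<in> down a m \<longleftrightarrow> y \<in> down a m"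
  using T.eqv_wall[OF assms down_wall] .

text \<open>An element fixing the vertex preserves the ball, and by determinant one also the scale
  of the norm. This bounds the entries of A z, hence those of A, and discreteness gives
  finiteness.\<close>

lemma vertex_stabilizer_finite:
  assumes x: "x \<in> norms"
  shows "finite (T.Stab x)"
proof -
  obtain z where z: "m2_det z \<noteq> 0" "x = mnorm z" using x by (auto simp: norms_def)
  obtain s \<alpha> n where s: "s > 0" "s\<^sup>2 * v \<pi> powi n = v (m2_det z)" "x = ball_norm s \<alpha> n"
    using mnorm_ball_norm[OF z(1)] z(2) by metis
  obtain a b c d where ze: "z = (a, b, c, d)" by (cases z)
  define D where "D = m2_det z"
  \<comment> \<open>The inverse of z, by which the bound on A z is turned into one on A.\<close>
  define w where "w = (d / D, - b / D, - c / D, a / D)"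
  have "m2_mult z w = ((a * d - b * c) / D, 0, 0, (a * d - b * c) / D)"
    by (simp add: ze w_def m2_mult_def diff_divide_distrib mult.commute)
  then have zw: "m2_mult z w = m2_one" using z(1) by (simp add: D_def ze m2_det_def m2_one_def)
  define R where "R = s * max 1 (max (v \<alpha>) (v \<pi> powi n))"
  show ?thesis
  proof (rule bounded_finite)
    show "T.Stab x \<subseteq> G" by (auto simp: T.Stab_def)
    fix g assume g: "g \<in> T.Stab x"
    then have gG: "g \<in> G" and ge: "T.eqv (act g x) x" by (auto simp: T.Stab_def)
    obtain A where A: "m2_det A = 1" "g = psl2_class A" using G_lift[OF gG] .
    have gx: "act g x = mnorm (m2_mult A z)" using act_mnorm[OF z(1)] A z(2) by simp
    have dz: "m2_det (m2_mult A z) \<noteq> 0" using A(1) z(1) by simp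
    have gxn: "act g x \<in> norms" using dz by (auto simp: gx norms_def)
    obtain s' \<alpha>' n' where s': "s' > 0" "s'\<^sup>2 * v \<pi> powi n' = v (m2_det (m2_mult A z))" "act g x = ball_norm s' \<alpha>' n'"
      using mnorm_ball_norm[OF dz] gx by metis
    have "x \<in> down \<alpha> n" using ball_norm_down[OF x s(1,3), of \<alpha> n] powi_pos[of n] by simp
    then have "act g x \<in> down \<alpha> n" using eqv_down[OF gxn x ge] by blast
    then have 1: "v (\<alpha>' - \<alpha>) \<le> v \<pi> powi n" "n \<le> n'" using ball_norm_down[OF gxn s'(1,3)] by auto
    have "act g x \<in> down \<alpha>' n'" using ball_norm_down[OF gxn s'(1,3), of \<alpha>' n'] powi_pos[of n'] by simp
    then have "x \<in> down \<alpha>' n'" using eqv_down[OF gxn x ge] by blast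
    then have "n' \<le> n" using ball_norm_down[OF x s(1,3)] by auto
    then have n: "n' = n" using 1 by simp
    have "s'\<^sup>2 * v \<pi> powi n = s\<^sup>2 * v \<pi> powi n" using s(2) s'(2) A(1) n by simp
    moreover have "v \<pi> powi n \<noteq> 0" using powi_pos[of n] by linarith
    ultimately have "s'\<^sup>2 = s\<^sup>2" using mult_right_cancel by blast
    then have ss: "s' = s" using s(1) s'(1) by simp
    have "v \<alpha>' \<le> max (v \<alpha>) (v \<pi> powi n)" using 1(1) v_add[of "\<alpha>' - \<alpha>" \<alpha>] by simp
    then have al: "s * max (v \<alpha>') (v \<pi> powi n) \<le> R" unfolding R_def using s(1) by (intro mult_left_mono) auto
    have one: "s * 1 \<le> R" unfolding R_def using s(1) by (intro mult_left_mono) auto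
    obtain p q r t where Az: "m2_mult A z = (p, q, r, t)" by (cases "m2_mult A z")
    have e: "mnorm (p, q, r, t) = ball_norm s \<alpha>' n" using gx s'(3) by (simp add: Az ss n)
    \<comment> \<open>The values of the norm at the two basis vectors bound all four entries of A
      z.\<close>
    have "mnorm (p, q, r, t) (1, 0) = s" "mnorm (p, q, r, t) (0, 1) = s * max (v \<alpha>') (v \<pi> powi n)"
      unfolding e using powi_pos[of n] by (simp_all add: ball_norm_def)
    then have "v p \<le> R" "v q \<le> R" "v r \<le> R" "v t \<le> R"
      using al one by (simp_all add: mnorm_def vm_def)
    then have "m2_norm (m2_mult A z) \<le> R" by (simp add: Az m2_norm_entries)
    then have "m2_norm (m2_mult A z) * m2_norm w \<le> R * m2_norm w"
      by (intro mult_right_mono m2_norm_nonneg)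
    moreover have "m2_mult (m2_mult A z) w = A" by (simp add: m2_mult_assoc zw)
    ultimately have "m2_norm A \<le> R * m2_norm w" using m2_norm_mult[of "m2_mult A z" w] by simp
    then show "\<exists>A. m2_det A = 1 \<and> g = psl2_class A \<and> m2_norm A \<le> R * m2_norm w" using A by blast
  qed
qed

section \<open>Stabilizers of collapsed vertices\<close>

lemma subgroup_of_Gamma:
  assumes "subgroup H \<Gamma>"
  shows "subgroup H PSL2" "H \<subseteq> G"
  using PSL2.incl_subgroup[OF sub assms] subgroup.subset[OF assms] by auto

lemma vertex_stabilizer_regular:
  assumes "x \<in> norms" "g \<in> T.Stab x" "g \<noteq> \<one>\<^bsub>PSL2\<^esub>"
  shows "regular g"
  using finite_subgroup_regular subgroup_of_Gamma[OF T.subgroup_Stab] vertex_stabilizer_finite assms by blast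

lemma vertex_stabilizer_abelian:
  assumes "x \<in> norms" "g \<in> T.Stab x" "h \<in> T.Stab x"
  shows "g \<star> h = h \<star> g"
  using finite_subgroup_abelian subgroup_of_Gamma[OF T.subgroup_Stab] vertex_stabilizer_finite assms by blast

text \<open>An element preserving an oriented edge fixes both ends, because tail and head are unique
  up to \<open>T.eqv\<close>.\<close>

lemma nonfree_wall_Stab:
  assumes w: "w \<in> walls" "w \<notin> T.free_walls"
  obtains g where "g \<noteq> \<one>\<^bsub>PSL2\<^esub>" "\<And>x. T.origin w x \<Longrightarrow> g \<in> T.Stab x" "\<And>y. T.origin (norms - w) y \<Longrightarrow> g \<in> T.Stab y"
proof -
  obtain g where g: "g \<in> carrier \<Gamma>" "act g ` w = w" "g \<noteq> \<one>\<^bsub>PSL2\<^esub>"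
    using w by (auto simp: T.free_walls_def)
  have g': "act g ` (norms - w) = norms - w" using T.image_compl[OF g(1) w(1)] g(2) by simp
  have "g \<in> T.Stab x" if "T.origin u x" "u \<in> walls" "act g ` u = u" for u x
    using T.origin_unique[OF that(2) _ that(1)] T.origin_act[OF g(1) that(1)] that(3) g(1)
    by (simp add: T.Stab_def)
  then show ?thesis using that g g' w(1) T.wall_compl[OF w(1)] by metis
qed

sublocale F: free_wall_action norms T.free_walls \<Gamma> act
proof (rule T.free_walls_action)
  fix g assume "g \<in> carrier \<Gamma>" "g \<otimes>\<^bsub>\<Gamma>\<^esub> g = \<one>\<^bsub>\<Gamma>\<^esub>"
  then have "g \<in> G" "g \<star> g = \<one>\<^bsub>PSL2\<^esub>" by simp_all
  then have "g = \<one>\<^bsub>PSL2\<^esub>" using no_2_torsion by blast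
  then show "g = \<one>\<^bsub>\<Gamma>\<^esub>" by simp
qed

lemma F_eqv_iff: "F.eqv x y \<longleftrightarrow> (\<forall>w\<in>T.sep x y. w \<notin> T.free_walls)"
proof -
  have "T.free_walls \<subseteq> walls" unfolding T.free_walls_def by blast
  then show ?thesis unfolding F.eqv_def F.sep_def T.sep_def by blast
qed

text \<open>Along a path crossing only walls with nontrivial stabilizers, consecutive vertex stabilizers
  share a nontrivial regular element, and commuting is transitive on regular elements.\<close>

lemma block_commute:
  assumes c: "regular c" and y: "y \<in> norms"
    and w: "w \<in> norms" "F.eqv w y" and comm: "\<And>d. d \<in> T.Stab w \<Longrightarrow> c \<star> d = d \<star> c"
    and d: "d \<in> T.Stab y"
  shows "c \<star> d = d \<star> c"
  using w comm
proof (induction "card (T.sep w y)" arbitrary: w rule: less_induct)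
  case less
  have cG: "c \<in> G" using c by (simp add: regular_def)
  show ?case
  proof (cases "T.eqv w y")
    case True
    have dG: "d \<in> carrier \<Gamma>" and dy: "T.eqv (act d y) y" using d by (auto simp: T.Stab_def)
    have "T.eqv (act d w) (act d y)" using T.eqv_act[OF dG less.prems(1) y] True by blast
    then have "T.eqv (act d w) y"
      using T.eqv_trans[OF _ _ y _ dy] T.act_closed dG less.prems(1) y by blast
    then have "T.eqv (act d w) w"
      using T.eqv_trans[OF _ y less.prems(1)] T.eqv_sym[OF less.prems(1) y True] T.act_closed dG less.prems(1) by blast
    then have "d \<in> T.Stab w" using dG by (simp add: T.Stab_def)
    then show ?thesis using less.prems(3) by blast
  next
    case False
    let ?h = "T.dir w y"
    have h: "?h \<in> T.sep w y" "?h \<in> walls" using T.dir_max(1) T.dir_W less.prems(1) y False by auto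
    then have nf: "?h \<notin> T.free_walls" using less.prems(2) F_eqv_iff by blast
    obtain t where t: "T.origin (norms - ?h) t" using T.origin_exists[OF T.wall_compl[OF h(2)]] by blast
    have tV: "t \<in> norms" using t by (simp add: T.origin_def)
    have lt: "T.sep t y \<subset> T.sep w y" using T.compl_dir_step[OF less.prems(1) y False t] .
    have "finite (T.sep w y)" unfolding T.sep_def using T.finite_sep[OF less.prems(1) y] .
    then have card: "card (T.sep t y) < card (T.sep w y)" using lt by (rule psubset_card_mono)
    have ty: "F.eqv t y" using lt less.prems(2) F_eqv_iff by blast
    obtain g where g: "g \<noteq> \<one>\<^bsub>PSL2\<^esub>" "g \<in> T.Stab w" "g \<in> T.Stab t"
      using nonfree_wall_Stab[OF h(2) nf] T.origin_dir[OF less.prems(1) y False] t by metis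
    have reg: "regular g" using vertex_stabilizer_regular[OF tV g(3,1)] .
    have cg: "g \<star> c = c \<star> g" using less.prems(3)[OF g(2)] by simp
    \<comment> \<open>Both c and e commute with the regular element g shared by the two neighbouring
      vertices.\<close>
    have "c \<star> e = e \<star> c" if e: "e \<in> T.Stab t" for e
    proof -
      have "e \<in> G" using e by (simp add: T.Stab_def)
      then show ?thesis
        using regular_centralizer[OF reg cG cg] vertex_stabilizer_abelian[OF tV g(3) e] by blast
    qed
    then show ?thesis using less.hyps[OF card tV ty] by blast
  qed
qed

text \<open>For c nontrivial in the stabilizer of the vertex x, its conjugate by g fixes the vertex
  g x of the same block and so commutes with c; by \<open>regular_normalizer\<close> g commutes with
  c too. If the vertex stabilizer is trivial, no edge at x is collapsed and the block is x
  alone.\<close>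

lemma block_stabilizer:
  assumes x: "x \<in> norms"
  shows "F.Stab x = {\<one>\<^bsub>PSL2\<^esub>} \<or> (\<exists>c\<in>F.Stab x. regular c \<and> (\<forall>g\<in>F.Stab x. c \<star> g = g \<star> c))"
proof (cases "T.Stab x \<subseteq> {\<one>\<^bsub>PSL2\<^esub>}")
  case True
  have "g = \<one>\<^bsub>PSL2\<^esub>" if g: "g \<in> F.Stab x" for g
  proof -
    have gG: "g \<in> carrier \<Gamma>" and ge: "F.eqv (act g x) x" using g by (auto simp: F.Stab_def)
    have gx: "act g x \<in> norms" using T.act_closed gG x by blast
    have ge': "F.eqv x (act g x)" using F.eqv_sym[OF gx x ge] .
    have "T.eqv x (act g x)"
    proof (rule ccontr)
      assume ne: "\<not> T.eqv x (act g x)"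
      let ?h = "T.dir x (act g x)"
      have h: "?h \<in> T.sep x (act g x)" "?h \<in> walls" using T.dir_max(1) T.dir_W x gx ne by auto
      then have "?h \<notin> T.free_walls" using ge' F_eqv_iff by blast
      then obtain k where "k \<noteq> \<one>\<^bsub>PSL2\<^esub>" "k \<in> T.Stab x"
        using nonfree_wall_Stab[OF h(2)] T.origin_dir[OF x gx ne] by metis
      then show False using True by blast
    qed
    then have "g \<in> T.Stab x" using T.eqv_sym[OF x gx] gG by (simp add: T.Stab_def)
    then show ?thesis using True by blast
  qed
  moreover have "\<one>\<^bsub>PSL2\<^esub> \<in> F.Stab x" using subgroup.one_closed[OF F.subgroup_Stab[OF x]] by simp
  ultimately show ?thesis by blast
next
  case False
  then obtain c where c: "c \<in> T.Stab x" "c \<noteq> \<one>\<^bsub>PSL2\<^esub>" by blast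
  have reg: "regular c" using vertex_stabilizer_regular[OF x c] .
  have cG: "c \<in> carrier \<Gamma>" using c by (simp add: T.Stab_def)
  have cF: "c \<in> F.Stab x" using c F_eqv_iff by (auto simp: T.Stab_def F.Stab_def T.eqv_def)
  have "c \<star> g = g \<star> c" if g: "g \<in> F.Stab x" for g
  proof -
    have gG: "g \<in> carrier \<Gamma>" and ge: "F.eqv (act g x) x" using g by (auto simp: F.Stab_def)
    have gx: "act g x \<in> norms" using T.act_closed gG x by blast
    let ?d = "g \<otimes>\<^bsub>\<Gamma>\<^esub> c \<otimes>\<^bsub>\<Gamma>\<^esub> inv\<^bsub>\<Gamma>\<^esub> g"
    have dG: "?d \<in> carrier \<Gamma>" using gG cG T.m_closed T.inv_closed by blast
    have "act ?d (act g x) = act g (act c x)"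
      using T.act_mult[OF T.m_closed[OF gG cG] T.inv_closed[OF gG] gx] T.act_inv[OF gG x] T.act_mult[OF gG cG x] by simp
    moreover have "T.eqv (act g (act c x)) (act g x)"
      using T.eqv_act[OF gG T.act_closed[OF cG x] x] c(1) by (simp add: T.Stab_def)
    ultimately have d: "?d \<in> T.Stab (act g x)" using dG by (simp add: T.Stab_def)
    have "c \<star> ?d = ?d \<star> c"
      using block_commute[OF reg gx x F.eqv_sym[OF gx x ge] _ d] vertex_stabilizer_abelian[OF x c(1)] by blast
    moreover have "?d = g \<star> c \<star> inv\<^bsub>PSL2\<^esub> g"
      using PSL2.m_inv_consistent[OF sub] gG by simp
    ultimately show ?thesis using regular_normalizer[OF reg, of g] gG by simp
  qed
  then show ?thesis using reg cF by blast
qed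

lemma block_stabilizer_structure:
  assumes x: "x \<in> norms"
  shows "cyclic_group (psl2_on (F.Stab x)) \<or>
    (\<exists>n>0. psl2_on (F.Stab x) \<cong> DirProd (integer_mod_group n) integer_group)"
proof -
  note H = subgroup_of_Gamma[OF F.subgroup_Stab[OF x]]
  from block_stabilizer[OF x] show ?thesis
  proof
    assume one: "F.Stab x = {\<one>\<^bsub>PSL2\<^esub>}"
    have "trivial_group (psl2_on (F.Stab x))"
      unfolding trivial_group_def using PSL2.subgroup_imp_group[OF H(1)] one by simp
    then show ?thesis using trivial_imp_cyclic_group by blast
  next
    assume "\<exists>c\<in>F.Stab x. regular c \<and> (\<forall>g\<in>F.Stab x. c \<star> g = g \<star> c)"
    then obtain c where c: "c \<in> F.Stab x" "regular c" "\<And>g. g \<in> F.Stab x \<Longrightarrow> c \<star> g = g \<star> c" by blast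
    obtain A where A: "m2_det A = 1" "c = psl2_class A" "m2_tr A \<noteq> 0" "(m2_tr A)\<^sup>2 \<noteq> 4"
      using c(2) by (auto simp: regular_def)
    interpret torus_subgroup v G "F.Stab x" A
      by (rule torus_subgroup.intro[OF discrete_PSL2_axioms], rule torus_subgroup_axioms.intro)
        (use H A c in simp_all)
    show ?thesis by (rule torus_structure)
  qed
qed

theorem free_product_structure:
  "\<exists>\<H>. free_product_of \<Gamma> \<H> \<and> (\<forall>H\<in>\<H>. cyclic_group (psl2_on H) \<or>
     (\<exists>n>0. psl2_on H \<cong> DirProd (integer_mod_group n) integer_group))"
proof -
  have "norms \<noteq> {}" using pt_norms by blast
  from F.free_product_of_stabilizers[OF this]
  obtain \<H> where \<H>: "free_product_of \<Gamma> \<H>"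
    "\<And>H. H \<in> \<H> \<Longrightarrow> (\<exists>x\<in>norms. H = F.Stab x) \<or> (\<exists>c\<in>carrier \<Gamma>. H = generate \<Gamma> {c})" by blast
  have "cyclic_group (psl2_on (generate \<Gamma> {c}))" if c: "c \<in> carrier \<Gamma>" for c
    using T.cyclic_group_generated[of c] c by (simp add: subgroup_generated_def)
  then show ?thesis using \<H> block_stabilizer_structure by blast
qed

end

theorem theoremB:
  fixes v :: "'a::field_char_0 \<Rightarrow> real"
    and G :: "'a m2 set set"
  assumes "nonarch_local_field v"
    and "subgroup G PSL2"
    and "psl2_discrete v G"
    and "\<forall>g \<in> G. g \<otimes>\<^bsub>PSL2\<^esub> g = \<one>\<^bsub>PSL2\<^esub> \<longrightarrow> g = \<one>\<^bsub>PSL2\<^esub>"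
  shows "\<exists>\<H>. free_product_of (PSL2\<lparr>carrier := G\<rparr>) \<H> \<and>
           (\<forall>H \<in> \<H>. cyclic_group (PSL2\<lparr>carrier := H\<rparr>) \<or>
                     (\<exists>n>0. PSL2\<lparr>carrier := H\<rparr> \<cong> DirProd (integer_mod_group n) integer_group))"
proof -
  interpret discrete_PSL2 v G
    by (intro discrete_PSL2.intro local_field.intro discrete_PSL2_axioms.intro assms)
  show ?thesis by (rule free_product_structure)
qed

end
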